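(* Let $\Gamma$ be a uniform irreducible lattice of $G=\mathrm{PSL}(2,\mathbb{R})\times\mathrm{PSL}(2,\mathbb{R})$. Let $g=(g_1,g_2)\in G$ and $x=\Gamma g\in\Gamma\backslash G$ be such that one of the points $g_1(0),g_1(\infty)$ (in the first factor $\partial\mathbb{H}$), $g_2(0),g_2(\infty)$ (in the second factor $\partial\mathbb{H}$) is fixed by a non-trivial element of $\Gamma$. Then the orbit $xA$ is either closed or dense in $\Gamma\backslash G$.
   Context: A lattice in $G=\mathrm{PSL}(2,\mathbb{R})\times\mathrm{PSL}(2,\mathbb{R})$ is a discrete subgroup of finite covolume; it is uniform if $\Gamma\backslash G$ is compact. It is reducible if, up to finite index, it is a product of two lattices of $\mathrm{PSL}(2,\mathbb{R})$ (one in each factor), and irreducible otherwise. $A$ is the maximal diagonal subgroup of $G$, i.e. the group of all pairs $\left(\pm\begin{pmatrix}\lambda_1&0\\0&\lambda_1^{-1}\end{pmatrix},\pm\begin{pmatrix}\lambda_2&0\\0&\lambda_2^{-1}\end{pmatrix}\right)$ with $\lambda_1,\lambda_2>0$, acting on $\Gamma\backslash G$ by right translation; $xA=\{xa:a\in A\}$. $\partial\mathbb{H}=\mathbb{R}\cup\{\infty\}$ is the boundary of the upper half-plane $\mathbb{H}$, on which $\mathrm{PSL}(2,\mathbb{R})$ acts by Möbius transformations. The group $G$ acts on each factor of $\partial\mathbb{H}\times\partial\mathbb{H}$ through the corresponding component: $\gamma=(\gamma_1,\gamma_2)$ fixes a point $\xi_i$ of the $i$-th factor if $\gamma_i(\xi_i)=\xi_i$.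 *)

theory Defs
  imports "HOL-Analysis.Analysis" "HOL-Algebra.Coset"
begin

section \<open>Quotient topology\<close>

definition quotient_topology :: "'a topology \<Rightarrow> ('a \<Rightarrow> 'b) \<Rightarrow> 'b topology" where
  "quotient_topology X f =
     topology (\<lambda>U. U \<subseteq> f ` topspace X \<and> openin X {x \<in> topspace X. f x \<in> U})"

lemma openin_quotient_topology:
  "openin (quotient_topology X f) U \<longleftrightarrow>
     U \<subseteq> f ` topspace X \<and> openin X {x \<in> topspace X. f x \<in> U}"
proof -
  have "istopology (\<lambda>U. U \<subseteq> f ` topspace X \<and> openin X {x \<in> topspace X. f x \<in> U})"
    unfolding istopology_def
  proof (intro conjI allI impI)
    fix S T
    assume "S \<subseteq> f ` topspace X \<and> openin X {x \<in> topspace X. f x \<in> S}"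
      and "T \<subseteq> f ` topspace X \<and> openin X {x \<in> topspace X. f x \<in> T}"
    moreover have "{x \<in> topspace X. f x \<in> S \<inter> T} =
        {x \<in> topspace X. f x \<in> S} \<inter> {x \<in> topspace X. f x \<in> T}" by auto
    ultimately show "S \<inter> T \<subseteq> f ` topspace X" "openin X {x \<in> topspace X. f x \<in> S \<inter> T}"
      by auto
  next
    fix K
    assume *: "\<forall>S\<in>K. S \<subseteq> f ` topspace X \<and> openin X {x \<in> topspace X. f x \<in> S}"
    then show "\<Union>K \<subseteq> f ` topspace X" by blast
    have "{x \<in> topspace X. f x \<in> \<Union>K} = (\<Union>S\<in>K. {x \<in> topspace X. f x \<in> S})" by auto
    then show "openin X {x \<in> topspace X. f x \<in> \<Union>K}" using * by auto
  qed
  then show ?thesis by (simp add: quotient_topology_def)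
qed

lemma topspace_quotient_topology: "topspace (quotient_topology X f) = f ` topspace X"
proof -
  have "{x \<in> topspace X. f x \<in> f ` topspace X} = topspace X" by auto
  then have "openin (quotient_topology X f) (f ` topspace X)"
    by (simp add: openin_quotient_topology)
  then show ?thesis
    by (metis openin_quotient_topology openin_subset openin_topspace subset_antisym)
qed

lemma quotient_map_quotient_topology: "quotient_map X (quotient_topology X f) f"
  by (auto simp: quotient_map_def topspace_quotient_topology openin_quotient_topology)


section \<open>Lattices in topological groups\<close>

text \<open>A topological group is given by a group \<open>G\<close> together with a topology \<open>T\<close> whose
  space is the carrier of \<open>G\<close>.\<close>

definition coset_topology :: "('a, 'b) monoid_scheme \<Rightarrow> 'a topology \<Rightarrow> 'a set \<Rightarrow> 'a set topology"
  where "coset_topology G T \<Gamma> = quotient_topology T (\<lambda>g. \<Gamma> #>\<^bsub>G\<^esub> g)"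

definition discrete_subgroup :: "('a, 'b) monoid_scheme \<Rightarrow> 'a topology \<Rightarrow> 'a set \<Rightarrow> bool"
  where "discrete_subgroup G T \<Gamma> \<longleftrightarrow> subgroup \<Gamma> G \<and> subtopology T \<Gamma> = discrete_topology \<Gamma>"

text \<open>Regularity of the measure is not required: on the locally compact, second countable groups
  considered here it follows from finiteness on compact sets.\<close>

definition haar_measure :: "('a, 'b) monoid_scheme \<Rightarrow> 'a topology \<Rightarrow> 'a measure \<Rightarrow> bool"
  where "haar_measure G T \<mu> \<longleftrightarrow>
    space \<mu> = topspace T \<and> sets \<mu> = sigma_sets (topspace T) {U. openin T U} \<and>
    (\<forall>K. compactin T K \<longrightarrow> emeasure \<mu> K < \<infinity>) \<and>
    emeasure \<mu> (space \<mu>) \<noteq> 0 \<and>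
    (\<forall>g \<in> carrier G. \<forall>B \<in> sets \<mu>. emeasure \<mu> (g <#\<^bsub>G\<^esub> B) = emeasure \<mu> B)"

text \<open>The covolume of a discrete subgroup \<open>\<Gamma>\<close> is the Haar measure of a Borel set \<open>F\<close> of
  representatives of \<open>\<Gamma>\<backslash>G\<close>; whether it is finite depends neither on \<open>F\<close>
  nor on the normalisation of the Haar measure.\<close>

definition finite_covolume :: "('a, 'b) monoid_scheme \<Rightarrow> 'a topology \<Rightarrow> 'a set \<Rightarrow> bool"
  where "finite_covolume G T \<Gamma> \<longleftrightarrow>
    (\<exists>\<mu> F. haar_measure G T \<mu> \<and> F \<in> sets \<mu> \<and>
       (\<forall>x \<in> rcosets\<^bsub>G\<^esub> \<Gamma>. \<exists>!f. f \<in> F \<inter> x) \<and> emeasure \<mu> F < \<infinity>)"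

definition lattice_subgroup :: "('a, 'b) monoid_scheme \<Rightarrow> 'a topology \<Rightarrow> 'a set \<Rightarrow> bool"
  where "lattice_subgroup G T \<Gamma> \<longleftrightarrow> discrete_subgroup G T \<Gamma> \<and> finite_covolume G T \<Gamma>"

definition uniform_lattice :: "('a, 'b) monoid_scheme \<Rightarrow> 'a topology \<Rightarrow> 'a set \<Rightarrow> bool"
  where "uniform_lattice G T \<Gamma> \<longleftrightarrow>
    lattice_subgroup G T \<Gamma> \<and> compact_space (coset_topology G T \<Gamma>)"

definition finite_index_subgroup :: "('a, 'b) monoid_scheme \<Rightarrow> 'a set \<Rightarrow> 'a set \<Rightarrow> bool"
  where "finite_index_subgroup G H K \<longleftrightarrow>
    subgroup H G \<and> subgroup K G \<and> H \<subseteq> K \<and> finite (rcosets\<^bsub>G\<lparr>carrier := K\<rparr>\<^esub> H)"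


section \<open>\<open>PSL(2,\<real>)\<close> and its square\<close>

definition SL2 :: "(real^2^2) monoid" where
  "SL2 = \<lparr>carrier = {M. det M = 1}, monoid.mult = (**), one = mat 1\<rparr>"

definition SL2_centre :: "(real^2^2) set" where
  "SL2_centre = {mat 1, - mat 1}"

text \<open>Elements of \<open>PSL(2,\<real>)\<close> are the cosets \<open>{M, - M}\<close>.\<close>

definition PSL2 :: "(real^2^2) set monoid" where
  "PSL2 = SL2 Mod SL2_centre"

definition psl :: "real^2^2 \<Rightarrow> (real^2^2) set" where
  "psl M = SL2_centre #>\<^bsub>SL2\<^esub> M"

definition PSL2_top :: "(real^2^2) set topology" where
  "PSL2_top = quotient_topology (top_of_set (carrier SL2)) psl"

type_synonym psl2_pair = "(real^2^2) set \<times> (real^2^2) set"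

definition PSL2_sq :: "psl2_pair monoid" where
  "PSL2_sq = PSL2 \<times>\<times> PSL2"

definition PSL2_sq_top :: "psl2_pair topology" where
  "PSL2_sq_top = prod_topology PSL2_top PSL2_top"

definition reducible_lattice :: "psl2_pair set \<Rightarrow> bool" where
  "reducible_lattice \<Gamma> \<longleftrightarrow>
    (\<exists>\<Gamma>\<^sub>1 \<Gamma>\<^sub>2. lattice_subgroup PSL2 PSL2_top \<Gamma>\<^sub>1 \<and> lattice_subgroup PSL2 PSL2_top \<Gamma>\<^sub>2 \<and>
       finite_index_subgroup PSL2_sq (\<Gamma>\<^sub>1 \<times> \<Gamma>\<^sub>2) \<Gamma>)"

definition diag2 :: "real \<Rightarrow> real^2^2" where
  "diag2 l = vector [vector [l, 0], vector [0, inverse l]]"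

definition diag_subgroup :: "psl2_pair set" where
  "diag_subgroup = {(psl (diag2 l\<^sub>1), psl (diag2 l\<^sub>2)) | l\<^sub>1 l\<^sub>2. l\<^sub>1 > 0 \<and> l\<^sub>2 > 0}"

text \<open>A point of \<open>\<Gamma>\<backslash>G\<close> is a coset \<open>x = \<Gamma>g\<close>, and the right translate
  of the point \<open>x\<close> by \<open>a\<close> is the coset \<open>\<Gamma>ga\<close>.\<close>

definition diag_orbit :: "psl2_pair set \<Rightarrow> psl2_pair set set" where
  "diag_orbit x = (\<lambda>a. x #>\<^bsub>PSL2_sq\<^esub> a) ` diag_subgroup"


section \<open>The boundary of the upper half-plane\<close>

datatype boundary = Fin real | Infty

fun mobius :: "real^2^2 \<Rightarrow> boundary \<Rightarrow> boundary" where
  "mobius M (Fin x) =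
     (if M$2$1 * x + M$2$2 = 0 then Infty
      else Fin ((M$1$1 * x + M$1$2) / (M$2$1 * x + M$2$2)))"
| "mobius M Infty = (if M$2$1 = 0 then Infty else Fin (M$1$1 / M$2$1))"

text \<open>The choice of the representative is immaterial, see \<open>psl_act_psl\<close> below.\<close>

definition psl_act :: "(real^2^2) set \<Rightarrow> boundary \<Rightarrow> boundary" where
  "psl_act p \<xi> = mobius (SOME M. M \<in> p) \<xi>"


section \<open>Consistency of the definitions\<close>

lemma psl_eq: "psl M = {M, - M}"
proof -
  have "- mat 1 ** M = - M"
    by (simp add: vec_eq_iff forall_2 matrix_matrix_mult_def sum_2 mat_def)
  then show ?thesis by (auto simp: psl_def SL2_centre_def SL2_def r_coset_def)
qed

lemma mobius_uminus: "mobius (- M) \<xi> = mobius M \<xi>"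
proof (cases \<xi>)
  case (Fin x)
  have "(- M)$2$1 * x + (- M)$2$2 = - (M$2$1 * x + M$2$2)"
       "(- M)$1$1 * x + (- M)$1$2 = - (M$1$1 * x + M$1$2)" by simp_all
  then show ?thesis using Fin
    by (simp only: mobius.simps neg_equal_0_iff_equal minus_divide_divide)
qed simp

lemma psl_act_psl: "psl_act (psl M) \<xi> = mobius M \<xi>"
proof -
  have "(SOME N. N \<in> psl M) \<in> psl M"
    by (rule someI[of _ M]) (simp add: psl_eq)
  then show ?thesis
    unfolding psl_act_def psl_eq by (metis mobius_uminus insertE singletonD)
qed

lemma group_SL2: "group SL2"
proof (rule groupI)
  fix M assume M: "M \<in> carrier SL2"
  then have "invertible M" by (simp add: SL2_def invertible_det_nz)
  then obtain N where N: "N ** M = mat 1" by (auto simp: invertible_def)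
  then have "det N * det M = 1" by (metis det_I det_mul)
  with M N have "N \<in> carrier SL2" "N \<otimes>\<^bsub>SL2\<^esub> M = \<one>\<^bsub>SL2\<^esub>" by (simp_all add: SL2_def)
  then show "\<exists>N \<in> carrier SL2. N \<otimes>\<^bsub>SL2\<^esub> M = \<one>\<^bsub>SL2\<^esub>" by blast
qed (auto simp: SL2_def det_mul matrix_mul_assoc)

lemma normal_SL2_centre: "SL2_centre \<lhd> SL2"
proof -
  interpret group SL2 by (rule group_SL2)
  have d: "det (- mat 1 :: real^2^2) = 1" by (simp add: det_2 mat_def)
  have l: "- mat 1 ** M = - M" and r: "M ** - mat 1 = - M" for M :: "real^2^2"
    by (simp_all add: vec_eq_iff forall_2 matrix_matrix_mult_def sum_2 mat_def)
  have "inv\<^bsub>SL2\<^esub> (- mat 1) = - mat 1"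
    by (rule inv_equality) (auto simp: SL2_def l d)
  moreover have "inv\<^bsub>SL2\<^esub> (mat 1) = mat 1"
    using inv_one by (simp add: SL2_def)
  ultimately have "subgroup SL2_centre SL2"
    by (intro subgroupI) (auto simp: SL2_centre_def SL2_def l r d)
  moreover have "SL2_centre #>\<^bsub>SL2\<^esub> M = M <#\<^bsub>SL2\<^esub> SL2_centre" for M
    by (auto simp: r_coset_def l_coset_def SL2_centre_def SL2_def l r)
  ultimately show ?thesis
    by (simp add: normal_def normal_axioms_def group_axioms)
qed

lemma group_PSL2: "group PSL2"
  unfolding PSL2_def by (rule normal.factorgroup_is_group[OF normal_SL2_centre])

lemma group_PSL2_sq: "group PSL2_sq"
  unfolding PSL2_sq_def by (intro DirProd_group group_PSL2)

lemma carrier_PSL2: "carrier PSL2 = psl ` carrier SL2"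
  unfolding PSL2_def carrier_FactGroup psl_def by (rule refl)

lemma topspace_PSL2_top: "topspace PSL2_top = carrier PSL2"
  by (simp add: PSL2_top_def topspace_quotient_topology carrier_PSL2)

lemma topspace_PSL2_sq_top: "topspace PSL2_sq_top = carrier PSL2_sq"
  by (simp add: PSL2_sq_top_def PSL2_sq_def topspace_PSL2_top)

lemma topspace_coset_topology:
  "topspace (coset_topology PSL2_sq PSL2_sq_top \<Gamma>) = rcosets\<^bsub>PSL2_sq\<^esub> \<Gamma>"
  by (auto simp: coset_topology_def topspace_quotient_topology topspace_PSL2_sq_top RCOSETS_def)

lemma diag_subgroup_subset: "diag_subgroup \<subseteq> carrier PSL2_sq"
  by (auto simp: diag_subgroup_def PSL2_sq_def carrier_PSL2 SL2_def diag2_def det_2)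

end

theory Submission
  imports Defs
begin

text \<open>Lift the lattice to \<open>SL(2,\<real>) \<times> SL(2,\<real>)\<close>. Since \<open>\<Gamma>\<close> is uniform, its conjugacy classes
  are closed in \<open>G\<close>, so no component of an element of \<open>\<Gamma>\<close> is parabolic. If a projection of
  \<open>\<Gamma>\<close> to a factor were discrete, \<open>\<Gamma>\<close> would be commensurable to the product of its two kernels;
  hence for irreducible \<open>\<Gamma>\<close> both projections are nondiscrete, and as they normalise no line in the
  Lie algebra, they are dense. It follows that the projections are injective and, by contracting the
  boundary circle of one factor with elements that are close to the identity in the other one, that
  every orbit of \<open>1 \<times> B\<close> on \<open>\<Gamma>\<backslash>G\<close> is dense, for \<open>B\<close> a Borel subgroup.

  Let \<open>\<gamma> \<in> \<Gamma>\<close> fix \<open>g\<^sub>1(\<infinity>)\<close>. Then \<open>\<gamma>\<^sub>1\<close> is hyperbolic and \<open>g\<^sub>1 = h\<^sub>1 u\<close> with \<open>u\<close> unipotent and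
  \<open>h\<^sub>1\<close> diagonalising \<open>\<gamma>\<^sub>1\<close>. The centraliser of \<open>\<gamma>\<close> in \<open>\<Gamma>\<close> has dense projections to the one-parameter
  groups that centralise \<open>\<gamma>\<^sub>1\<close> and \<open>\<gamma>\<^sub>2\<close>. Contracting \<open>u\<close> by the diagonal group of the first
  factor therefore places \<open>\<Gamma>(h\<^sub>1, z g\<^sub>2)\<close> in the closure of \<open>xA\<close>, for all \<open>z\<close> in the one-parameter
  group centralising \<open>\<gamma>\<^sub>2\<close>. The diagonal group of the second factor expands this curve to full
  unipotent orbits, so the closure contains an orbit of \<open>1 \<times> B\<close> and is everything, unless \<open>g\<^sub>2\<close>
  diagonalises \<open>\<gamma>\<^sub>2\<close>. In that case \<open>xA\<close> is a compact torus if \<open>u = 1\<close>, and if \<open>u \<noteq> 1\<close> the same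
  argument applies with the factors exchanged.\<close>

section \<open>Two-by-two real matrices\<close>

text \<open>Irreducibility is a negative hypothesis, so using it means exhibiting a product of two
  lattices: when the projections are discrete, the kernels must be certified as lattices of one
  factor, with a Haar measure and a strict Borel set of representatives. Hence the measure theory in
  the last part.

  Cocompactness enters as a norm bound: every pair is an element of the lifted lattice times a pair
  of norm at most \<open>R\<close>. Together with discreteness it gives finiteness statements, and
  limits of lattice elements become equalities.

  The unipotent \<open>u\<close> is contracted by torus elements of \<open>\<Gamma>\<close> whose
  first logarithmic coordinate tends to minus infinity while the second stays bounded; boundedness
  lets the second components subconverge. The same elements give the dense projection: by
  injectivity the second coordinate determines the first, so infinitely many second coordinates lie
  in one bounded interval. For elliptic \<open>\<gamma>\<^sub>2\<close> the multiples of a single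
  element suffice, after reducing angles modulo 2 pi.\<close>

definition mat2 :: "real \<Rightarrow> real \<Rightarrow> real \<Rightarrow> real \<Rightarrow> real^2^2" where
  "mat2 a b c d = vector [vector [a, b], vector [c, d]]"

lemma mat2_nth [simp]:
  "mat2 a b c d $1$1 = a" "mat2 a b c d $1$2 = b"
  "mat2 a b c d $2$1 = c" "mat2 a b c d $2$2 = d"
  by (simp_all add: mat2_def)

lemma mat_eq_iff:
  fixes M N :: "real^2^2"
  shows "M = N \<longleftrightarrow> M$1$1 = N$1$1 \<and> M$1$2 = N$1$2 \<and> M$2$1 = N$2$1 \<and> M$2$2 = N$2$2"
  by (auto simp: vec_eq_iff forall_2)

lemma mat_mult_nth [simp]:
  fixes M N :: "real^2^2"
  shows "(M ** N)$1$1 = M$1$1 * N$1$1 + M$1$2 * N$2$1"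
    "(M ** N)$1$2 = M$1$1 * N$1$2 + M$1$2 * N$2$2"
    "(M ** N)$2$1 = M$2$1 * N$1$1 + M$2$2 * N$2$1"
    "(M ** N)$2$2 = M$2$1 * N$1$2 + M$2$2 * N$2$2"
  by (simp_all add: matrix_matrix_mult_def sum_2)

lemma mat_one_nth [simp]:
  "(mat 1 :: real^2^2)$1$1 = 1" "(mat 1 :: real^2^2)$1$2 = 0"
  "(mat 1 :: real^2^2)$2$1 = 0" "(mat 1 :: real^2^2)$2$2 = 1"
  by (simp_all add: mat_def)

lemma det_mat2 [simp]: "det (mat2 a b c d) = a * d - b * c"
  by (simp add: det_2)

lemma mat_mult_minus [simp]:
  fixes M N :: "real^2^2"
  shows "(- M) ** N = - (M ** N)" "M ** (- N) = - (M ** N)"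
  by (simp_all add: mat_eq_iff)

lemma det_minus2 [simp]: "det (- M :: real^2^2) = det M"
  by (simp add: det_2)

text \<open>The adjugate agrees with the inverse on determinant one, but it is linear and total, so
  product rules and limits carry no invertibility hypotheses.\<close>

definition adj2 :: "real^2^2 \<Rightarrow> real^2^2" where
  "adj2 M = mat2 (M$2$2) (- (M$1$2)) (- (M$2$1)) (M$1$1)"

lemma adj2_nth [simp]:
  "adj2 M $1$1 = M$2$2" "adj2 M $1$2 = - (M$1$2)"
  "adj2 M $2$1 = - (M$2$1)" "adj2 M $2$2 = M$1$1"
  by (simp_all add: adj2_def)

lemma det_adj2 [simp]: "det (adj2 M) = det M"
  by (simp add: det_2)

lemma adj2_adj2 [simp]: "adj2 (adj2 M) = M"
  by (simp add: mat_eq_iff)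

lemma adj2_one [simp]: "adj2 (mat 1) = mat 1"
  by (simp add: mat_eq_iff)

lemma adj2_minus [simp]: "adj2 (- M) = - adj2 M"
  by (simp add: mat_eq_iff)

lemma adj2_mult: "adj2 (M ** N) = adj2 N ** adj2 M"
  by (simp add: mat_eq_iff)

lemma adj2_left: "det M = 1 \<Longrightarrow> adj2 M ** M = mat 1"
  and adj2_right: "det M = 1 \<Longrightarrow> M ** adj2 M = mat 1"
  by (simp_all add: mat_eq_iff det_2 algebra_simps)

lemma adj2_cancel:
  assumes "det M = 1"
  shows "adj2 M ** (M ** N) = N" "M ** (adj2 M ** N) = N"
    "N ** M ** adj2 M = N" "N ** adj2 M ** M = N"
  using adj2_left[OF assms] adj2_right[OF assms]
  by (simp_all add: matrix_mul_assoc) (simp_all flip: matrix_mul_assoc)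

lemma det_one_mult: "det M = 1 \<Longrightarrow> det N = 1 \<Longrightarrow> det (M ** N) = (1::real)"
  by (simp add: det_mul)

lemma conj_eq_iff:
  assumes "det g = 1"
  shows "adj2 g ** M ** g = N \<longleftrightarrow> M ** g = g ** N"
  by (metis adj2_cancel(2) assms adj2_cancel(1) matrix_mul_assoc)

section \<open>Norm estimates and continuity of the matrix operations\<close>

lemma norm_sq_mat:
  fixes M :: "real^2^2"
  shows "(norm M)\<^sup>2 = (M$1$1)\<^sup>2 + (M$1$2)\<^sup>2 + (M$2$1)\<^sup>2 + (M$2$2)\<^sup>2"
  by (simp add: power2_norm_eq_inner inner_vec_def sum_2) (simp add: power2_eq_square)

lemma norm_mat_entry_le:
  fixes M :: "real^2^2"
  shows "\<bar>M$i$j\<bar> \<le> norm M"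
  by (metis component_le_norm_cart order_trans real_norm_def Finite_Cartesian_Product.norm_nth_le)

lemma norm_mat_mult_le:
  fixes M N :: "real^2^2"
  shows "norm (M ** N) \<le> norm M * norm N"
proof (rule power2_le_imp_le)
  obtain a b c d where M: "a = M$1$1" "b = M$1$2" "c = M$2$1" "d = M$2$2" by blast
  obtain e f g h where N: "e = N$1$1" "f = N$1$2" "g = N$2$1" "h = N$2$2" by blast
  \<comment> \<open>Lagrange's identity for each row of \<open>M\<close> against each column of
    \<open>N\<close>.\<close>
  have "(norm M * norm N)\<^sup>2 - (norm (M ** N))\<^sup>2 =
      (a*g - b*e)\<^sup>2 + (a*h - b*f)\<^sup>2 + (c*g - d*e)\<^sup>2 + (c*h - d*f)\<^sup>2"
    unfolding power_mult_distrib norm_sq_mat mat_mult_nth M[symmetric] N[symmetric]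
    by (simp add: power2_eq_square algebra_simps)
  moreover have "\<dots> \<ge> 0" by simp
  ultimately show "(norm (M ** N))\<^sup>2 \<le> (norm M * norm N)\<^sup>2" by linarith
qed simp

lemma norm_adj2 [simp]: "norm (adj2 M) = norm M"
proof -
  have "(norm (adj2 M))\<^sup>2 = (norm M)\<^sup>2" unfolding norm_sq_mat by simp
  then show ?thesis by simp
qed

lemma bounded_bilinear_mat_mult: "bounded_bilinear ((**) :: real^2^2 \<Rightarrow> real^2^2 \<Rightarrow> real^2^2)"
proof
  show "\<exists>K. \<forall>(a :: real^2^2) (b :: real^2^2). norm (a ** b) \<le> norm a * norm b * K"
    by (intro exI[of _ 1]) (simp add: norm_mat_mult_le)
qed (simp_all add: mat_eq_iff algebra_simps)

lemmas tendsto_mat_mult [tendsto_intros] = bounded_bilinear.tendsto[OF bounded_bilinear_mat_mult]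
lemmas continuous_on_mat_mult [continuous_intros] =
  bounded_bilinear.continuous_on[OF bounded_bilinear_mat_mult]

lemma bounded_linear_adj2: "bounded_linear adj2"
  by (rule bounded_linear_intro[of _ 1]) (simp_all add: mat_eq_iff)

lemmas tendsto_adj2 [tendsto_intros] = bounded_linear.tendsto[OF bounded_linear_adj2]
lemmas continuous_on_adj2 [continuous_intros] = bounded_linear.continuous_on[OF bounded_linear_adj2]

lemma tendsto_mat_iff:
  fixes f :: "'a \<Rightarrow> real^2^2"
  shows "(f \<longlongrightarrow> M) F \<longleftrightarrow>
    ((\<lambda>x. f x$1$1) \<longlongrightarrow> M$1$1) F \<and> ((\<lambda>x. f x$1$2) \<longlongrightarrow> M$1$2) F \<and>
    ((\<lambda>x. f x$2$1) \<longlongrightarrow> M$2$1) F \<and> ((\<lambda>x. f x$2$2) \<longlongrightarrow> M$2$2) F"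
  (is "?L \<longleftrightarrow> ?R")
proof
  show "?L \<Longrightarrow> ?R" by (intro conjI tendsto_vec_nth)
  assume ?R
  show ?L
  proof (intro vec_tendstoI)
    fix i j :: 2
    show "((\<lambda>x. f x $ i $ j) \<longlongrightarrow> M $ i $ j) F"
      using \<open>?R\<close> exhaust_2[of i] exhaust_2[of j] by auto
  qed
qed

lemma tendsto_mat2 [tendsto_intros]:
  "(a \<longlongrightarrow> a') F \<Longrightarrow> (b \<longlongrightarrow> b') F \<Longrightarrow> (c \<longlongrightarrow> c') F \<Longrightarrow> (d \<longlongrightarrow> d') F \<Longrightarrow>
    ((\<lambda>x. mat2 (a x) (b x) (c x) (d x)) \<longlongrightarrow> mat2 a' b' c' d') F"
  by (simp add: tendsto_mat_iff)

lemma tendsto_det2: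
  fixes f :: "'a \<Rightarrow> real^2^2"
  assumes "(f \<longlongrightarrow> M) F"
  shows "((\<lambda>x. det (f x)) \<longlongrightarrow> det M) F"
  unfolding det_2 by (intro tendsto_intros assms)

lemma det_one_limit:
  fixes f :: "nat \<Rightarrow> real^2^2"
  assumes "f \<longlonglongrightarrow> M" "\<And>n. det (f n) = 1"
  shows "det M = 1"
  using tendsto_det2[OF assms(1)] assms(2) by (simp add: LIMSEQ_const_iff)

lemma closed_det_one: "closed {M :: real^2^2. det M = 1}"
  using det_one_limit by (auto simp: closed_sequential_limits)

section \<open>Unipotent, diagonal and Weyl elements; conjugation of traceless matrices\<close>

definition upper2 :: "real \<Rightarrow> real^2^2" where "upper2 x = mat2 1 x 0 1"
definition lower2 :: "real \<Rightarrow> real^2^2" where "lower2 x = mat2 1 0 x 1"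
text \<open>Acts on the boundary by x -> -1/x: it exchanges 0 and \<infinity>, and conjugation by it
  exchanges upper and lower triangular matrices.\<close>

definition weyl2 :: "real^2^2" where "weyl2 = mat2 0 (-1) 1 0"
text \<open>The projection to the Lie algebra. It has the same centraliser as \<open>M\<close> and,
  on determinant one, vanishes exactly at \<plusminus> 1.\<close>

definition trless2 :: "real^2^2 \<Rightarrow> real^2^2" where
  "trless2 M = M - ((M$1$1 + M$2$2) / 2) *\<^sub>R mat 1"

lemma diag2_mat2: "diag2 l = mat2 l 0 0 (inverse l)"
  by (simp add: diag2_def mat2_def)

lemmas special_defs = upper2_def lower2_def weyl2_def diag2_mat2

lemma det_special [simp]:
  "det (upper2 x) = 1" "det (lower2 x) = 1" "det weyl2 = 1" "l \<noteq> 0 \<Longrightarrow> det (diag2 l) = 1"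
  by (simp_all add: special_defs)

lemma upper2_add: "upper2 x ** upper2 y = upper2 (x + y)"
  and lower2_add: "lower2 x ** lower2 y = lower2 (x + y)"
  and diag2_mult: "diag2 a ** diag2 b = diag2 (a * b)"
  by (simp_all add: special_defs mat_eq_iff)

lemma special_one [simp]: "upper2 0 = mat 1" "lower2 0 = mat 1" "diag2 1 = mat 1"
  by (simp_all add: special_defs mat_eq_iff)

lemma adj2_special:
  "adj2 (upper2 x) = upper2 (- x)" "adj2 (lower2 x) = lower2 (- x)"
  "adj2 (diag2 l) = diag2 (inverse l)"
  by (simp_all add: special_defs mat_eq_iff)

lemma trless2_nth [simp]:
  "trless2 M $1$1 = (M$1$1 - M$2$2) / 2" "trless2 M $1$2 = M$1$2"
  "trless2 M $2$1 = M$2$1" "trless2 M $2$2 = (M$2$2 - M$1$1) / 2"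
  by (simp_all add: trless2_def field_simps)

lemma scalar_det_one:
  assumes "det (M :: real^2^2) = 1" "M$1$2 = 0" "M$2$1 = 0" "M$1$1 = M$2$2"
  shows "M = mat 1 \<or> M = - mat 1"
proof -
  have "M$1$1 * M$1$1 = 1" using assms by (simp add: det_2)
  then have "M$1$1 = 1 \<or> M$1$1 = -1" by (simp add: square_eq_1_iff)
  then show ?thesis using assms by (auto simp: mat_eq_iff)
qed

lemma trless2_eq_0_iff:
  assumes "det M = 1"
  shows "trless2 M = 0 \<longleftrightarrow> M = mat 1 \<or> M = - mat 1"
proof
  assume "trless2 M = 0"
  then have 0: "trless2 M $1$1 = 0" "trless2 M $1$2 = 0" "trless2 M $2$1 = 0" by simp_all
  then have "M$1$2 = 0" "M$2$1 = 0" "M$1$1 = M$2$2" unfolding trless2_nth by auto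
  then show "M = mat 1 \<or> M = - mat 1" by (rule scalar_det_one[OF assms])
next
  have "trless2 (mat 1) = 0" "trless2 (- mat 1) = 0" unfolding mat_eq_iff by simp_all
  then show "M = mat 1 \<or> M = - mat 1 \<Longrightarrow> trless2 M = 0" by metis
qed

lemma mat_mult_scaleR [simp]:
  fixes M N :: "real^2^2"
  shows "(c *\<^sub>R M) ** N = c *\<^sub>R (M ** N)" "M ** (c *\<^sub>R N) = c *\<^sub>R (M ** N)"
  by (simp_all add: mat_eq_iff algebra_simps)

lemma mat_mult_diff_distrib:
  fixes M N P :: "real^2^2"
  shows "(M - N) ** P = M ** P - N ** P" "P ** (M - N) = P ** M - P ** N"
  by (simp_all add: mat_eq_iff algebra_simps)

lemma mat_mult_add_distrib:
  fixes M N P :: "real^2^2"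
  shows "(M + N) ** P = M ** P + N ** P" "P ** (M + N) = P ** M + P ** N"
  by (simp_all add: mat_eq_iff algebra_simps)

lemma commute_trless2_iff: "M ** trless2 N = trless2 N ** M \<longleftrightarrow> M ** N = N ** M"
  unfolding trless2_def mat_mult_diff_distrib by simp

lemma det_scaleR2: "det (c *\<^sub>R M :: real^2^2) = c\<^sup>2 * det M"
  by (simp add: det_2 power2_eq_square algebra_simps)

text \<open>Diagonal conjugation rescales an off-diagonal entry at will, and a diagonal
  \<open>Z\<close> acquires one by unipotent conjugation. A cocompact group therefore cannot fix a
  non-zero \<open>Z\<close>, as that would keep the whole conjugation orbit bounded.\<close>

lemma conj_trless2_unbounded:
  assumes "Z \<noteq> 0" "Z$1$1 + Z$2$2 = 0"
  shows "\<exists>A. det A = 1 \<and> norm (adj2 A ** Z ** A) > K"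
proof -
  have big: "norm M > K" if "M$i$j = \<bar>K\<bar> + 1" for i j and M :: "real^2^2"
    using norm_mat_entry_le[of M i j] that by linarith
  consider "Z$1$2 \<noteq> 0" | "Z$2$1 \<noteq> 0" | "Z$1$2 = 0" "Z$2$1 = 0" by blast
  then show ?thesis
  proof cases
    case 1
    define l where "l = sqrt ((\<bar>K\<bar> + 1) / \<bar>Z$1$2\<bar>)"
    have l: "l > 0" "l * l = (\<bar>K\<bar> + 1) / \<bar>Z$1$2\<bar>" using 1 by (auto simp: l_def)
    let ?M = "adj2 (diag2 (inverse l)) ** Z ** diag2 (inverse l)"
    have "?M$1$2 = (l * l) * Z$1$2" by (simp add: diag2_mat2)
    then have "\<bar>?M$1$2\<bar> = \<bar>K\<bar> + 1" unfolding l(2) using 1 by (simp add: abs_mult)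
    then have "norm ?M > K" using norm_mat_entry_le[of ?M 1 2] by linarith
    moreover have "det (diag2 (inverse l)) = 1" using l by simp
    ultimately show ?thesis by blast
  next
    case 2
    define l where "l = sqrt ((\<bar>K\<bar> + 1) / \<bar>Z$2$1\<bar>)"
    have l: "l > 0" "l * l = (\<bar>K\<bar> + 1) / \<bar>Z$2$1\<bar>" using 2 by (auto simp: l_def)
    let ?M = "adj2 (diag2 l) ** Z ** diag2 l"
    have "?M$2$1 = (l * l) * Z$2$1" by (simp add: diag2_mat2)
    then have "\<bar>?M$2$1\<bar> = \<bar>K\<bar> + 1" unfolding l(2) using 2 by (simp add: abs_mult)
    then have "norm ?M > K" using norm_mat_entry_le[of ?M 2 1] by linarith
    moreover have "det (diag2 l) = 1" using l by simp
    ultimately show ?thesis by blast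
  next
    case 3
    then have nz: "Z$1$1 \<noteq> 0" and 22: "Z$2$2 = - Z$1$1" using assms by (auto simp: mat_eq_iff)
    define x where "x = (\<bar>K\<bar> + 1) / (2 * Z$1$1)"
    let ?M = "adj2 (upper2 x) ** Z ** upper2 x"
    have "?M$1$2 = \<bar>K\<bar> + 1" using nz by (simp add: upper2_def 3 22 x_def field_simps)
    then have "norm ?M > K" by (rule big)
    then show ?thesis using det_special(1) by blast
  qed
qed

text \<open>Two matrices commute iff their vectors (difference of the diagonal entries, off-diagonal
  entries) are parallel. The vector of \<open>C\<close> is non-zero, so those of \<open>A\<close>
  and \<open>B\<close> are both multiples of it.\<close>

lemma centraliser_commutative:
  fixes A B C :: "real^2^2"
  assumes "trless2 C \<noteq> 0" "A ** C = C ** A" "B ** C = C ** B"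
  shows "A ** B = B ** A"
proof -
  define p q r where C: "p = C$1$1 - C$2$2" "q = C$1$2" "r = C$2$1"
  define a b c where A: "a = A$1$1 - A$2$2" "b = A$1$2" "c = A$2$1"
  define a' b' c' where B: "a' = B$1$1 - B$2$2" "b' = B$1$2" "c' = B$2$1"
  have commute: "M ** N = N ** M \<longleftrightarrow> M$1$2 * N$2$1 = N$1$2 * M$2$1 \<and>
      (M$1$1 - M$2$2) * N$1$2 = (N$1$1 - N$2$2) * M$1$2 \<and>
      (M$1$1 - M$2$2) * N$2$1 = (N$1$1 - N$2$2) * M$2$1" for M N :: "real^2^2"
    unfolding mat_eq_iff mat_mult_nth by (simp add: algebra_simps) argo
  have nz: "p \<noteq> 0 \<or> q \<noteq> 0 \<or> r \<noteq> 0"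
    using assms(1) unfolding C mat_eq_iff[of "trless2 C"] by simp argo
  have 1: "b * r = q * c" "a * q = p * b" "a * r = p * c"
    using assms(2) unfolding commute A C by simp_all
  have 2: "b' * r = q * c'" "a' * q = p * b'" "a' * r = p * c'"
    using assms(3) unfolding commute B C by simp_all
  have "b * c' = b' * c \<and> a * b' = a' * b \<and> a * c' = a' * c"
    using nz
  proof (elim disjE)
    assume "p \<noteq> 0"
    then have "b = a * q / p" "c = a * r / p" "b' = a' * q / p" "c' = a' * r / p"
      using 1 2 by (simp_all add: field_simps)
    then show ?thesis by simp
  next
    assume "q \<noteq> 0"
    then have "a = p * b / q" "c = b * r / q" "a' = p * b' / q" "c' = b' * r / q"
      using 1 2 by (simp_all add: field_simps)
    then show ?thesis by simp
  next
    assume "r \<noteq> 0"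
    then have "a = p * c / r" "b = q * c / r" "a' = p * c' / r" "b' = q * c' / r"
      using 1 2 by (simp_all add: field_simps)
    then show ?thesis by simp
  qed
  then show ?thesis unfolding commute A[symmetric] B[symmetric] by blast
qed

lemma sl2_first_column:
  assumes "a \<noteq> 0 \<or> b \<noteq> 0"
  shows "\<exists>g :: real^2^2. det g = 1 \<and> g$1$1 = a \<and> g$2$1 = b"
proof -
  have n: "a * a + b * b \<noteq> 0" using assms by (auto simp: add_nonneg_eq_0_iff)
  let ?g = "mat2 a (- b / (a*a+b*b)) b (a / (a*a+b*b))"
  have "det ?g = 1" using n by (simp add: add_divide_distrib[symmetric])
  then show ?thesis by (intro exI[of _ ?g]) auto
qed

lemma conj_upper_triangular:
  assumes "det M = 1" "l * l - (M$1$1 + M$2$2) * l + 1 = 0"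
  shows "\<exists>g. det g = 1 \<and> (adj2 g ** M ** g)$1$1 = l \<and> (adj2 g ** M ** g)$2$1 = 0"
proof -
  have ev: "\<exists>a b. (a \<noteq> 0 \<or> b \<noteq> 0) \<and> M$1$1 * a + M$1$2 * b = l * a \<and> M$2$1 * a + M$2$2 * b = l * b"
  proof -
    have d: "(M$1$1 - l) * (M$2$2 - l) = M$1$2 * M$2$1"
      using assms by (simp add: det_2 algebra_simps)
    \<comment> \<open>Either row of \<open>M\<close> minus \<open>l\<close> yields a vector that it
      annihilates; both vectors vanish only if \<open>M\<close> is scalar.\<close>
    consider "M$1$2 \<noteq> 0 \<or> l - M$1$1 \<noteq> 0" | "l - M$2$2 \<noteq> 0 \<or> M$2$1 \<noteq> 0"
      | "M$1$2 = 0" "M$2$1 = 0" "l = M$1$1" "l = M$2$2" by fastforce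
    then show ?thesis
    proof cases
      case 1
      show ?thesis
        using 1 d by (intro exI[of _ "M$1$2"] exI[of _ "l - M$1$1"]) (auto simp: algebra_simps)
    next
      case 2
      show ?thesis
        using 2 d by (intro exI[of _ "l - M$2$2"] exI[of _ "M$2$1"]) (auto simp: algebra_simps)
    next
      case 3
      show ?thesis using 3 by (intro exI[of _ 1] exI[of _ 0]) auto
    qed
  qed
  then obtain a b where ab: "a \<noteq> 0 \<or> b \<noteq> 0"
    "M$1$1 * a + M$1$2 * b = l * a" "M$2$1 * a + M$2$2 * b = l * b" by blast
  obtain g :: "real^2^2" where g: "det g = 1" "g$1$1 = a" "g$2$1 = b" using sl2_first_column[OF ab(1)] by blast
  have "(adj2 g ** M ** g)$1$1 = g$2$2 * (M$1$1 * a + M$1$2 * b) - g$1$2 * (M$2$1 * a + M$2$2 * b)"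
    by (simp add: g algebra_simps)
  also have "\<dots> = l * det g" unfolding ab by (simp add: det_2 g algebra_simps)
  finally have 1: "(adj2 g ** M ** g)$1$1 = l" using g by simp
  have "(adj2 g ** M ** g)$2$1 = - b * (M$1$1 * a + M$1$2 * b) + a * (M$2$1 * a + M$2$2 * b)"
    by (simp add: g algebra_simps)
  also have "\<dots> = 0" unfolding ab by simp
  finally show ?thesis using g 1 by blast
qed

lemma trace_conj:
  assumes "det g = 1"
  shows "(adj2 g ** M ** g)$1$1 + (adj2 g ** M ** g)$2$2 = M$1$1 + M$2$2"
proof -
  have "(adj2 g ** M ** g)$1$1 + (adj2 g ** M ** g)$2$2 = det g * (M$1$1 + M$2$2)"
    unfolding det_2 by (simp add: algebra_simps)
  then show ?thesis using assms by simp
qed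

section \<open>Sequences and subgroups of the line\<close>

text \<open>Stated for later use with \<open>f (p, q)\<close> equal to the inverse of p times q:
  terms of a convergent sequence in a discrete group then differ by elements near 1, so they
  coincide. The limit is not assumed to lie in the group.\<close>

lemma eventually_const_of_separated:
  fixes X :: "nat \<Rightarrow> 'a::metric_space" and f :: "'a \<times> 'a \<Rightarrow> 'b::metric_space"
  assumes X: "X \<longlonglongrightarrow> l" and f: "continuous_on UNIV f" and "e > 0"
    and sep: "\<And>m n. dist (f (X m, X n)) (f (l, l)) < e \<Longrightarrow> X m = X n"
  shows "\<exists>k. \<forall>n\<ge>k. X n = l"
proof -
  have "isCont f (l, l)" using f by (simp add: continuous_on_eq_continuous_at)
  then obtain d where d: "d > 0" "\<And>p. dist p (l, l) < d \<Longrightarrow> dist (f p) (f (l, l)) < e"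
    using \<open>e > 0\<close> unfolding continuous_at_eps_delta by blast
  obtain k where k: "\<And>n. n \<ge> k \<Longrightarrow> dist (X n) l < d / 2"
    using X d(1) unfolding lim_sequentially by (meson half_gt_zero)
  have const: "X n = X k" if "n \<ge> k" for n
  proof (rule sep, rule d(2))
    have "dist (X n, X k) (l, l) \<le> dist (X n) l + dist (X k) l"
      unfolding dist_prod_def by (simp add: sqrt_sum_squares_le_sum)
    also have "\<dots> < d" using k[OF that] k[of k] by simp
    finally show "dist (X n, X k) (l, l) < d" .
  qed
  then have "X \<longlonglongrightarrow> X k"
    by (intro tendsto_eventually eventually_sequentiallyI[of k])
  then have "X k = l" using X LIMSEQ_unique by blast
  with const show ?thesis by metis
qed

lemma finite_if_convergent_eventually_const:
  fixes S :: "'a::heine_borel set"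
  assumes "bounded S"
    and *: "\<And>X l. \<lbrakk>\<And>n. X n \<in> S; X \<longlonglongrightarrow> l\<rbrakk> \<Longrightarrow> \<exists>k::nat. \<forall>n\<ge>k. X n = l"
  shows "finite S"
proof (rule ccontr)
  assume "infinite S"
  then obtain f :: "nat \<Rightarrow> 'a" where f: "inj f" "range f \<subseteq> S"
    using infinite_countable_subset by blast
  then have "bounded (range f)" using assms(1) bounded_subset by blast
  then obtain l r where r: "strict_mono (r :: nat \<Rightarrow> nat)" "(f \<circ> r) \<longlonglongrightarrow> l"
    using bounded_imp_convergent_subsequence by metis
  then obtain k where k: "\<forall>n\<ge>k. (f \<circ> r) n = l" using *[of "f \<circ> r" l] f by auto
  then have "f (r k) = f (r (Suc k))" by simp
  then have "r k = r (Suc k)" using f(1) by (simp add: inj_eq)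
  then show False using r(1) by (metis lessI nat_neq_iff strict_mono_less)
qed

lemma int_multiple_mem:
  fixes P :: "'a::real_vector set"
  assumes diff: "\<And>x y. x \<in> P \<Longrightarrow> y \<in> P \<Longrightarrow> x - y \<in> P" and x: "x \<in> P"
  shows "of_int n *\<^sub>R x \<in> P"
proof -
  have 0: "0 \<in> P" using diff[OF x x] by simp
  have minus: "- y \<in> P" if "y \<in> P" for y using diff[OF 0 that] by simp
  have nat: "of_nat m *\<^sub>R x \<in> P" for m
  proof (induction m)
    case (Suc m)
    from diff[OF this minus[OF x]] show ?case by (simp add: scaleR_left_distrib add.commute)
  qed (simp add: 0)
  show ?thesis using nat[of "nat n"] minus[OF nat[of "nat (- n)"]] by (cases "n \<ge> 0") auto
qed

text \<open>Infinitely many elements in a bounded interval accumulate, so there are arbitrarily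
  small non-zero differences, and the integer multiples of these approximate every real
  number.\<close>

lemma additive_subgroup_dense:
  fixes P :: "real set"
  assumes diff: "\<And>s t. s \<in> P \<Longrightarrow> t \<in> P \<Longrightarrow> s - t \<in> P"
    and inf: "infinite (P \<inter> {-R..R})"
  shows "closure P = UNIV"
proof -
  have imult: "of_int n * s \<in> P" if "s \<in> P" for n s
    using int_multiple_mem[of P s n] diff that by simp
  have small: "\<exists>s\<in>P. 0 < s \<and> s < e" if "e > 0" for e
  proof -
    have "\<exists>l. l islimpt (P \<inter> {-R..R})"
      using compact_Icc[of "-R" R] inf unfolding compact_eq_Bolzano_Weierstrass by blast
    then obtain l where l: "l islimpt P" using islimpt_subset by blast
    then obtain s where s: "s \<in> P" "s \<noteq> l" "dist s l < e / 2"
      using l \<open>e > 0\<close> unfolding islimpt_approachable by (meson half_gt_zero)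
    obtain t where t: "t \<in> P" "t \<noteq> l" "dist t l < dist s l"
      using l s(2) unfolding islimpt_approachable by (metis zero_less_dist_iff)
    have "s - t \<in> P" "t - s \<in> P" "s \<noteq> t" using s t diff by auto
    moreover have "\<bar>s - t\<bar> < e" using s(3) t(3) unfolding dist_real_def by linarith
    ultimately show ?thesis
      by (cases s t rule: linorder_cases)
        (auto intro: bexI[of _ "t - s"], auto intro: bexI[of _ "s - t"])
  qed
  have "x \<in> closure P" for x
    unfolding closure_approachable
  proof (intro allI impI)
    fix e :: real assume "e > 0"
    then obtain s where s: "s \<in> P" "0 < s" "s < e" using small by blast
    define n where "n = \<lfloor>x / s\<rfloor>"
    have "of_int n \<le> x / s" "x / s < of_int n + 1" unfolding n_def by linarith+
    then have "of_int n * s \<le> x" "x < of_int n * s + s" using s(2) by (simp_all add: field_simps)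
    then have "dist (of_int n * s) x < e" using s(3) by (simp add: dist_real_def)
    then show "\<exists>y\<in>P. dist y x < e" using imult[OF s(1)] by blast
  qed
  then show ?thesis by auto
qed

lemma cross_perp_parallel:
  fixes x x' y y' :: "real^3"
  assumes "cross3 x x' \<noteq> 0" "y \<noteq> 0" "y \<bullet> x = 0" "y \<bullet> x' = 0" "y' \<bullet> x = 0" "y' \<bullet> x' = 0"
  shows "\<exists>c. y' = c *\<^sub>R y"
proof -
  have par: "\<exists>c. z = c *\<^sub>R cross3 x x'" if "z \<bullet> x = 0" "z \<bullet> x' = 0" for z
  proof -
    have "cross3 (cross3 x x') z = 0"
      using that by (simp add: cross_triple Lagrange cross_skew[of "cross3 x x'"])
    then have "collinear {0, cross3 x x', z}" by (simp add: cross_eq_0)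
    then show ?thesis using assms(1) by (auto simp: collinear_lemma intro: exI[of _ 0])
  qed
  obtain a b where "y = a *\<^sub>R cross3 x x'" "y' = b *\<^sub>R cross3 x x'" using par assms by blast
  then have "y' = (b / a) *\<^sub>R y" using assms(2) by auto
  then show ?thesis by blast
qed

text \<open>The trace pairing of traceless matrices is indefinite, but it becomes the Euclidean inner
  product when its two arguments are given different coordinates, so that orthogonality can be read
  off from the cross product.\<close>

lemma trace_perp_parallel:
  fixes X X' Y Y' :: "real^2^2"
  assumes tr: "X$1$1 + X$2$2 = 0" "X'$1$1 + X'$2$2 = 0" "Y$1$1 + Y$2$2 = 0" "Y'$1$1 + Y'$2$2 = 0"
    and X: "X \<noteq> 0" "\<And>c. X' \<noteq> c *\<^sub>R X" and "Y \<noteq> 0"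
    and perp: "trace (Y ** X) = 0" "trace (Y ** X') = 0" "trace (Y' ** X) = 0" "trace (Y' ** X') = 0"
  shows "\<exists>c. Y' = c *\<^sub>R Y"
proof -
  define p :: "real^2^2 \<Rightarrow> real^3" where "p M = vector [M$1$1, M$1$2, M$2$1]" for M
  define q :: "real^2^2 \<Rightarrow> real^3" where "q M = vector [2 * M$1$1, M$2$1, M$1$2]" for M
  have pq: "q A \<bullet> p B = trace (A ** B)" if "A$1$1 + A$2$2 = 0" "B$1$1 + B$2$2 = 0" for A B
  proof -
    have "A$2$2 = - A$1$1" "B$2$2 = - B$1$1" using that by linarith+
    then show ?thesis
      by (simp add: p_def q_def inner_vec_def sum_3 trace_def sum_2 algebra_simps)
  qed
  have peq: "A = c *\<^sub>R B" if "A$1$1 + A$2$2 = 0" "B$1$1 + B$2$2 = 0" "p A = c *\<^sub>R p B" for A B c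
  proof -
    have "A$2$2 = - A$1$1" "B$2$2 = - B$1$1" using that by linarith+
    with that(3) show ?thesis by (simp add: p_def mat_eq_iff vec_eq_iff forall_3)
  qed
  have qeq: "A = c *\<^sub>R B" if "A$1$1 + A$2$2 = 0" "B$1$1 + B$2$2 = 0" "q A = c *\<^sub>R q B" for A B c
  proof -
    have "A$2$2 = - A$1$1" "B$2$2 = - B$1$1" using that by linarith+
    with that(3) show ?thesis by (simp add: q_def mat_eq_iff vec_eq_iff forall_3)
  qed
  have "p X \<noteq> 0" using peq[OF tr(1,1), of 0] X(1) by auto
  have "cross3 (p X) (p X') \<noteq> 0"
  proof
    assume "cross3 (p X) (p X') = 0"
    then have "collinear {0, p X, p X'}" by (simp add: cross_eq_0)
    then obtain c where "p X' = c *\<^sub>R p X" using \<open>p X \<noteq> 0\<close> by (auto simp: collinear_lemma intro: exI[of _ 0])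
    then show False using peq[OF tr(2,1)] X(2) by blast
  qed
  moreover have "q Y \<noteq> 0" using qeq[OF tr(3,3), of 0] \<open>Y \<noteq> 0\<close> by auto
  ultimately obtain c where "q Y' = c *\<^sub>R q Y"
    using cross_perp_parallel[of "p X" "p X'" "q Y" "q Y'"] perp pq tr by metis
  then show ?thesis using qeq tr by blast
qed

section \<open>Closed subgroups of \<open>SL(2,\<real>)\<close>\<close>

text \<open>In the application \<open>D\<close> is g - h with \<open>h\<close> nearest to g, and the
  competitors are the points \<open>h ** k n\<close>. In the squared inequality divided by
  \<open>\<epsilon> n\<close>, the quadratic term keeps a factor tending to 0.\<close>

lemma nearest_point_first_order:
  fixes D h X :: "real^2^2" and k :: "nat \<Rightarrow> real^2^2"
  assumes k: "k \<longlonglongrightarrow> mat 1" and X: "(\<lambda>n. (k n - mat 1) /\<^sub>R \<epsilon> n) \<longlonglongrightarrow> X"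
    and eps: "\<And>n. \<epsilon> n > 0"
    and near: "\<And>n. norm D \<le> norm (D - h ** (k n - mat 1))"
  shows "D \<bullet> (h ** X) \<le> 0"
proof -
  let ?w = "\<lambda>n. h ** (k n - mat 1)"
  have w: "?w \<longlonglongrightarrow> h ** (mat 1 - mat 1)" by (intro tendsto_intros k)
  have wX: "(\<lambda>n. ?w n /\<^sub>R \<epsilon> n) \<longlonglongrightarrow> h ** X"
    using tendsto_mat_mult[OF tendsto_const[of h] X] by simp
  have "2 * (D \<bullet> (?w n /\<^sub>R \<epsilon> n)) \<le> norm (?w n /\<^sub>R \<epsilon> n) * norm (?w n)" for n
  proof -
    have "(norm D)\<^sup>2 \<le> (norm (D - ?w n))\<^sup>2" using near[of n] by (simp add: power_mono)
    then have "2 * (D \<bullet> ?w n) \<le> norm (?w n) * norm (?w n)"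
      by (simp add: power2_norm_eq_inner inner_diff inner_commute flip: power2_eq_square)
    then have "(2 * (D \<bullet> ?w n)) / \<epsilon> n \<le> (norm (?w n) * norm (?w n)) / \<epsilon> n"
      using eps[of n] by (intro divide_right_mono) auto
    then show ?thesis using eps[of n] by (simp add: divide_inverse_commute mult_ac)
  qed
  moreover have "(\<lambda>n. 2 * (D \<bullet> (?w n /\<^sub>R \<epsilon> n))) \<longlonglongrightarrow> 2 * (D \<bullet> (h ** X))"
    by (intro tendsto_intros wX)
  moreover have "(\<lambda>n. norm (?w n /\<^sub>R \<epsilon> n) * norm (?w n)) \<longlonglongrightarrow> norm (h ** X) * norm (h ** (mat 1 - mat 1))"
    by (intro tendsto_intros wX w)
  ultimately have "2 * (D \<bullet> (h ** X)) \<le> norm (h ** X) * norm (h ** (mat 1 - mat 1))"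
    using LIMSEQ_le by blast
  then show ?thesis by (simp add: mat_mult_diff_distrib)
qed

text \<open>Unit directions subconverge by compactness. From det (1 + e v) = 1 + e tr v + e^2 det v
  = 1 follows tr v = - e det v, so the limit is traceless.\<close>

lemma sl2_tangent_direction:
  fixes h :: "nat \<Rightarrow> real^2^2"
  assumes h: "h \<longlonglongrightarrow> mat 1" "\<And>n. h n \<noteq> mat 1" "\<And>n. det (h n) = 1"
  obtains r X where "strict_mono (r :: nat \<Rightarrow> nat)" "X \<noteq> 0" "X$1$1 + X$2$2 = 0"
    "(\<lambda>n. (h (r n) - mat 1) /\<^sub>R norm (h (r n) - mat 1)) \<longlonglongrightarrow> X"
proof -
  define v where "v n = (h n - mat 1) /\<^sub>R norm (h n - mat 1)" for n
  have nv: "norm (v n) = 1" for n using h(2)[of n] by (simp add: v_def)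
  then have "bounded (range v)" by (auto simp: bounded_iff)
  then obtain X r where r: "strict_mono (r :: nat \<Rightarrow> nat)" "(v \<circ> r) \<longlonglongrightarrow> X"
    using bounded_imp_convergent_subsequence by metis
  have "(\<lambda>n. norm ((v \<circ> r) n)) \<longlonglongrightarrow> norm X" by (intro tendsto_intros r)
  then have "norm X = 1" using nv by (simp add: LIMSEQ_const_iff)
  then have "X \<noteq> 0" by auto
  have tr: "v n$1$1 + v n$2$2 = - norm (h n - mat 1) * det (v n)" for n
  proof -
    define e where "e = norm (h n - mat 1)"
    have "e > 0" using h(2)[of n] by (simp add: e_def)
    have "h n = mat 1 + e *\<^sub>R v n" using h(2)[of n] by (simp add: v_def e_def)
    then have "det (mat 1 + e *\<^sub>R v n) = 1" using h(3)[of n] by simp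
    then have "e * (v n$1$1 + v n$2$2 + e * det (v n)) = 0" by (simp add: det_2 algebra_simps)
    then show ?thesis using \<open>e > 0\<close> by (simp add: e_def)
  qed
  have hr: "(\<lambda>n. h (r n)) \<longlonglongrightarrow> mat 1" using LIMSEQ_subseq_LIMSEQ[OF h(1) r(1)] by (simp add: o_def)
  have rr: "(\<lambda>n. v (r n)) \<longlonglongrightarrow> X" using r(2) by (simp add: o_def)
  have "(\<lambda>n. - norm (h (r n) - mat 1) * det (v (r n))) \<longlonglongrightarrow> - norm (mat 1 - mat 1 :: real^2^2) * det X"
    by (intro tendsto_intros hr tendsto_det2 rr)
  moreover have "(\<lambda>n. v (r n)$1$1 + v (r n)$2$2) \<longlonglongrightarrow> X$1$1 + X$2$2"
    by (intro tendsto_intros rr)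
  ultimately have "X$1$1 + X$2$2 = 0" unfolding tr using LIMSEQ_unique by force
  then show thesis using that[OF r(1) \<open>X \<noteq> 0\<close>] rr unfolding v_def by blast
qed

lemma inner_eq_trace:
  fixes D h W :: "real^2^2"
  shows "D \<bullet> (h ** W) = trace ((transpose D ** h) ** W)"
  by (simp add: inner_vec_def trace_def sum_2 transpose_def algebra_simps)

lemma trace_trless2:
  fixes W :: "real^2^2"
  assumes "W$1$1 + W$2$2 = 0"
  shows "trace (Y ** W) = trace (trless2 Y ** W)"
proof -
  have "W$2$2 = - W$1$1" using assms by linarith
  then show ?thesis by (simp add: trace_def sum_2 field_simps)
qed

lemma trace_cyclic2: "trace ((A :: real^2^2) ** B) = trace (B ** A)"
  by (simp add: trace_def sum_2 algebra_simps)

text \<open>The trace form is invariant, so having no invariant line in the traceless matrices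
  excludes invariant planes too: this is irreducibility of the adjoint action of \<open>H\<close>.
  With one tangent vector it forces \<open>H\<close> to be everything, see
  \<open>eq_SL2\<close>.\<close>

locale sl2_closed_subgroup =
  fixes H :: "(real^2^2) set"
  assumes closed_H: "closed H"
    and det_H: "M \<in> H \<Longrightarrow> det M = 1"
    and mult_H: "M \<in> H \<Longrightarrow> N \<in> H \<Longrightarrow> M ** N \<in> H"
    and adj_H: "M \<in> H \<Longrightarrow> adj2 M \<in> H"
    and one_H: "mat 1 \<in> H"
    and no_invariant_line:
      "Z \<noteq> 0 \<Longrightarrow> Z$1$1 + Z$2$2 = 0 \<Longrightarrow> \<exists>M\<in>H. \<forall>c. M ** Z ** adj2 M \<noteq> c *\<^sub>R Z"
    and nondiscrete: "e > 0 \<Longrightarrow> \<exists>M\<in>H. M \<noteq> mat 1 \<and> dist M (mat 1) < e"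
begin

text \<open>Since \<open>X\<close> and some conjugate of it are independent, the trace complement of
  all conjugates of \<open>X\<close> is at most a line. It is \<open>H\<close>-invariant, so a
  non-zero \<open>Y\<close> in it would span an invariant line.\<close>

lemma perp_all_conjugates_zero:
  assumes X: "X \<noteq> 0" "X$1$1 + X$2$2 = 0" and Y: "Y$1$1 + Y$2$2 = 0"
    and perp: "\<And>M. M \<in> H \<Longrightarrow> trace (Y ** (M ** X ** adj2 M)) = 0"
  shows "Y = 0"
proof (rule ccontr)
  assume "Y \<noteq> 0"
  obtain A where A: "A \<in> H" "\<And>c. A ** X ** adj2 A \<noteq> c *\<^sub>R X" using no_invariant_line[OF X] by blast
  obtain B where B: "B \<in> H" "\<And>c. B ** Y ** adj2 B \<noteq> c *\<^sub>R Y"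
    using no_invariant_line[OF \<open>Y \<noteq> 0\<close> Y] by blast
  have trc: "(M ** Z ** adj2 M)$1$1 + (M ** Z ** adj2 M)$2$2 = 0"
    if "M \<in> H" "Z$1$1 + Z$2$2 = 0" for M Z
    using trace_conj[of "adj2 M" Z] det_H[OF that(1)] that(2) by simp
  have perpB: "trace ((B ** Y ** adj2 B) ** (M ** X ** adj2 M)) = 0" if "M \<in> H" for M
  proof -
    have "trace ((B ** Y ** adj2 B) ** (M ** X ** adj2 M)) =
        trace (B ** (Y ** (adj2 B ** M ** X ** adj2 M)))" by (simp add: matrix_mul_assoc)
    also have "\<dots> = trace (Y ** ((adj2 B ** M) ** X ** adj2 (adj2 B ** M)))"
      by (subst trace_cyclic2) (simp add: matrix_mul_assoc adj2_mult)
    also have "\<dots> = 0" by (intro perp mult_H adj_H B that)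
    finally show ?thesis .
  qed
  have "\<exists>c. B ** Y ** adj2 B = c *\<^sub>R Y"
    by (rule trace_perp_parallel[of X "A ** X ** adj2 A"])
      (use perp[OF one_H] perp[OF A(1)] perpB[OF one_H] perpB[OF A(1)] trc A B X Y \<open>Y \<noteq> 0\<close> in auto)
  then show False using B(2) by blast
qed

text \<open>Let \<open>h \<in> H\<close> be nearest to \<open>g\<close>. Minimality to first order makes \<open>transpose (g - h) ** h\<close>
  orthogonal to all conjugates of a tangent vector of \<open>H\<close>, hence scalar, and then
  \<open>det g = det h = 1\<close> leaves only \<open>g = h\<close> or \<open>norm (g - h) > 1\<close>.\<close>

lemma near_one_mem:
  assumes g: "det g = 1" "norm (g - mat 1) \<le> 1"
  shows "g \<in> H"
proof -
  obtain h0 where h0: "\<And>n. h0 n \<in> H \<and> h0 n \<noteq> mat 1 \<and> dist (h0 n) (mat 1) < inverse (Suc n)" for n :: nat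
    using nondiscrete[of "inverse (real (Suc _))"] by (metis inverse_positive_iff_positive of_nat_0_less_iff zero_less_Suc)
  have "h0 \<longlonglongrightarrow> mat 1"
  proof (rule metric_LIMSEQ_I)
    fix e :: real assume "e > 0"
    then obtain n0 where n0: "inverse (real (Suc n0)) < e" using reals_Archimedean by blast
    have "dist (h0 n) (mat 1) < e" if "n \<ge> n0" for n
    proof -
      have "inverse (real (Suc n)) \<le> inverse (real (Suc n0))" using that by (simp add: field_simps)
      then show ?thesis using h0[of n] n0 by linarith
    qed
    then show "\<exists>n0. \<forall>n\<ge>n0. dist (h0 n) (mat 1) < e" by blast
  qed
  moreover have "h0 n \<noteq> mat 1" "det (h0 n) = 1" for n using h0 det_H by auto
  ultimately obtain r X where r: "strict_mono (r :: nat \<Rightarrow> nat)" and X: "X \<noteq> 0" "X$1$1 + X$2$2 = 0"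
    and lim: "(\<lambda>n. (h0 (r n) - mat 1) /\<^sub>R norm (h0 (r n) - mat 1)) \<longlonglongrightarrow> X"
    using sl2_tangent_direction[of h0] by blast
  define k where "k n = h0 (r n)" for n
  define e where "e n = norm (k n - mat 1)" for n
  have k: "k \<longlonglongrightarrow> mat 1" "\<And>n. k n \<in> H" "\<And>n. e n > 0" "(\<lambda>n. (k n - mat 1) /\<^sub>R e n) \<longlonglongrightarrow> X"
    using LIMSEQ_subseq_LIMSEQ[OF \<open>h0 \<longlonglongrightarrow> mat 1\<close> r] h0 lim by (auto simp: k_def[abs_def] e_def o_def)
  have mX: "adj2 X = - X" using X(2) by (simp add: mat_eq_iff)
  have "(\<lambda>n. adj2 ((k n - mat 1) /\<^sub>R e n)) \<longlonglongrightarrow> adj2 X" by (intro tendsto_intros k)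
  then have k': "(\<lambda>n. (adj2 (k n) - mat 1) /\<^sub>R e n) \<longlonglongrightarrow> - X"
    unfolding mX by (elim Lim_transform_eventually) (simp add: mat_eq_iff)
  have adjk: "(\<lambda>n. adj2 (k n)) \<longlonglongrightarrow> mat 1" using tendsto_adj2[OF k(1)] by simp
  obtain h where h: "h \<in> H" "\<And>y. y \<in> H \<Longrightarrow> dist g h \<le> dist g y"
    using distance_attains_inf[OF closed_H, of g] one_H by blast
  define D where "D = g - h"
  have half: "D \<bullet> (h ** (M ** X' ** adj2 M)) \<le> 0"
    if "M \<in> H" "\<And>n. k' n \<in> H" "k' \<longlonglongrightarrow> mat 1" "(\<lambda>n. (k' n - mat 1) /\<^sub>R e n) \<longlonglongrightarrow> X'" for M k' X'
  proof (rule nearest_point_first_order)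
    have 1: "M ** k' n ** adj2 M - mat 1 = M ** (k' n - mat 1) ** adj2 M" for n
      using adj2_right[OF det_H[OF that(1)]] by (simp add: mat_mult_diff_distrib)
    show "(\<lambda>n. M ** k' n ** adj2 M) \<longlonglongrightarrow> mat 1"
    proof -
      have "(\<lambda>n. M ** k' n ** adj2 M) \<longlonglongrightarrow> M ** mat 1 ** adj2 M" by (intro tendsto_intros that)
      then show ?thesis using adj2_right[OF det_H[OF that(1)]] by simp
    qed
    have "(\<lambda>n. M ** ((k' n - mat 1) /\<^sub>R e n) ** adj2 M) \<longlonglongrightarrow> M ** X' ** adj2 M"
      by (intro tendsto_intros that)
    then show "(\<lambda>n. (M ** k' n ** adj2 M - mat 1) /\<^sub>R e n) \<longlonglongrightarrow> M ** X' ** adj2 M"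
      unfolding 1 by simp
    show "e n > 0" for n by (rule k)
    show "norm D \<le> norm (D - h ** (M ** k' n ** adj2 M - mat 1))" for n
    proof -
      have "h ** (M ** k' n ** adj2 M) \<in> H" by (intro mult_H adj_H h that)
      from h(2)[OF this] show ?thesis by (simp add: D_def dist_norm mat_mult_diff_distrib)
    qed
  qed
  \<comment> \<open>The one-sided bound is used for \<open>k n\<close> and for its inverse, whose
    tangent vector is \<open>- X\<close>; together they give equality.\<close>
  have perp: "D \<bullet> (h ** (M ** X ** adj2 M)) = 0" if "M \<in> H" for M
  proof -
    have "D \<bullet> (h ** (M ** X ** adj2 M)) \<le> 0" by (rule half) (use that k in auto)
    moreover have "D \<bullet> (h ** (M ** (- X) ** adj2 M)) \<le> 0"
      by (rule half[OF that _ adjk k']) (use adj_H k in auto)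
    ultimately show ?thesis by simp
  qed
  define Y where "Y = transpose D ** h"
  have "trless2 Y = 0"
  proof (rule perp_all_conjugates_zero[OF X])
    show "trace (trless2 Y ** (M ** X ** adj2 M)) = 0" if "M \<in> H" for M
    proof -
      have "(M ** X ** adj2 M)$1$1 + (M ** X ** adj2 M)$2$2 = 0"
        using trace_conj[of "adj2 M" X] det_H[OF that] X(2) by simp
      from trace_trless2[OF this, of Y] show ?thesis
        using perp[OF that] inner_eq_trace[of D h] by (simp add: Y_def)
    qed
  qed (simp add: field_simps)
  then have Y: "Y$1$2 = 0" "Y$2$1 = 0" "Y$1$1 = Y$2$2"
    by (metis trless2_nth(2) zero_index, metis trless2_nth(3) zero_index)
      (metis \<open>trless2 Y = 0\<close> trless2_nth(1) zero_index divide_eq_0_iff eq_iff_diff_eq_0 zero_neq_numeral)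
  define c where "c = Y$1$1"
  have "transpose D = c *\<^sub>R adj2 h"
  proof -
    have "Y = c *\<^sub>R mat 1" using Y by (simp add: mat_eq_iff c_def)
    then have "Y ** adj2 h = c *\<^sub>R adj2 h" by simp
    then show ?thesis unfolding Y_def using adj2_cancel(3)[OF det_H[OF h(1)]] by simp
  qed
  then have D: "D$1$1 = c * h$2$2" "D$2$1 = - c * h$1$2" "D$1$2 = - c * h$2$1" "D$2$2 = c * h$1$1"
    by (auto simp: mat_eq_iff transpose_def)
  have nD: "(norm D)\<^sup>2 = c\<^sup>2 * (norm h)\<^sup>2"
    unfolding norm_sq_mat D by (simp add: power2_eq_square algebra_simps)
  have gh: "g = h + D" by (simp add: D_def)
  have dh: "h$1$1 * h$2$2 - h$1$2 * h$2$1 = 1" using det_H[OF h(1)] by (simp add: det_2)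
  \<comment> \<open>\<open>D\<close> is \<open>c\<close> times the cofactor matrix of
    \<open>h\<close>, so the determinant of \<open>h + D\<close> is a quadratic polynomial in
    \<open>c\<close>.\<close>
  have "det g = (h$1$1 * h$2$2 - h$1$2 * h$2$1) + c * (norm h)\<^sup>2 + c\<^sup>2 * (h$1$1 * h$2$2 - h$1$2 * h$2$1)"
    unfolding gh det_2 norm_sq_mat by (simp add: D power2_eq_square algebra_simps)
  then have "c * ((norm h)\<^sup>2 + c) = 0" using g(1) dh by (simp add: power2_eq_square algebra_simps)
  then consider "c = 0" | "c = - (norm h)\<^sup>2" by force
  then show ?thesis
  proof cases
    case 1
    then have "D = 0" using nD by simp
    then show ?thesis using gh h(1) by simp
  next
    case 2
    \<comment> \<open>In this case |D|^2 = |h|^6 with |h|^2 at least 2, whereas the identity, as a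
      competitor for the nearest point, gives |D| at most 1.\<close>
    have "(norm h)\<^sup>2 = (h$1$1 - h$2$2)\<^sup>2 + (h$1$2 + h$2$1)\<^sup>2 + 2 * (h$1$1 * h$2$2 - h$1$2 * h$2$1)"
      unfolding norm_sq_mat by (simp add: power2_eq_square algebra_simps)
    then have "(norm h)\<^sup>2 \<ge> 2" unfolding dh by simp
    then have "(norm D)\<^sup>2 \<ge> 2\<^sup>2 * 2" unfolding nD 2
      by (intro mult_mono) (use power_mono[of 2 "(norm h)\<^sup>2" 2] in auto)
    moreover have "norm D \<le> 1" using h(2)[OF one_H] g(2) by (simp add: D_def dist_norm)
    then have "(norm D)\<^sup>2 \<le> 1" by (simp add: power_le_one)
    ultimately show ?thesis by simp
  qed
qed

text \<open>Every unipotent is a power of one in the unit ball around 1, where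
  \<open>near_one_mem\<close> applies, and the upper and lower unipotents generate
  SL(2,\<real>).\<close>

lemma eq_SL2:
  assumes "det g = 1"
  shows "g \<in> H"
proof -
  have fraction: "\<exists>n::nat. n > 0 \<and> \<bar>x / n\<bar> \<le> 1" for x :: real
  proof -
    obtain n :: nat where "\<bar>x\<bar> < n" using reals_Archimedean2 by blast
    then show ?thesis by (intro exI[of _ n]) (auto simp: field_simps)
  qed
  have up: "upper2 x \<in> H" for x
  proof -
    obtain n :: nat where n: "n > 0" "\<bar>x / n\<bar> \<le> 1" using fraction[of x] by auto
    define y where "y = x / n"
    have "norm (upper2 y - mat 1) = \<bar>y\<bar>"
      by (rule power2_eq_imp_eq) (simp_all add: norm_sq_mat upper2_def)
    then have "norm (upper2 y - mat 1) \<le> 1" using n(2) by (simp only: y_def)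
    then have "upper2 y \<in> H" by (intro near_one_mem) auto
    then have "upper2 (m * y) \<in> H" for m :: nat
      by (induction m) (auto simp: one_H distrib_right simp flip: upper2_add intro: mult_H)
    from this[of n] show ?thesis using n(1) by (simp add: y_def)
  qed
  have low: "lower2 x \<in> H" for x
  proof -
    obtain n :: nat where n: "n > 0" "\<bar>x / n\<bar> \<le> 1" using fraction[of x] by auto
    define y where "y = x / n"
    have "norm (lower2 y - mat 1) = \<bar>y\<bar>"
      by (rule power2_eq_imp_eq) (simp_all add: norm_sq_mat lower2_def)
    then have "norm (lower2 y - mat 1) \<le> 1" using n(2) by (simp only: y_def)
    then have "lower2 y \<in> H" by (intro near_one_mem) auto
    then have "lower2 (m * y) \<in> H" for m :: nat
      by (induction m) (auto simp: one_H distrib_right simp flip: lower2_add intro: mult_H)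
    from this[of n] show ?thesis using n(1) by (simp add: y_def)
  qed
  have lower_nz: "M \<in> H" if "det M = 1" "M$2$1 \<noteq> 0" for M
  proof -
    let ?c = "M$2$1"
    have "M$1$1 * M$2$2 - M$1$2 * ?c = 1" using that(1) by (simp add: det_2)
    then have "M = upper2 ((M$1$1 - 1) / ?c) ** lower2 ?c ** upper2 ((M$2$2 - 1) / ?c)"
      using that(2) by (simp add: mat_eq_iff special_defs field_simps)
    then show ?thesis using up low mult_H by metis
  qed
  show ?thesis
  proof (cases "g$2$1 = 0")
    case True
    then have "g$1$1 \<noteq> 0" using assms by (auto simp: det_2)
    then have "lower2 1 ** g \<in> H" using True assms
      by (intro lower_nz) (auto simp: lower2_def det_one_mult)
    then have "lower2 (-1) ** (lower2 1 ** g) \<in> H" using low mult_H by blast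
    then show ?thesis by (simp add: matrix_mul_assoc lower2_add)
  qed (use lower_nz assms in blast)
qed

end

section \<open>Uniform lattices in \<open>SL(2,\<real>) \<times> SL(2,\<real>)\<close>\<close>

lemma closure_sequenceE:
  assumes "x \<in> closure S"
  obtains f :: "nat \<Rightarrow> _::first_countable_topology" where "\<And>n. f n \<in> S" "f \<longlonglongrightarrow> x"
  using assms unfolding closure_sequential by blast

lemma norm_conj_le: "norm (adj2 C ** Z ** C) \<le> norm C * norm Z * norm C"
  using order_trans[OF norm_mat_mult_le mult_right_mono[OF norm_mat_mult_le norm_ge_zero]]
  by (metis norm_adj2)

text \<open>Each \<open>A\<close> is M C with M in \<open>K\<close> and C bounded, so conjugating
  \<open>Z\<close> by \<open>A\<close> has the same norm as conjugating it by C. This contradicts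
  \<open>conj_trless2_unbounded\<close>.\<close>

lemma cocompact_fixed_zero:
  assumes Z: "Z$1$1 + Z$2$2 = 0"
    and R: "\<And>A. det A = 1 \<Longrightarrow> \<exists>M\<in>K. norm (adj2 M ** A) \<le> R"
    and inv: "\<And>M. M \<in> K \<Longrightarrow> det M = 1 \<and> (adj2 M ** Z ** M = Z \<or> adj2 M ** Z ** M = - Z)"
  shows "Z = 0"
proof (rule ccontr)
  assume "Z \<noteq> 0"
  obtain A where A: "det A = 1" "norm (adj2 A ** Z ** A) > R * norm Z * R"
    using conj_trless2_unbounded[OF \<open>Z \<noteq> 0\<close> Z] by blast
  obtain M where M: "M \<in> K" "norm (adj2 M ** A) \<le> R" using R[OF A(1)] by blast
  define C where "C = adj2 M ** A"
  have dM: "det M = 1" using inv[OF M(1)] by blast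
  have "adj2 A ** Z ** A = adj2 C ** (adj2 M ** Z ** M) ** C"
    by (simp add: C_def adj2_mult matrix_mul_assoc adj2_cancel[OF dM])
  then have "norm (adj2 A ** Z ** A) = norm (adj2 C ** Z ** C)" using inv[OF M(1)] by auto
  also have "\<dots> \<le> norm C * norm Z * norm C" by (rule norm_conj_le)
  also have "\<dots> \<le> R * norm Z * R"
    using M(2) order_trans[OF norm_ge_zero M(2)] by (intro mult_mono) (auto simp: C_def)
  finally show False using A(2) by simp
qed

text \<open>Meant for the full preimage of \<open>\<Gamma>\<close> under the covering by
  SL(2,\<real>) \<times> SL(2,\<real>), hence the two sign elements. \<open>cocompact_L\<close> says
  that every pair is an element of \<open>L\<close> times a pair of norms at most
  \<open>R\<close>.\<close>

locale cocompact_lattice2 =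
  fixes L :: "((real^2^2) \<times> (real^2^2)) set"
  assumes det_fst: "(M, N) \<in> L \<Longrightarrow> det M = 1"
    and det_snd: "(M, N) \<in> L \<Longrightarrow> det N = 1"
    and mult_L: "(M, N) \<in> L \<Longrightarrow> (M', N') \<in> L \<Longrightarrow> (M ** M', N ** N') \<in> L"
    and adj_L: "(M, N) \<in> L \<Longrightarrow> (adj2 M, adj2 N) \<in> L"
    and sign_fst: "(- mat 1, mat 1) \<in> L"
    and sign_snd: "(mat 1, - mat 1) \<in> L"
    and discrete_L: "\<exists>e>0. \<forall>M N. (M, N) \<in> L \<longrightarrow> dist M (mat 1) < e \<longrightarrow> dist N (mat 1) < e \<longrightarrow>
      M = mat 1 \<and> N = mat 1"
    and cocompact_L: "\<exists>R. \<forall>A B. det A = 1 \<longrightarrow> det B = 1 \<longrightarrow>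
      (\<exists>M N. (M, N) \<in> L \<and> norm (adj2 M ** A) \<le> R \<and> norm (adj2 N ** B) \<le> R)"
begin

lemma one_L: "(mat 1, mat 1) \<in> L"
  using mult_L[OF sign_fst sign_fst] by simp

lemma minus_fst: "(M, N) \<in> L \<Longrightarrow> (- M, N) \<in> L"
  using mult_L[OF sign_fst] by fastforce

lemma minus_snd: "(M, N) \<in> L \<Longrightarrow> (M, - N) \<in> L"
  using mult_L[OF sign_snd] by fastforce

lemma conj_L: "(P, Q) \<in> L \<Longrightarrow> (M, N) \<in> L \<Longrightarrow> (P ** M ** adj2 P, Q ** N ** adj2 Q) \<in> L"
  by (intro mult_L adj_L)

lemma mem_swap: "(M, N) \<in> prod.swap ` L \<longleftrightarrow> (N, M) \<in> L"
  by force

lemma swap_lattice: "cocompact_lattice2 (prod.swap ` L)"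
proof
  show "\<exists>e>0. \<forall>M N. (M, N) \<in> prod.swap ` L \<longrightarrow> dist M (mat 1) < e \<longrightarrow> dist N (mat 1) < e \<longrightarrow>
      M = mat 1 \<and> N = mat 1"
    unfolding mem_swap using discrete_L by blast
  obtain R where R: "\<And>A B. det A = 1 \<Longrightarrow> det B = 1 \<Longrightarrow>
      \<exists>M N. (M, N) \<in> L \<and> norm (adj2 M ** A) \<le> R \<and> norm (adj2 N ** B) \<le> R"
    using cocompact_L by blast
  show "\<exists>R. \<forall>A B. det A = 1 \<longrightarrow> det B = 1 \<longrightarrow>
      (\<exists>M N. (M, N) \<in> prod.swap ` L \<and> norm (adj2 M ** A) \<le> R \<and> norm (adj2 N ** B) \<le> R)"
    unfolding mem_swap using R by (intro exI[of _ R]) blast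
qed (unfold mem_swap, auto intro: det_fst det_snd mult_L adj_L sign_fst sign_snd)

lemma convergent_eventually_const:
  assumes X: "\<And>n. X n \<in> L" "X \<longlonglongrightarrow> l"
  shows "\<exists>k. \<forall>n\<ge>k. X n = l"
proof -
  obtain e where e: "e > 0" "\<And>M N. (M, N) \<in> L \<Longrightarrow> dist M (mat 1) < e \<Longrightarrow> dist N (mat 1) < e \<Longrightarrow>
      M = mat 1 \<and> N = mat 1"
    using discrete_L by blast
  define f :: "((real^2^2) \<times> (real^2^2)) \<times> ((real^2^2) \<times> (real^2^2)) \<Rightarrow> (real^2^2) \<times> (real^2^2)"
    where "f = (\<lambda>(p, q). (adj2 (fst p) ** fst q, adj2 (snd p) ** snd q))"
  have det: "det (fst (X n)) = 1" "det (snd (X n)) = 1" for n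
    using X(1)[of n] det_fst det_snd by (metis prod.collapse)+
  have "det (fst l) = 1" "det (snd l) = 1"
    using det_one_limit[OF tendsto_fst[OF X(2)] det(1)] det_one_limit[OF tendsto_snd[OF X(2)] det(2)]
    by auto
  then have fl: "f (l, l) = (mat 1, mat 1)" by (simp add: f_def adj2_left)
  show ?thesis
  proof (rule eventually_const_of_separated[OF X(2) _ e(1), of f])
    show "continuous_on UNIV f"
      unfolding f_def case_prod_unfold by (intro continuous_intros)
    fix m n assume d: "dist (f (X m, X n)) (f (l, l)) < e"
    have "(adj2 (fst (X m)) ** fst (X n), adj2 (snd (X m)) ** snd (X n)) \<in> L"
      using X(1) by (intro mult_L adj_L) (auto simp: prod.collapse)
    moreover have "dist (adj2 (fst (X m)) ** fst (X n)) (mat 1) < e"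
      "dist (adj2 (snd (X m)) ** snd (X n)) (mat 1) < e"
      using d dist_fst_le[of "f (X m, X n)" "f (l, l)"] dist_snd_le[of "f (X m, X n)" "f (l, l)"]
      unfolding fl by (simp_all add: f_def)
    ultimately have "adj2 (fst (X m)) ** fst (X n) = mat 1" "adj2 (snd (X m)) ** snd (X n) = mat 1"
      using e(2) by blast+
    then have "fst (X m) ** (adj2 (fst (X m)) ** fst (X n)) = fst (X m)"
      "snd (X m) ** (adj2 (snd (X m)) ** snd (X n)) = snd (X m)" by simp_all
    then show "X m = X n" using adj2_cancel(2) det by (simp add: prod_eq_iff)
  qed
qed

lemma limit_mem:
  assumes "\<And>n. (M n, N n) \<in> L" "M \<longlonglongrightarrow> A" "N \<longlonglongrightarrow> B"
  obtains k where "\<And>n. n \<ge> k \<Longrightarrow> M n = A" "\<And>n. n \<ge> k \<Longrightarrow> N n = B" "(A, B) \<in> L"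
proof -
  obtain k where k: "\<forall>n\<ge>k. (M n, N n) = (A, B)"
    using convergent_eventually_const[OF _ tendsto_Pair[OF assms(2,3)]] assms(1) by blast
  then have "(A, B) \<in> L" using assms(1)[of k] by auto
  with k that show ?thesis by blast
qed

lemma finite_bounded_L: "finite {p \<in> L. norm (fst p) \<le> r \<and> norm (snd p) \<le> s}"
proof (rule finite_if_convergent_eventually_const)
  show "bounded {p \<in> L. norm (fst p) \<le> r \<and> norm (snd p) \<le> s}"
    by (rule boundedI[of _ "r + s"]) (auto intro: order_trans[OF norm_Pair_le])
qed (use convergent_eventually_const in blast)

text \<open>Cocompactness in sequential form: after left translation by \<open>L\<close> every
  sequence subconverges. The lattice elements come reindexed, \<open>M n\<close> belonging to
  \<open>A (r n)\<close>.\<close>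

lemma coset_sequence:
  fixes A B :: "nat \<Rightarrow> real^2^2"
  assumes "\<And>n. det (A n) = 1" "\<And>n. det (B n) = 1"
  obtains r M N C D where "strict_mono (r :: nat \<Rightarrow> nat)" "\<And>n. (M n, N n) \<in> L"
    "(\<lambda>n. adj2 (M n) ** A (r n)) \<longlonglongrightarrow> C" "(\<lambda>n. adj2 (N n) ** B (r n)) \<longlonglongrightarrow> D" "det C = 1" "det D = 1"
proof -
  obtain R where "\<And>n. \<exists>M N. (M, N) \<in> L \<and> norm (adj2 M ** A n) \<le> R \<and> norm (adj2 N ** B n) \<le> R"
    using cocompact_L assms by blast
  then obtain M N where MN: "\<And>n. (M n, N n) \<in> L" "\<And>n. norm (adj2 (M n) ** A n) \<le> R"
    "\<And>n. norm (adj2 (N n) ** B n) \<le> R" by metis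
  let ?f = "\<lambda>n. (adj2 (M n) ** A n, adj2 (N n) ** B n)"
  have "bounded (range ?f)"
  proof (rule boundedI)
    fix p assume "p \<in> range ?f"
    then obtain n where p: "p = ?f n" by blast
    show "norm p \<le> R + R" unfolding p
      by (rule order_trans[OF norm_Pair_le add_mono[OF MN(2,3)]])
  qed
  then obtain p r where r: "strict_mono (r :: nat \<Rightarrow> nat)" "(?f \<circ> r) \<longlonglongrightarrow> p"
    using bounded_imp_convergent_subsequence[of ?f] by blast
  have C: "(\<lambda>n. adj2 (M (r n)) ** A (r n)) \<longlonglongrightarrow> fst p" using tendsto_fst[OF r(2)] by (simp add: o_def)
  have D: "(\<lambda>n. adj2 (N (r n)) ** B (r n)) \<longlonglongrightarrow> snd p" using tendsto_snd[OF r(2)] by (simp add: o_def)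
  show thesis
  proof (rule that[OF r(1) _ C D])
    show "(M (r n), N (r n)) \<in> L" for n by (rule MN)
    show "det (fst p) = 1"
      by (rule det_one_limit[OF C]) (auto intro!: det_one_mult assms det_fst[OF MN(1)])
    show "det (snd p) = 1"
      by (rule det_one_limit[OF D]) (auto intro!: det_one_mult assms det_snd[OF MN(1)])
  qed
qed

section \<open>Parabolic components and invariant lines\<close>

text \<open>Conjugacy classes of elements of a uniform lattice are closed in the ambient group, whereas
  the class of an element with a parabolic first component accumulates at elements whose first
  component is \<open>\<plusminus> 1\<close>.\<close>

lemma unipotent_fst_trivial:
  assumes MN: "(M, N) \<in> L" and tr: "M$1$1 + M$2$2 = 2"
  shows "M = mat 1"
proof -
  have dM: "det M = 1" using MN det_fst by blast
  obtain g where g: "det g = 1" "(adj2 g ** M ** g)$1$1 = 1" "(adj2 g ** M ** g)$2$1 = 0"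
    using conj_upper_triangular[OF dM, of 1] tr by auto
  define x where "x = (adj2 g ** M ** g)$1$2"
  have up: "adj2 g ** M ** g = upper2 x"
    using trace_conj[OF g(1), of M] g tr unfolding mat_eq_iff by (simp add: x_def upper2_def)
  define l where "l n = real (Suc n)" for n
  define A where "A n = g ** diag2 (l n)" for n
  have dA: "det (A n) = 1" for n using g by (simp add: A_def l_def det_one_mult)
  have "adj2 (A n) ** M ** A n = adj2 (diag2 (l n)) ** (adj2 g ** M ** g) ** diag2 (l n)" for n
    by (simp add: A_def adj2_mult matrix_mul_assoc)
  then have AM: "adj2 (A n) ** M ** A n = upper2 (x * (inverse (l n) * inverse (l n)))" for n
    unfolding up by (simp add: mat_eq_iff special_defs l_def)
  have "(\<lambda>n. x * (inverse (l n) * inverse (l n))) \<longlonglongrightarrow> x * (0 * 0)"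
    unfolding l_def by (intro tendsto_intros LIMSEQ_inverse_real_of_nat)
  then have lim: "(\<lambda>n. adj2 (A n) ** M ** A n) \<longlonglongrightarrow> mat 1"
    unfolding AM by (simp add: upper2_def tendsto_mat_iff)
  \<comment> \<open>The second sequence is constantly 1, so the inverses of \<open>Q n\<close>
    converge themselves, and the conjugates of \<open>N\<close> converge along with those of
    \<open>M\<close>.\<close>
  obtain r P Q C D where r: "strict_mono (r :: nat \<Rightarrow> nat)" and PQ: "\<And>n. (P n, Q n) \<in> L"
    and C: "(\<lambda>n. adj2 (P n) ** A (r n)) \<longlonglongrightarrow> C" and D: "(\<lambda>n. adj2 (Q n) ** mat 1) \<longlonglongrightarrow> D"
    and dC: "det C = 1" "det D = 1"
    by (rule coset_sequence[of A "\<lambda>_. mat 1", OF dA det_I]) (rule that)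
  define C' where "C' n = adj2 (P n) ** A (r n)" for n
  \<comment> \<open>Conjugating \<open>M\<close> by the lattice element \<open>P n\<close> amounts
    to conjugating a matrix tending to 1 by the convergent \<open>C' n\<close>. The limit is 1, and
    discreteness turns convergence into equality.\<close>
  have eq: "adj2 (P n) ** M ** P n = C' n ** (adj2 (A (r n)) ** M ** A (r n)) ** adj2 (C' n)" for n
    unfolding C'_def by (simp add: adj2_mult matrix_mul_assoc adj2_cancel[OF dA])
  have "(\<lambda>n. adj2 (A (r n)) ** M ** A (r n)) \<longlonglongrightarrow> mat 1"
    using LIMSEQ_subseq_LIMSEQ[OF lim r] by (simp add: o_def)
  then have lim1: "(\<lambda>n. adj2 (P n) ** M ** P n) \<longlonglongrightarrow> C ** mat 1 ** adj2 C"
    unfolding eq using C by (intro tendsto_intros) (simp_all add: C'_def)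
  have lim2: "(\<lambda>n. adj2 (Q n) ** N ** adj2 (adj2 (Q n))) \<longlonglongrightarrow> D ** N ** adj2 D"
    using D by (intro tendsto_intros) auto
  have mem: "(adj2 (P n) ** M ** P n, adj2 (Q n) ** N ** adj2 (adj2 (Q n))) \<in> L" for n
    using conj_L[OF adj_L[OF PQ] MN, of n] by simp
  obtain k where k: "\<And>n. n \<ge> k \<Longrightarrow> adj2 (P n) ** M ** P n = C ** mat 1 ** adj2 C"
    by (rule limit_mem[OF mem lim1 lim2]) (rule that)
  have "adj2 (P k) ** M ** P k = mat 1" using k[of k] dC by (simp add: adj2_right)
  then have "M ** P k = P k" using conj_eq_iff[OF det_fst[OF PQ]] by simp
  then have "M ** P k ** adj2 (P k) = P k ** adj2 (P k)" by simp
  then show ?thesis using adj2_cancel(3) adj2_right det_fst[OF PQ] by metis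
qed

lemma parabolic_fst_trivial:
  assumes MN: "(M, N) \<in> L" and tr: "\<bar>M$1$1 + M$2$2\<bar> = 2"
  shows "M = mat 1 \<or> M = - mat 1"
proof (cases "M$1$1 + M$2$2 = 2")
  case True
  then show ?thesis using unipotent_fst_trivial[OF MN] by blast
next
  case False
  then have "(- M)$1$1 + (- M)$2$2 = 2" using tr by auto
  then have "- M = mat 1" using unipotent_fst_trivial[OF minus_fst[OF MN]] by blast
  then show ?thesis by (metis minus_minus)
qed

lemma fixed_up_to_sign_zero:
  assumes Z: "Z$1$1 + Z$2$2 = 0"
    and inv: "\<And>M N. (M, N) \<in> L \<Longrightarrow> M ** Z ** adj2 M = Z \<or> M ** Z ** adj2 M = - Z"
  shows "Z = 0"
proof -
  obtain R where R: "\<And>A. det A = 1 \<Longrightarrow> \<exists>M N. (M, N) \<in> L \<and> norm (adj2 M ** A) \<le> R"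
    using cocompact_L det_I by blast
  show ?thesis
  proof (rule cocompact_fixed_zero[OF Z, of "fst ` L"])
    show "\<exists>M\<in>fst ` L. norm (adj2 M ** A) \<le> R" if "det A = 1" for A using R[OF that] by force
    show "det M = 1 \<and> (adj2 M ** Z ** M = Z \<or> adj2 M ** Z ** M = - Z)" if M: "M \<in> fst ` L" for M
    proof -
      obtain N where N: "(M, N) \<in> L" using M by auto
      show ?thesis using det_fst[OF N] inv[OF adj_L[OF N]] by simp
    qed
  qed
qed

text \<open>All first components fix the boundary point g(\<infinity>), so their commutators are
  unipotent, and \<open>unipotent_fst_trivial\<close> kills these.\<close>

lemma fixes_boundary_point_commute:
  assumes g: "det g = 1" and up: "\<And>M N. (M, N) \<in> L \<Longrightarrow> (adj2 g ** M ** g)$2$1 = 0"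
    and MN: "(M, N) \<in> L" "(M', N') \<in> L"
  shows "M ** M' = M' ** M"
proof -
  define K where "K = M ** M' ** adj2 M ** adj2 M'"
  have "(K, N ** N' ** adj2 N ** adj2 N') \<in> L" unfolding K_def by (intro mult_L adj_L MN)
  moreover have "K$1$1 + K$2$2 = 2"
  proof -
    define A where "A = adj2 g ** M ** g"
    define B where "B = adj2 g ** M' ** g"
    have 21: "A$2$1 = 0" "B$2$1 = 0" using up MN by (auto simp: A_def B_def)
    have "det A = 1" "det B = 1" using det_fst MN g by (auto simp: A_def B_def intro!: det_one_mult)
    then have 1: "A$1$1 * A$2$2 = 1" "B$1$1 * B$2$2 = 1" using 21 by (auto simp: det_2)
    have "adj2 g ** K ** g = A ** B ** adj2 A ** adj2 B"
      unfolding K_def A_def B_def by (simp add: adj2_mult matrix_mul_assoc adj2_cancel[OF g])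
    then have "K$1$1 + K$2$2 = (A ** B ** adj2 A ** adj2 B)$1$1 + (A ** B ** adj2 A ** adj2 B)$2$2"
      using trace_conj[OF g, of K] by simp
    also have "\<dots> = 2 * (A$1$1 * A$2$2) * (B$1$1 * B$2$2)" by (simp add: 21 algebra_simps)
    finally show ?thesis using 1 by simp
  qed
  ultimately have "K = mat 1" using unipotent_fst_trivial by blast
  then have "K ** M' ** M = M' ** M" by simp
  then show ?thesis unfolding K_def using adj2_cancel(4) det_fst MN by metis
qed

text \<open>If det \<open>Z\<close> is non-zero, it forces the factor c to be \<plusminus> 1, so
  \<open>Z\<close> is fixed up to sign. If \<open>Z\<close> is nilpotent, its kernel is a common
  fixed boundary point; the first components then commute, hence are \<plusminus> 1, and
  \<open>Z\<close> is fixed again. Both contradict cocompactness.\<close>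

lemma no_invariant_line_fst:
  assumes Z: "Z \<noteq> 0" "Z$1$1 + Z$2$2 = 0"
  shows "\<exists>M\<in>fst ` L. \<forall>c. M ** Z ** adj2 M \<noteq> c *\<^sub>R Z"
proof (rule ccontr)
  assume "\<not> ?thesis"
  then have inv: "\<exists>c. M ** Z ** adj2 M = c *\<^sub>R Z" if "(M, N) \<in> L" for M N using that by force
  show False
  proof (cases "det Z = 0")
    case False
    have "M ** Z ** adj2 M = Z \<or> M ** Z ** adj2 M = - Z" if MN: "(M, N) \<in> L" for M N
    proof -
      obtain c where c: "M ** Z ** adj2 M = c *\<^sub>R Z" using inv[OF MN] by blast
      have "det (M ** Z ** adj2 M) = det Z" using det_fst[OF MN] by (simp add: det_mul)
      then have "c\<^sup>2 = 1" unfolding c det_scaleR2 using False by simp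
      then have "c = 1 \<or> c = -1" by (simp add: power2_eq_1_iff)
      then show ?thesis using c by auto
    qed
    then show False using fixed_up_to_sign_zero[OF Z(2)] Z(1) by blast
  next
    case True
    have 22: "Z$2$2 = - Z$1$1" using Z(2) by linarith
    \<comment> \<open>\<open>U\<close> is unipotent; putting it in upper triangular form makes the
      conjugate \<open>T\<close> of \<open>Z\<close> strictly upper triangular.\<close>
    define U where "U = mat 1 + Z"
    have "det U = 1" "U$1$1 + U$2$2 = 2" using True 22 by (simp_all add: U_def det_2 algebra_simps)
    then obtain g where g: "det g = 1" "(adj2 g ** U ** g)$1$1 = 1" "(adj2 g ** U ** g)$2$1 = 0"
      using conj_upper_triangular[of U 1] by auto
    define T where "T = adj2 g ** Z ** g"
    have "adj2 g ** U ** g = mat 1 + T"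
      using adj2_left[OF g(1)] unfolding U_def T_def by (simp add: mat_eq_iff algebra_simps)
    then have T: "T$1$1 = 0" "T$2$1 = 0" "T$2$2 = 0"
      using g trace_conj[OF g(1), of Z] Z(2) by (simp_all flip: T_def)
    have "Z = g ** T ** adj2 g" unfolding T_def by (simp add: matrix_mul_assoc adj2_cancel[OF g(1)] adj2_right[OF g(1)])
    then have t: "T$1$2 \<noteq> 0" using Z(1) T by (auto simp: mat_eq_iff)
    have up: "(adj2 g ** M ** g)$2$1 = 0" if MN: "(M, N) \<in> L" for M N
    proof -
      define A where "A = adj2 g ** M ** g"
      obtain c where c: "M ** Z ** adj2 M = c *\<^sub>R Z" using inv[OF MN] by blast
      have "M ** Z = M ** Z ** adj2 M ** M" using adj2_cancel(4)[OF det_fst[OF MN]] by simp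
      also have "\<dots> = c *\<^sub>R (Z ** M)" unfolding c by simp
      finally have cM: "M ** Z = c *\<^sub>R (Z ** M)" .
      have "A ** T = adj2 g ** (M ** Z) ** g"
        unfolding A_def T_def by (simp add: matrix_mul_assoc adj2_cancel[OF g(1)])
      also have "\<dots> = c *\<^sub>R (T ** A)"
        unfolding A_def T_def cM by (simp add: matrix_mul_assoc adj2_cancel[OF g(1)])
      finally have "(A ** T)$2$2 = (c *\<^sub>R (T ** A))$2$2" by simp
      then have "A$2$1 * T$1$2 = 0" using T by simp
      then show ?thesis using t by (simp add: A_def)
    qed
    have "M0 = mat 1 \<or> M0 = - mat 1" if M0: "(M0, N0) \<in> L" for M0 N0
    proof -
      have "trless2 M0 = 0"
      proof (rule fixed_up_to_sign_zero)
        fix M N assume MN: "(M, N) \<in> L"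
        have "M ** trless2 M0 = trless2 M0 ** M"
          unfolding commute_trless2_iff by (rule fixes_boundary_point_commute[OF g(1) _ MN M0]) (rule up)
        then show "M ** trless2 M0 ** adj2 M = trless2 M0 \<or> M ** trless2 M0 ** adj2 M = - trless2 M0"
          using adj2_cancel(3)[OF det_fst[OF MN]] by simp
      qed (simp add: field_simps)
      then show ?thesis using trless2_eq_0_iff det_fst[OF M0] by blast
    qed
    then have "M ** Z ** adj2 M = Z \<or> M ** Z ** adj2 M = - Z" if "(M, N) \<in> L" for M N
      using that by force
    then show False using fixed_up_to_sign_zero[OF Z(2)] Z(1) by blast
  qed
qed

section \<open>Dense and discrete projections, and their kernels\<close>

lemma dense_fst:
  assumes nondiscrete: "\<And>e. e > 0 \<Longrightarrow> \<exists>M\<in>fst ` L. M \<noteq> mat 1 \<and> dist M (mat 1) < e"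
    and A: "det A = 1"
  shows "A \<in> closure (fst ` L)"
proof -
  interpret sl2_closed_subgroup "closure (fst ` L)"
  proof
    show "closed (closure (fst ` L))" by simp
    show "mat 1 \<in> closure (fst ` L)" using one_L closure_subset by force
    show "det M = 1" if "M \<in> closure (fst ` L)" for M
    proof -
      have "fst ` L \<subseteq> {M. det M = 1}" using det_fst by auto
      then show ?thesis using closure_minimal[OF _ closed_det_one] that by blast
    qed
    show "M ** N \<in> closure (fst ` L)" if MN: "M \<in> closure (fst ` L)" "N \<in> closure (fst ` L)" for M N
    proof -
      obtain m where m: "\<And>k. m k \<in> fst ` L" "m \<longlonglongrightarrow> M" by (rule closure_sequenceE[OF MN(1)]) (rule that)
      obtain n where n: "\<And>k. n k \<in> fst ` L" "n \<longlonglongrightarrow> N" by (rule closure_sequenceE[OF MN(2)]) (rule that)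
      have "m k ** n k \<in> fst ` L" for k
      proof -
        obtain P Q where "(m k, P) \<in> L" "(n k, Q) \<in> L" using m(1)[of k] n(1)[of k] by auto
        from mult_L[OF this] show ?thesis by force
      qed
      then show ?thesis using tendsto_mat_mult[OF m(2) n(2)]
        unfolding closure_sequential by (intro exI[of _ "\<lambda>k. m k ** n k"] conjI allI)
    qed
    show "adj2 M \<in> closure (fst ` L)" if MN: "M \<in> closure (fst ` L)" for M
    proof -
      obtain m where m: "\<And>k. m k \<in> fst ` L" "m \<longlonglongrightarrow> M" by (rule closure_sequenceE[OF MN]) (rule that)
      have "adj2 (m k) \<in> fst ` L" for k
      proof -
        obtain P where "(m k, P) \<in> L" using m(1)[of k] by auto
        from adj_L[OF this] show ?thesis by force
      qed
      then show ?thesis using tendsto_adj2[OF m(2)]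
        unfolding closure_sequential by (intro exI[of _ "\<lambda>k. adj2 (m k)"] conjI allI)
    qed
    show "\<exists>M\<in>closure (fst ` L). \<forall>c. M ** Z ** adj2 M \<noteq> c *\<^sub>R Z"
      if "Z \<noteq> 0" "Z$1$1 + Z$2$2 = 0" for Z
      using no_invariant_line_fst[OF that] by (rule bexE) (rule bexI, assumption, erule subsetD[OF closure_subset])
    show "\<exists>M\<in>closure (fst ` L). M \<noteq> mat 1 \<and> dist M (mat 1) < e" if "e > 0" for e
      using nondiscrete[OF that] by (rule bexE) (rule bexI, assumption, erule subsetD[OF closure_subset])
  qed
  show ?thesis by (rule eq_SL2[OF A])
qed

text \<open>The kernel of the first projection is normalised by a dense set of second components
  and, limits in \<open>L\<close> being attained, by all of SL(2,\<real>). Conjugates of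
  \<open>n\<close> by unipotents tending to 1 are eventually equal to \<open>n\<close>, so
  \<open>n\<close> commutes with a non-trivial upper and a non-trivial lower unipotent.\<close>

lemma kernel_snd_trivial:
  assumes dense: "\<And>A. det A = 1 \<Longrightarrow> A \<in> closure (snd ` L)" and n: "(mat 1, n) \<in> L"
  shows "n = mat 1 \<or> n = - mat 1"
proof -
  have conj: "(mat 1, A ** n ** adj2 A) \<in> L" if A: "det A = 1" for A
  proof -
    obtain Q where Q: "\<And>k. Q k \<in> snd ` L" "Q \<longlonglongrightarrow> A"
      by (rule closure_sequenceE[OF dense[OF A]]) (rule that)
    have "\<exists>M. (M, Q k) \<in> L" for k using Q(1)[of k] by auto
    then obtain P where PQ: "\<And>k. (P k, Q k) \<in> L" by metis
    have "(mat 1, Q k ** n ** adj2 (Q k)) \<in> L" for k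
      using conj_L[OF PQ n, of k] adj2_right det_fst[OF PQ] by simp
    then show ?thesis
      by (rule limit_mem[of "\<lambda>_. mat 1" "\<lambda>k. Q k ** n ** adj2 (Q k)"]) (auto intro!: tendsto_intros Q)
  qed
  have lim: "(\<lambda>k. inverse (real (Suc k))) \<longlonglongrightarrow> 0" by (rule LIMSEQ_inverse_real_of_nat)
  have comm: "\<exists>x. x \<noteq> 0 \<and> u x ** n ** adj2 (u x) = n"
    if u: "\<And>x. det (u x) = 1" "(\<lambda>k. u (inverse (real (Suc k)))) \<longlonglongrightarrow> mat 1" for u
  proof -
    let ?u = "\<lambda>k. u (inverse (real (Suc k)))"
    have "(\<lambda>k. ?u k ** n ** adj2 (?u k)) \<longlonglongrightarrow> mat 1 ** n ** adj2 (mat 1)"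
      by (intro tendsto_intros u)
    then have lim: "(\<lambda>k. ?u k ** n ** adj2 (?u k)) \<longlonglongrightarrow> n" by simp
    have mem: "(mat 1, ?u k ** n ** adj2 (?u k)) \<in> L" for k by (rule conj[OF u(1)])
    obtain k where "\<And>m. m \<ge> k \<Longrightarrow> ?u m ** n ** adj2 (?u m) = n"
      by (rule limit_mem[of "\<lambda>_. mat 1" "\<lambda>k. ?u k ** n ** adj2 (?u k)", OF mem tendsto_const lim]) (rule that)
    then have "?u k ** n ** adj2 (?u k) = n" by blast
    then show ?thesis by (intro exI[of _ "inverse (real (Suc k))"]) auto
  qed
  have 1: "(\<lambda>k. upper2 (inverse (real (Suc k)))) \<longlonglongrightarrow> mat 1"
    unfolding special_one(1)[symmetric] unfolding upper2_def by (intro tendsto_mat2 tendsto_const lim)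
  have 2: "(\<lambda>k. lower2 (inverse (real (Suc k)))) \<longlonglongrightarrow> mat 1"
    unfolding special_one(2)[symmetric] unfolding lower2_def by (intro tendsto_mat2 tendsto_const lim)
  obtain x where x: "x \<noteq> 0" "upper2 x ** n ** adj2 (upper2 x) = n" using comm[OF _ 1] by auto
  obtain y where y: "y \<noteq> 0" "lower2 y ** n ** adj2 (lower2 y) = n" using comm[OF _ 2] by auto
  have "upper2 x ** n = n ** upper2 x" "lower2 y ** n = n ** lower2 y"
    using x(2) y(2) adj2_cancel(4)[of "upper2 x" "upper2 x ** n"]
      adj2_cancel(4)[of "lower2 y" "lower2 y ** n"] by simp_all
  then have "n$1$2 = 0 \<and> n$2$1 = 0 \<and> n$1$1 = n$2$2"
    using x(1) y(1) unfolding mat_eq_iff by (simp add: upper2_def lower2_def)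
  then show ?thesis using scalar_det_one det_snd[OF n] by blast
qed

text \<open>Cocompactness at (1, B) gives a lattice element whose first component is bounded, hence
  in a finite set \<open>F\<close> since the projection is discrete. Dividing by a chosen element
  \<open>(M, s M)\<close> over it lands in the kernel, and the bound grows by the factor
  \<open>S\<close>.\<close>

lemma kernel_cocompact:
  assumes disc: "e > 0" "\<And>M. M \<in> fst ` L \<Longrightarrow> dist M (mat 1) < e \<Longrightarrow> M = mat 1"
  shows "\<exists>R. \<forall>B. det B = 1 \<longrightarrow> (\<exists>N. (mat 1, N) \<in> L \<and> norm (adj2 N ** B) \<le> R)"
proof -
  obtain R where R: "\<And>A B. det A = 1 \<Longrightarrow> det B = 1 \<Longrightarrow>
      \<exists>M N. (M, N) \<in> L \<and> norm (adj2 M ** A) \<le> R \<and> norm (adj2 N ** B) \<le> R"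
    using cocompact_L by blast
  define F where "F = {M \<in> fst ` L. norm M \<le> R}"
  have dF: "det M = 1" if "M \<in> fst ` L" for M using that det_fst by auto
  have "finite F"
  proof (rule finite_if_convergent_eventually_const)
    show "bounded F" unfolding F_def bounded_iff by blast
    fix X :: "nat \<Rightarrow> real^2^2" and l assume X: "\<And>n. X n \<in> F" "X \<longlonglongrightarrow> l"
    have XL: "X n \<in> fst ` L" "det (X n) = 1" for n using X(1)[of n] dF by (auto simp: F_def)
    then have "det l = 1" using det_one_limit[OF X(2)] by blast
    define f :: "(real^2^2) \<times> (real^2^2) \<Rightarrow> real^2^2" where "f = (\<lambda>(p, q). adj2 p ** q)"
    show "\<exists>k. \<forall>n\<ge>k. X n = l"
    proof (rule eventually_const_of_separated[OF X(2) _ disc(1), of f])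
      show "continuous_on UNIV f" unfolding f_def case_prod_unfold by (intro continuous_intros)
      fix m n assume "dist (f (X m, X n)) (f (l, l)) < e"
      then have "dist (adj2 (X m) ** X n) (mat 1) < e"
        using \<open>det l = 1\<close> by (simp add: f_def adj2_left)
      moreover have "adj2 (X m) ** X n \<in> fst ` L"
      proof -
        obtain P Q where "(X m, P) \<in> L" "(X n, Q) \<in> L" using XL(1)[of m] XL(1)[of n] by auto
        then have "(adj2 (X m) ** X n, adj2 P ** Q) \<in> L" by (intro mult_L adj_L)
        then show ?thesis by force
      qed
      ultimately have "adj2 (X m) ** X n = mat 1" using disc(2) by blast
      then have "X m ** (adj2 (X m) ** X n) = X m" by simp
      then show "X m = X n" using adj2_cancel(2) XL(2) by simp
    qed
  qed
  have "\<forall>M\<in>F. \<exists>N. (M, N) \<in> L" by (force simp: F_def)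
  then obtain s where s: "\<And>M. M \<in> F \<Longrightarrow> (M, s M) \<in> L" by metis
  obtain S where S: "\<And>M. M \<in> F \<Longrightarrow> norm (s M) \<le> S"
    using finite_imp_bounded[OF finite_imageI[OF \<open>finite F\<close>, of s]] by (auto simp: bounded_iff)
  show ?thesis
  proof (intro exI[of _ "S * R"] allI impI)
    fix B :: "real^2^2" assume "det B = 1"
    then obtain M N where MN: "(M, N) \<in> L" "norm (adj2 M ** mat 1) \<le> R" "norm (adj2 N ** B) \<le> R"
      using R[of "mat 1" B] by auto
    then have F: "M \<in> F" by (force simp: F_def)
    have "(M ** adj2 M, N ** adj2 (s M)) \<in> L" by (intro mult_L adj_L s F MN)
    then have "(mat 1, N ** adj2 (s M)) \<in> L" using adj2_right det_fst[OF MN(1)] by simp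
    moreover have "adj2 (N ** adj2 (s M)) ** B = s M ** (adj2 N ** B)"
      by (simp add: adj2_mult matrix_mul_assoc)
    moreover have "norm (s M ** (adj2 N ** B)) \<le> S * R"
      using S[OF F] MN(3) order_trans[OF norm_ge_zero S[OF F]]
      by (intro order_trans[OF norm_mat_mult_le mult_mono]) simp_all
    ultimately show "\<exists>N. (mat 1, N) \<in> L \<and> norm (adj2 N ** B) \<le> S * R" by metis
  qed
qed

text \<open>The kernel of the first projection is cocompact in the second factor, so it contains two
  non-commuting elements. For a second component \<open>N\<close> near 1 the commutator with a
  kernel element is a kernel element near 1, hence trivial; commuting with both makes
  \<open>N\<close> scalar.\<close>

lemma discrete_snd_if_discrete_fst:
  assumes disc: "e > 0" "\<And>M. M \<in> fst ` L \<Longrightarrow> dist M (mat 1) < e \<Longrightarrow> M = mat 1"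
  shows "\<exists>e>0. \<forall>N\<in>snd ` L. dist N (mat 1) < e \<longrightarrow> N = mat 1"
proof -
  obtain R where R: "\<And>B. det B = 1 \<Longrightarrow> \<exists>N. (mat 1, N) \<in> L \<and> norm (adj2 N ** B) \<le> R"
    using kernel_cocompact[OF disc] by blast
  have noncentral: "Z = 0"
    if Z: "Z$1$1 + Z$2$2 = 0" and comm: "\<And>N. (mat 1, N) \<in> L \<Longrightarrow> Z ** N = N ** Z" for Z
  proof (rule cocompact_fixed_zero[OF Z, of "{N. (mat 1, N) \<in> L}" R])
    show "det N = 1 \<and> (adj2 N ** Z ** N = Z \<or> adj2 N ** Z ** N = - Z)" if "N \<in> {N. (mat 1, N) \<in> L}" for N
      using that det_snd comm conj_eq_iff by blast
  qed (use R in blast)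
  \<comment> \<open>Any non-zero traceless matrix would serve: not commuting with it shows that
    \<open>m0\<close> is not \<plusminus> 1.\<close>
  define Z0 where "Z0 = mat2 1 0 0 (-1)"
  have "Z0 \<noteq> 0" unfolding mat_eq_iff by (simp add: Z0_def)
  then obtain m0 where m0: "(mat 1, m0) \<in> L" "Z0 ** m0 \<noteq> m0 ** Z0"
    using noncentral[of Z0] by (auto simp: Z0_def)
  have "trless2 m0 \<noteq> 0"
    using m0(2) trless2_eq_0_iff[OF det_snd[OF m0(1)]] by auto
  then obtain m1 where m1: "(mat 1, m1) \<in> L" "trless2 m0 ** m1 \<noteq> m1 ** trless2 m0"
    using noncentral[of "trless2 m0"] by (auto simp: field_simps)
  have m01: "m0 ** m1 \<noteq> m1 ** m0" using m1(2) commute_trless2_iff[of m1 m0] by metis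
  obtain d where d: "d > 0" "\<And>M N. (M, N) \<in> L \<Longrightarrow> dist M (mat 1) < d \<Longrightarrow> dist N (mat 1) < d \<Longrightarrow>
      M = mat 1 \<and> N = mat 1"
    using discrete_L by blast
  have near: "\<exists>e>0. \<forall>N\<in>snd ` L. dist N (mat 1) < e \<longrightarrow> N ** m = m ** N" if m: "(mat 1, m) \<in> L" for m
  proof -
    define f where "f N = N ** m ** adj2 N ** adj2 m" for N
    have "continuous_on UNIV f" unfolding f_def by (intro continuous_intros)
    then have "isCont f (mat 1)" by (simp add: continuous_on_eq_continuous_at)
    moreover have f1: "f (mat 1) = mat 1" using adj2_right[OF det_snd[OF m]] by (simp add: f_def)
    ultimately obtain e where e: "e > 0" "\<And>N. dist N (mat 1) < e \<Longrightarrow> dist (f N) (mat 1) < d"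
      using d(1) unfolding continuous_at_eps_delta by metis
    have "N ** m = m ** N" if N: "N \<in> snd ` L" "dist N (mat 1) < e" for N
    proof -
      obtain M where MN: "(M, N) \<in> L" using N(1) by auto
      have "(M ** mat 1 ** adj2 M ** adj2 (mat 1), f N) \<in> L"
        unfolding f_def by (intro mult_L adj_L MN m)
      then have "(mat 1, f N) \<in> L" using adj2_right[OF det_fst[OF MN]] by simp
      then have "f N = mat 1" using d e(2)[OF N(2)] by auto
      then have "f N ** m ** N = m ** N" by simp
      then show ?thesis unfolding f_def using adj2_cancel(4) det_snd m MN by metis
    qed
    then show ?thesis using e(1) by blast
  qed
  obtain e0 where e0: "e0 > 0" "\<And>N. N \<in> snd ` L \<Longrightarrow> dist N (mat 1) < e0 \<Longrightarrow> N ** m0 = m0 ** N"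
    using near[OF m0(1)] by blast
  obtain e1 where e1: "e1 > 0" "\<And>N. N \<in> snd ` L \<Longrightarrow> dist N (mat 1) < e1 \<Longrightarrow> N ** m1 = m1 ** N"
    using near[OF m1(1)] by blast
  \<comment> \<open>The bound 1 excludes the scalar matrix -1, whose diagonal entries are at
    distance 2 from 1.\<close>
  have "N = mat 1" if N: "N \<in> snd ` L" "dist N (mat 1) < min (min e0 e1) 1" for N
  proof -
    have "det N = 1" using N(1) det_snd by auto
    have "trless2 N = 0"
    proof (rule ccontr)
      assume "trless2 N \<noteq> 0"
      then have "m0 ** m1 = m1 ** m0"
        by (rule centraliser_commutative) (use e0(2) e1(2) N in auto)
      then show False using m01 by blast
    qed
    then consider "N = mat 1" | "N = - mat 1" using trless2_eq_0_iff[OF \<open>det N = 1\<close>] by blast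
    then show ?thesis
    proof cases
      case 2
      have "\<bar>(N - mat 1)$1$1\<bar> < 1"
        using norm_mat_entry_le[of "N - mat 1" 1 1] N(2) by (simp add: dist_norm)
      then show ?thesis unfolding 2 by simp
    qed
  qed
  then show ?thesis using e0(1) e1(1) by (intro exI[of _ "min (min e0 e1) 1"]) auto
qed

end

section \<open>Density of Borel orbits\<close>

text \<open>Irreducibility is represented by the density of both projections, which
  \<open>irreducible_lattice2_lift\<close> derives from it.\<close>

locale irreducible_lattice2 = cocompact_lattice2 +
  assumes closure_fst: "det A = 1 \<Longrightarrow> A \<in> closure (fst ` L)"
    and closure_snd: "det B = 1 \<Longrightarrow> B \<in> closure (snd ` L)"
begin

lemma swap_irreducible: "irreducible_lattice2 (prod.swap ` L)"
proof -
  have "fst ` prod.swap ` L = snd ` L" "snd ` prod.swap ` L = fst ` L" by force+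
  then show ?thesis
    unfolding irreducible_lattice2_def irreducible_lattice2_axioms_def
    using swap_lattice closure_fst closure_snd by metis
qed

lemma fst_trivial_imp_snd_trivial:
  assumes "(M, N) \<in> L" "M = mat 1 \<or> M = - mat 1"
  shows "N = mat 1 \<or> N = - mat 1"
proof -
  have "(mat 1, N) \<in> L" using assms minus_fst[OF assms(1)] by auto
  then show ?thesis using kernel_snd_trivial[OF closure_snd] by blast
qed

lemma snd_trivial_imp_fst_trivial:
  assumes "(M, N) \<in> L" "N = mat 1 \<or> N = - mat 1"
  shows "M = mat 1 \<or> M = - mat 1"
  using irreducible_lattice2.fst_trivial_imp_snd_trivial[OF swap_irreducible] assms
  unfolding mem_swap by blast

lemma approximate_fst:
  assumes "det A = 1"
  obtains M N where "\<And>k. (M k, N k) \<in> L" "M \<longlonglongrightarrow> A"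
proof -
  obtain M where M: "\<And>k. M k \<in> fst ` L" "M \<longlonglongrightarrow> A"
    by (rule closure_sequenceE[OF closure_fst[OF assms]]) (rule that)
  have "\<exists>N. (M k, N) \<in> L" for k using M(1)[of k] by auto
  then obtain N where "\<And>k. (M k, N k) \<in> L" by metis
  then show thesis using that M(2) by blast
qed

lemma approximate_snd:
  assumes "det B = 1"
  obtains M N where "\<And>k. (M k, N k) \<in> L" "N \<longlonglongrightarrow> B"
proof -
  obtain N where N: "\<And>k. N k \<in> snd ` L" "N \<longlonglongrightarrow> B"
    by (rule closure_sequenceE[OF closure_snd[OF assms]]) (rule that)
  have "\<exists>M. (M, N k) \<in> L" for k using N(1)[of k] by auto
  then obtain M where "\<And>k. (M k, N k) \<in> L" by metis
  then show thesis using that N(2) by blast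
qed

lemma fst_near_identity:
  assumes "e > 0"
  shows "\<exists>M N. (M, N) \<in> L \<and> M \<noteq> mat 1 \<and> dist M (mat 1) < e"
proof -
  \<comment> \<open>\<open>upper2 x\<close> is at distance exactly \<open>x\<close> from 1, so an
    element within less than \<open>x\<close> of it differs from 1 and is within 2 x = e.\<close>
  define x where "x = e / 2"
  have "norm (upper2 x - mat 1) = \<bar>x\<bar>"
    by (rule power2_eq_imp_eq) (simp_all add: norm_sq_mat upper2_def)
  then have d: "dist (upper2 x) (mat 1) = x" using assms by (simp add: dist_norm x_def)
  obtain M where M: "M \<in> fst ` L" "dist M (upper2 x) < x"
  proof -
    have "x > 0" using assms by (simp add: x_def)
    then show thesis
      using that closure_fst[of "upper2 x"] unfolding closure_approachable by (metis det_special(1))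
  qed
  have "M \<noteq> mat 1" using M(2) d by (metis dist_commute less_irrefl)
  moreover have "dist M (mat 1) < e"
    using dist_triangle[of M "mat 1" "upper2 x"] M(2) d by (simp add: x_def)
  ultimately show ?thesis using M(1) by auto
qed

section \<open>Minimality of the Borel action on the second factor\<close>

definition borel_closed :: "((real^2^2) \<times> (real^2^2)) set \<Rightarrow> bool" where
  "borel_closed Z \<longleftrightarrow> closed Z \<and>
    (\<forall>M N A B. (M, N) \<in> L \<longrightarrow> (A, B) \<in> Z \<longrightarrow> (M ** A, N ** B) \<in> Z) \<and>
    (\<forall>A B b. (A, B) \<in> Z \<longrightarrow> det b = 1 \<longrightarrow> b$2$1 = 0 \<longrightarrow> (A, B ** b) \<in> Z)"

lemma borel_closedD:
  assumes "borel_closed Z"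
  shows "closed Z" "\<And>M N A B. (M, N) \<in> L \<Longrightarrow> (A, B) \<in> Z \<Longrightarrow> (M ** A, N ** B) \<in> Z"
    "\<And>A B b. (A, B) \<in> Z \<Longrightarrow> det b = 1 \<Longrightarrow> b$2$1 = 0 \<Longrightarrow> (A, B ** b) \<in> Z"
  using assms unfolding borel_closed_def by blast+

text \<open>Lattice elements of bounded norm form a finite set, so their non-trivial first
  components keep away from 1; hence the norms of \<open>N n\<close> tend to infinity. The
  normalised matrices have determinant \<open>norm (N n)\<close> to the power -2, so their limit is
  singular.\<close>

lemma contracting_sequence:
  obtains M N T where "\<And>n::nat. (M n, N n) \<in> L" "M \<longlonglongrightarrow> mat 1" "\<And>n. norm (N n) > 0"
    "(\<lambda>n. N n /\<^sub>R norm (N n)) \<longlonglongrightarrow> T" "T \<noteq> 0" "det T = 0"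
proof -
  have "\<exists>M N. (M, N) \<in> L \<and> M \<noteq> mat 1 \<and> dist M (mat 1) < inverse (real (Suc n))" for n
    by (rule fst_near_identity) simp
  then obtain M N where MN: "\<And>n. (M n, N n) \<in> L" "\<And>n. M n \<noteq> mat 1"
    "\<And>n. dist (M n) (mat 1) < inverse (real (Suc n))"
    by metis
  have M1: "M \<longlonglongrightarrow> mat 1"
    unfolding tendsto_dist_iff[of M]
    by (rule tendsto_sandwich[OF _ _ tendsto_const LIMSEQ_inverse_real_of_nat])
      (auto intro!: always_eventually less_imp_le[OF MN(3)] simp del: of_nat_Suc)
  have unbounded: "filterlim (\<lambda>n. norm (N n)) at_top sequentially"
    unfolding filterlim_at_top
  proof
    fix r :: real
    define F where "F = {p \<in> L. norm (fst p) \<le> norm (mat 1 :: real^2^2) + 1 \<and> norm (snd p) \<le> r}"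
    \<comment> \<open>The least distance from 1 among the non-trivial first components in
      \<open>F\<close>. Inserting 1 covers the empty case and keeps \<open>M n\<close> within the
      norm bound of \<open>F\<close>.\<close>
    define \<delta> where "\<delta> = Min (insert 1 ((\<lambda>p. dist (fst p) (mat 1)) ` {p \<in> F. fst p \<noteq> mat 1}))"
    have fin: "finite F" unfolding F_def by (rule finite_bounded_L)
    then have "\<delta> > 0" unfolding \<delta>_def by (subst Min_gr_iff) auto
    have \<delta>: "\<delta> \<le> dist (fst p) (mat 1)" if "p \<in> F" "fst p \<noteq> mat 1" for p
      unfolding \<delta>_def using fin that by (intro Min_le) auto
    have "\<delta> \<le> 1" unfolding \<delta>_def using fin by (intro Min_le) auto
    have "\<forall>\<^sub>F n in sequentially. dist (M n) (mat 1) < \<delta>"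
      using M1 \<open>\<delta> > 0\<close> by (simp add: tendsto_iff)
    then show "\<forall>\<^sub>F n in sequentially. r \<le> norm (N n)"
    proof eventually_elim
      case (elim n)
      have "norm (M n) \<le> norm (mat 1 :: real^2^2) + 1"
        using elim \<open>\<delta> \<le> 1\<close> norm_triangle_ineq2[of "M n" "mat 1"] by (simp add: dist_norm)
      then show ?case
        using \<delta>[of "(M n, N n)"] elim MN(1,2)[of n] by (force simp: F_def)
    qed
  qed
  have N0: "norm (N n) > 0" for n using det_snd[OF MN(1)[of n]] by (auto simp: det_2)
  define v where "v n = N n /\<^sub>R norm (N n)" for n
  have nv: "norm (v n) = 1" for n using N0[of n] by (simp add: v_def)
  then have "bounded (range v)" by (auto simp: bounded_iff)
  then obtain T r where r: "strict_mono (r :: nat \<Rightarrow> nat)" "(v \<circ> r) \<longlonglongrightarrow> T"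
    using bounded_imp_convergent_subsequence[of v] by blast
  have "(\<lambda>n. norm ((v \<circ> r) n)) \<longlonglongrightarrow> norm T" by (intro tendsto_intros r)
  then have "T \<noteq> 0" using nv by (auto simp: LIMSEQ_const_iff)
  have "det (v n) = inverse (norm (N n)) * inverse (norm (N n))" for n
    using det_snd[OF MN(1)[of n]] by (simp add: v_def det_scaleR2 power2_eq_square)
  then have dv: "(\<lambda>n. det (v n)) = (\<lambda>n. inverse (norm (N n)) * inverse (norm (N n)))" by blast
  have "(\<lambda>n. inverse (norm (N n))) \<longlonglongrightarrow> 0" by (rule tendsto_inverse_0_at_top[OF unbounded])
  from tendsto_mult[OF this this] have "(\<lambda>n. det (v n)) \<longlonglongrightarrow> 0" unfolding dv by simp
  from LIMSEQ_subseq_LIMSEQ[OF this r(1)] have "(\<lambda>n. det ((v \<circ> r) n)) \<longlonglongrightarrow> 0" by (simp add: o_def)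
  then have "det T = 0" using tendsto_det2[OF r(2)] LIMSEQ_unique by blast
  show thesis
    by (rule that[of "M \<circ> r" "N \<circ> r" T])
      (use MN(1) N0 LIMSEQ_subseq_LIMSEQ[OF M1 r(1)] r(2) \<open>T \<noteq> 0\<close> \<open>det T = 0\<close>
        in \<open>simp_all add: v_def o_def\<close>)
qed

text \<open>The first column of \<open>P\<close> spans the image of \<open>T\<close>, so the inverse
  of \<open>P\<close> clears the second row. On the boundary circle P(\<infinity>) is the image of
  the contraction, and the row (a, b) determines the kernel point.\<close>

lemma rank_one_factor:
  fixes T :: "real^2^2"
  assumes "T \<noteq> 0" "det T = 0"
  obtains P a b where "det P = 1" "adj2 P ** T = mat2 a b 0 0" "T = P ** mat2 a b 0 0" "a \<noteq> 0 \<or> b \<noteq> 0"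
proof -
  have d: "T$1$1 * T$2$2 = T$1$2 * T$2$1" using assms(2) by (simp add: det_2)
  have "\<exists>u v. (u \<noteq> 0 \<or> v \<noteq> 0) \<and> u * T$2$1 = v * T$1$1 \<and> u * T$2$2 = v * T$1$2"
  proof (cases "T$1$1 = 0 \<and> T$2$1 = 0")
    case True
    then have "T$1$2 \<noteq> 0 \<or> T$2$2 \<noteq> 0" using assms(1) by (auto simp: mat_eq_iff)
    then show ?thesis using True by (intro exI[of _ "T$1$2"] exI[of _ "T$2$2"]) (auto simp: mult.commute)
  next
    case False
    then show ?thesis
      using d by (intro exI[of _ "T$1$1"] exI[of _ "T$2$1"]) (auto simp: mult.commute)
  qed
  then obtain u v where uv: "u \<noteq> 0 \<or> v \<noteq> 0" "u * T$2$1 = v * T$1$1" "u * T$2$2 = v * T$1$2" by blast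
  obtain P :: "real^2^2" where P: "det P = 1" "P$1$1 = u" "P$2$1 = v"
    using sl2_first_column[OF uv(1)] by blast
  define S where "S = adj2 P ** T"
  have S: "S = mat2 (S$1$1) (S$1$2) 0 0"
    unfolding mat_eq_iff using uv P by (simp add: S_def)
  have TS: "T = P ** S" unfolding S_def using adj2_cancel(2)[OF P(1)] by simp
  have "S$1$1 \<noteq> 0 \<or> S$1$2 \<noteq> 0"
  proof (rule ccontr)
    assume "\<not> ?thesis"
    then have "S = 0" using S by (simp add: mat_eq_iff)
    then show False using TS assms(1) by (simp add: mat_eq_iff)
  qed
  then show thesis using that[OF P(1)] S TS unfolding S_def by metis
qed

text \<open>The elements of a sequence \<open>(M n, N n)\<close> with \<open>M n \<rightarrow> 1\<close> and \<open>N n \<rightarrow> \<infinity>\<close> contract the second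
  boundary circle, away from the kernel of the limit \<open>T\<close> of the directions of \<open>N n\<close>, to the image
  of \<open>T\<close>.\<close>

lemma contraction_limit:
  assumes Z: "borel_closed Z"
    and MN: "\<And>n::nat. (M n, N n) \<in> L" "M \<longlonglongrightarrow> mat 1" "\<And>n. c n > 0" "(\<lambda>n. N n /\<^sub>R c n) \<longlonglongrightarrow> T"
    and P: "det P = 1" "T = P ** mat2 a b 0 0"
    and z: "(z1, z2) \<in> Z" "det z2 = 1" "(mat2 a b 0 0 ** z2)$1$1 \<noteq> 0"
  shows "(z1, P) \<in> Z"
proof -
  note left = borel_closedD(2)[OF Z] and borel = borel_closedD(3)[OF Z]
  define K where "K n = adj2 P ** N n ** z2" for n
  have dK: "det (K n) = 1" for n
    unfolding K_def by (intro det_one_mult z) (use P det_snd[OF MN(1)] in auto)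
  have "adj2 P ** T ** z2 = mat2 a b 0 0 ** z2" unfolding P(2) adj2_cancel(1)[OF P(1)] by (rule refl)
  moreover have "(\<lambda>n. adj2 P ** (N n /\<^sub>R c n) ** z2) \<longlonglongrightarrow> adj2 P ** T ** z2"
    by (intro tendsto_intros MN)
  ultimately have lim: "(\<lambda>n. K n /\<^sub>R c n) \<longlonglongrightarrow> mat2 a b 0 0 ** z2" by (simp add: K_def)
  define t where "t = (mat2 a b 0 0 ** z2)$1$1"
  have l1: "(\<lambda>n. K n$1$1 / c n) \<longlonglongrightarrow> t" and l2: "(\<lambda>n. K n$2$1 / c n) \<longlonglongrightarrow> 0"
    using lim unfolding tendsto_mat_iff by (simp_all add: t_def divide_inverse_commute)
  have t: "t \<noteq> 0" using z(3) by (simp add: t_def)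
  \<comment> \<open>The slope of the first column: \<open>K n\<close> is \<open>lower2 (x n)\<close>
    times an upper triangular matrix, and the matrix \<open>B\<close> below cancels the
    latter.\<close>
  define x where "x n = K n$2$1 / K n$1$1" for n
  have "(\<lambda>n. (K n$2$1 / c n) / (K n$1$1 / c n)) \<longlonglongrightarrow> 0 / t" by (intro tendsto_divide l1 l2 t)
  moreover have "(K n$2$1 / c n) / (K n$1$1 / c n) = x n" for n using MN(3)[of n] by (simp add: x_def)
  ultimately have x: "x \<longlonglongrightarrow> 0" by simp
  have ev: "\<forall>\<^sub>F n in sequentially. K n$1$1 / c n \<noteq> 0" by (rule tendsto_imp_eventually_ne[OF l1 t])
  have "\<forall>\<^sub>F n in sequentially. (M n ** z1, P ** lower2 (x n)) \<in> Z"
    using ev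
  proof eventually_elim
    case (elim n)
    then have K0: "K n$1$1 \<noteq> 0" by auto
    define B where "B = adj2 (lower2 (- x n) ** K n)"
    have "det B = 1" unfolding B_def by (simp add: det_one_mult dK)
    moreover have "B$2$1 = 0" using K0 by (simp add: B_def lower2_def x_def)
    ultimately have "(M n ** z1, N n ** z2 ** B) \<in> Z" by (intro borel left MN z)
    moreover have "N n ** z2 ** B = P ** lower2 (x n)"
    proof -
      have "N n ** z2 ** B = P ** (K n ** B)"
        unfolding K_def by (simp add: matrix_mul_assoc adj2_right[OF P(1)])
      also have "K n ** B = lower2 (x n)"
        unfolding B_def adj2_mult adj2_special using adj2_right[OF dK] by (simp add: matrix_mul_assoc)
      finally show ?thesis .
    qed
    ultimately show ?case by simp
  qed
  moreover have "(\<lambda>n. (M n ** z1, P ** lower2 (x n))) \<longlonglongrightarrow> (mat 1 ** z1, P ** mat2 1 0 0 1)"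
    unfolding lower2_def by (intro tendsto_intros MN x)
  moreover have "mat2 1 0 0 1 = mat 1" by (simp add: mat_eq_iff)
  ultimately show ?thesis using Lim_in_closed_set[OF borel_closedD(1)[OF Z]] by fastforce
qed

text \<open>Here z(\<infinity>) is the kernel point of the contraction. A conjugate \<open>D\<close>
  of a lower unipotent moves both z(\<infinity>) (by its inverse) and P(\<infinity>) (by itself) off
  that point. These are open conditions, so density supplies a lattice element.\<close>

lemma snd_avoiding:
  assumes ab: "a \<noteq> 0 \<or> b \<noteq> 0" and P: "det P = 1" and z: "det z = 1" "(mat2 a b 0 0 ** z)$1$1 = 0"
  shows "\<exists>D1 D2. (D1, D2) \<in> L \<and> (mat2 a b 0 0 ** (adj2 D2 ** z))$1$1 \<noteq> 0 \<and>
    (mat2 a b 0 0 ** (D2 ** P))$1$1 \<noteq> 0"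
proof -
  define S where "S = mat2 a b 0 0 ** z"
  define W where "W = adj2 z ** P"
  have S11: "S$1$1 = 0" using z by (simp add: S_def)
  have S12: "S$1$2 \<noteq> 0"
  proof
    assume "S$1$2 = 0"
    then have "S = 0" using S11 by (simp add: mat_eq_iff S_def)
    then have "S ** adj2 z = 0" by (simp add: mat_eq_iff)
    then have "mat2 a b 0 0 = 0" unfolding S_def using adj2_cancel(3)[OF z(1)] by simp
    then show False using ab by (simp add: mat_eq_iff)
  qed
  have "det W = 1" unfolding W_def using z P by (intro det_one_mult) auto
  then have W0: "W$1$1 \<noteq> 0 \<or> W$2$1 \<noteq> 0" by (auto simp: det_2)
  \<comment> \<open>A non-zero affine function of x has at most one root, so 1 or 2 works.\<close>
  obtain x where x: "x \<noteq> 0" "W$2$1 + x * W$1$1 \<noteq> 0"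
  proof (cases "W$2$1 + 1 * W$1$1 = 0")
    case True
    then have "W$2$1 + 2 * W$1$1 \<noteq> 0" using W0 by auto
    then show ?thesis using that[of 2] by simp
  qed (use that[of 1] in simp)
  define D where "D = z ** lower2 x ** adj2 z"
  have dD: "det D = 1" unfolding D_def using z by (intro det_one_mult) auto
  have "mat2 a b 0 0 ** (adj2 D ** z) = S ** lower2 (- x)"
    unfolding D_def S_def
    by (simp add: adj2_mult adj2_special matrix_mul_assoc adj2_cancel[OF z(1)] adj2_right[OF z(1)])
  then have 1: "(mat2 a b 0 0 ** (adj2 D ** z))$1$1 \<noteq> 0"
    using S11 S12 x(1) by (simp add: lower2_def)
  have "mat2 a b 0 0 ** (D ** P) = S ** lower2 x ** W"
    unfolding D_def S_def W_def by (simp add: matrix_mul_assoc)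
  moreover have "(S ** lower2 x ** W)$1$1 = S$1$2 * (W$2$1 + x * W$1$1)"
    using S11 by (simp add: lower2_def algebra_simps)
  ultimately have 2: "(mat2 a b 0 0 ** (D ** P))$1$1 \<noteq> 0" using S12 x(2) by simp
  obtain D1 D2 where D12: "\<And>k. (D1 k, D2 k) \<in> L" "D2 \<longlonglongrightarrow> D"
    by (rule approximate_snd[OF dD]) (rule that)
  have "\<forall>\<^sub>F k in sequentially. (mat2 a b 0 0 ** (adj2 (D2 k) ** z))$1$1 \<noteq> 0"
    by (rule tendsto_imp_eventually_ne[OF _ 1]) (intro tendsto_intros D12)
  moreover have "\<forall>\<^sub>F k in sequentially. (mat2 a b 0 0 ** (D2 k ** P))$1$1 \<noteq> 0"
    by (rule tendsto_imp_eventually_ne[OF _ 2]) (intro tendsto_intros D12)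
  ultimately have "\<forall>\<^sub>F k in sequentially. (mat2 a b 0 0 ** (adj2 (D2 k) ** z))$1$1 \<noteq> 0 \<and>
      (mat2 a b 0 0 ** (D2 k ** P))$1$1 \<noteq> 0"
    by (rule eventually_conj)
  then obtain k where "(mat2 a b 0 0 ** (adj2 (D2 k) ** z))$1$1 \<noteq> 0 \<and>
      (mat2 a b 0 0 ** (D2 k ** P))$1$1 \<noteq> 0"
    using eventually_happens'[OF sequentially_bot] by blast
  then show ?thesis using D12(1) by blast
qed

text \<open>Contraction replaces the second component by \<open>P\<close> and keeps the first one.
  Density of the first projection then puts all \<open>(y, P)\<close> into \<open>Z\<close>, and
  density of the second one moves \<open>P\<close> to \<open>B\<close>, the first component being
  free to compensate.\<close>

lemma borel_minimal:
  assumes Z: "borel_closed Z"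
    and z: "(z1, z2) \<in> Z" "det z1 = 1" "det z2 = 1"
    and AB: "det A = 1" "det B = 1"
  shows "(A, B) \<in> Z"
proof -
  note closed_Z = borel_closedD(1)[OF Z] and left = borel_closedD(2)[OF Z]
  obtain M N T where MN: "\<And>n::nat. (M n, N n) \<in> L" "M \<longlonglongrightarrow> mat 1" "\<And>n. norm (N n) > 0"
    "(\<lambda>n. N n /\<^sub>R norm (N n)) \<longlonglongrightarrow> T" and T: "T \<noteq> 0" "det T = 0"
    by (rule contracting_sequence) (rule that)
  obtain P a b where P: "det P = 1" "T = P ** mat2 a b 0 0" "a \<noteq> 0 \<or> b \<noteq> 0"
    by (rule rank_one_factor[OF T]) (rule that)
  note push = contraction_limit[OF Z MN P(1,2)]
  have toP: "(y1, P) \<in> Z" if y: "(y1, y2) \<in> Z" "det y2 = 1" for y1 y2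
  proof (cases "(mat2 a b 0 0 ** y2)$1$1 = 0")
    case False
    then show ?thesis by (intro push[OF y])
  next
    case True
    \<comment> \<open>At the kernel point: translate by the inverse of \<open>(D1, D2)\<close>,
      contract to \<open>P\<close>, translate back to \<open>D2 ** P\<close>, and contract once
      more. The first component returns to \<open>y1\<close>.\<close>
    obtain D1 D2 where D: "(D1, D2) \<in> L" "(mat2 a b 0 0 ** (adj2 D2 ** y2))$1$1 \<noteq> 0"
      "(mat2 a b 0 0 ** (D2 ** P))$1$1 \<noteq> 0"
      using snd_avoiding[OF P(3,1) y(2) True] by blast
    have "(adj2 D1 ** y1, adj2 D2 ** y2) \<in> Z" by (intro left adj_L D y)
    moreover have "det (adj2 D2 ** y2) = 1" using det_snd[OF D(1)] y by (intro det_one_mult) auto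
    ultimately have "(adj2 D1 ** y1, P) \<in> Z" by (rule push[OF _ _ D(2)])
    then have "(D1 ** (adj2 D1 ** y1), D2 ** P) \<in> Z" by (rule left[OF D(1)])
    then have "(y1, D2 ** P) \<in> Z" using adj2_cancel(2)[OF det_fst[OF D(1)]] by simp
    moreover have "det (D2 ** P) = 1" using det_snd[OF D(1)] P(1) by (intro det_one_mult)
    ultimately show ?thesis by (rule push[OF _ _ D(3)])
  qed
  have anyP: "(y, P) \<in> Z" if y: "det y = 1" for y
  proof -
    have "det (y ** adj2 z1) = 1" using y z by (intro det_one_mult) auto
    then obtain U V where UV: "\<And>k. (U k, V k) \<in> L" "U \<longlonglongrightarrow> y ** adj2 z1"
      by (rule approximate_fst) (rule that)
    have "(U k ** z1, P) \<in> Z" for k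
      by (rule toP[OF left[OF UV(1) z(1)]]) (intro det_one_mult det_snd[OF UV(1)] z)
    moreover have "(\<lambda>k. (U k ** z1, P)) \<longlonglongrightarrow> (y ** adj2 z1 ** z1, P)" by (intro tendsto_intros UV)
    ultimately have "(y ** adj2 z1 ** z1, P) \<in> Z"
      using closed_sequentially[OF closed_Z] by (metis (no_types, lifting))
    then show ?thesis using adj2_cancel(4)[OF z(2)] by simp
  qed
  have "det (B ** adj2 P) = 1" using AB P by (intro det_one_mult) auto
  then obtain U V where UV: "\<And>k. (U k, V k) \<in> L" "V \<longlonglongrightarrow> B ** adj2 P"
    by (rule approximate_snd) (rule that)
  have "(A, V k ** P) \<in> Z" for k
  proof -
    have "det (adj2 (U k) ** A) = 1" using det_fst[OF UV(1)] AB by (intro det_one_mult) auto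
    from left[OF UV(1)[of k] anyP[OF this]] show ?thesis using adj2_cancel(2)[OF det_fst[OF UV(1)[of k]]] by simp
  qed
  moreover have "(\<lambda>k. (A, V k ** P)) \<longlonglongrightarrow> (A, B ** adj2 P ** P)" by (intro tendsto_intros UV)
  ultimately have "(A, B ** adj2 P ** P) \<in> Z"
    using closed_sequentially[OF closed_Z] by (metis (no_types, lifting))
  then show ?thesis using adj2_cancel(4)[OF P(1)] by simp
qed

section \<open>Closed sets invariant under the diagonal group, and expansion of curves\<close>

definition invariant_closed :: "((real^2^2) \<times> (real^2^2)) set \<Rightarrow> bool" where
  "invariant_closed E \<longleftrightarrow> closed E \<and>
    (\<forall>M N A B. (M, N) \<in> L \<longrightarrow> (A, B) \<in> E \<longrightarrow> (M ** A, N ** B) \<in> E) \<and>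
    (\<forall>A B a b. (A, B) \<in> E \<longrightarrow> a > 0 \<longrightarrow> b > 0 \<longrightarrow> (A ** diag2 a, B ** diag2 b) \<in> E)"

lemma invariant_closedD:
  assumes "invariant_closed E"
  shows "closed E" "\<And>M N A B. (M, N) \<in> L \<Longrightarrow> (A, B) \<in> E \<Longrightarrow> (M ** A, N ** B) \<in> E"
    "\<And>A B a b. (A, B) \<in> E \<Longrightarrow> a > 0 \<Longrightarrow> b > 0 \<Longrightarrow> (A ** diag2 a, B ** diag2 b) \<in> E"
  using assms unfolding invariant_closed_def by blast+

lemma invariant_closed_minus:
  assumes "invariant_closed E" "(A, B) \<in> E"
  shows "(- A, B) \<in> E" "(A, - B) \<in> E"
  using invariant_closedD(2)[OF assms(1) sign_fst assms(2)]
    invariant_closedD(2)[OF assms(1) sign_snd assms(2)] by simp_all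

text \<open>\<open>Z\<close> collects the points whose whole Borel orbit stays in \<open>E\<close>,
  which makes it closed and Borel invariant. It contains \<open>(z1, z2)\<close> because an upper
  triangular matrix is, up to sign, a unipotent times a positive diagonal matrix.\<close>

lemma upper_line_dense:
  assumes E: "invariant_closed E" and z: "det z1 = 1" "det z2 = 1" "\<And>x. (z1, z2 ** upper2 x) \<in> E"
    and AB: "det A = 1" "det B = 1"
  shows "(A, B) \<in> E"
proof -
  define Z where "Z = {(A, B). \<forall>b. det b = 1 \<longrightarrow> b$2$1 = 0 \<longrightarrow> (A, B ** b) \<in> E}"
  have "(A, B) \<in> Z"
  proof (rule borel_minimal[OF _ _ z(1,2) AB])
    have "closed Z"
      unfolding closed_sequential_limits
    proof (intro allI impI, elim conjE)
      fix f l assume f: "\<forall>n. f n \<in> Z" "f \<longlonglongrightarrow> l"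
      have "(fst l, snd l ** b) \<in> E" if b: "det b = 1" "b$2$1 = 0" for b
      proof (rule closed_sequentially[OF invariant_closedD(1)[OF E]])
        show "(fst (f n), snd (f n) ** b) \<in> E" for n
          using f(1) b unfolding Z_def case_prod_unfold by blast
        show "(\<lambda>n. (fst (f n), snd (f n) ** b)) \<longlonglongrightarrow> (fst l, snd l ** b)" by (intro tendsto_intros f)
      qed
      then show "l \<in> Z" unfolding Z_def case_prod_unfold by blast
    qed
    moreover have "(M ** A, N ** B) \<in> Z" if "(M, N) \<in> L" "(A, B) \<in> Z" for M N A B
      using that invariant_closedD(2)[OF E that(1)] by (auto simp: Z_def simp flip: matrix_mul_assoc)
    moreover have "(A, B ** b) \<in> Z" if "(A, B) \<in> Z" "det b = 1" "b$2$1 = 0" for A B b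
    proof -
      have "(A, B ** (b ** b')) \<in> E" if "det b' = 1" "b'$2$1 = 0" for b'
        using \<open>(A, B) \<in> Z\<close> \<open>det b = 1\<close> \<open>b$2$1 = 0\<close> that by (simp add: Z_def det_one_mult)
      then show ?thesis by (simp add: Z_def matrix_mul_assoc)
    qed
    ultimately show "borel_closed Z" unfolding borel_closed_def by blast
    have pos: "(z1, z2 ** b) \<in> E" if b: "det b = 1" "b$2$1 = 0" "b$1$1 > 0" for b
    proof -
      have "b$1$1 * b$2$2 = 1" using b by (simp add: det_2)
      then have "b = upper2 (b$1$2 * b$1$1) ** diag2 (b$1$1)"
        using b by (simp add: mat_eq_iff special_defs field_simps)
      then have "z2 ** b = z2 ** upper2 (b$1$2 * b$1$1) ** diag2 (b$1$1)"
        by (metis matrix_mul_assoc)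
      then show ?thesis
        using invariant_closedD(3)[OF E z(3)[of "b$1$2 * b$1$1"], of 1 "b$1$1"] b by simp
    qed
    have "(z1, z2 ** b) \<in> E" if b: "det b = 1" "b$2$1 = 0" for b
    proof (cases "b$1$1 > 0")
      case False
      have "b$1$1 \<noteq> 0" using b by (auto simp: det_2)
      then have "(z1, z2 ** (- b)) \<in> E" using False b by (intro pos) auto
      then have "(z1, - (z2 ** (- b))) \<in> E" by (rule invariant_closed_minus(2)[OF E])
      then show ?thesis by simp
    qed (use pos b in blast)
    then show "(z1, z2) \<in> Z" by (simp add: Z_def)
  qed
  then have "\<forall>b. det b = 1 \<longrightarrow> b$2$1 = 0 \<longrightarrow> (A, B ** b) \<in> E" by (simp add: Z_def)
  from this[rule_format, of "mat 1"] show ?thesis by simp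
qed

lemma diag2_weyl2: "l \<noteq> 0 \<Longrightarrow> diag2 l ** adj2 weyl2 = adj2 weyl2 ** diag2 (inverse l)"
  by (simp add: mat_eq_iff special_defs)

text \<open>The Weyl element normalises the diagonal group. This transfers results on upper
  unipotents to lower ones and back.\<close>

lemma invariant_closed_weyl2:
  assumes E: "invariant_closed E"
  shows "invariant_closed {(A, B). (A, B ** adj2 weyl2) \<in> E}"
  unfolding invariant_closed_def mem_Collect_eq prod.case
proof (intro conjI allI impI)
  have "continuous_on UNIV (\<lambda>p :: (real^2^2) \<times> (real^2^2). (fst p, snd p ** adj2 weyl2))" by (intro continuous_intros)
  from closed_vimage[OF invariant_closedD(1)[OF E] this]
  show "closed {(A, B). (A, B ** adj2 weyl2) \<in> E}" by (simp add: vimage_def case_prod_unfold)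
  fix A B assume AB: "(A, B ** adj2 weyl2) \<in> E"
  show "(M ** A, N ** B ** adj2 weyl2) \<in> E" if "(M, N) \<in> L" for M N
    using invariant_closedD(2)[OF E that AB] by (simp add: matrix_mul_assoc)
  show "(A ** diag2 a, B ** diag2 b ** adj2 weyl2) \<in> E" if "a > 0" "b > 0" for a b
    using invariant_closedD(3)[OF E AB that(1), of "inverse b"] that diag2_weyl2[of b]
    by (simp flip: matrix_mul_assoc)
qed

lemma lower_line_dense:
  assumes E: "invariant_closed E" and z: "det z1 = 1" "det z2 = 1" "\<And>x. (z1, z2 ** lower2 x) \<in> E"
    and AB: "det A = 1" "det B = 1"
  shows "(A, B) \<in> E"
proof -
  have w: "weyl2 ** upper2 x ** adj2 weyl2 = lower2 (- x)" for x
    by (simp add: mat_eq_iff special_defs)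
  have "(A, B ** weyl2) \<in> {(A, B). (A, B ** adj2 weyl2) \<in> E}"
  proof (rule upper_line_dense[OF invariant_closed_weyl2[OF E] z(1)])
    show "det (z2 ** weyl2) = 1" "det (B ** weyl2) = 1" using z AB by (auto intro!: det_one_mult)
    show "(z1, z2 ** weyl2 ** upper2 x) \<in> {(A, B). (A, B ** adj2 weyl2) \<in> E}" for x
      using z(3)[of "- x"] unfolding w[symmetric] by (simp add: matrix_mul_assoc)
  qed (rule AB)
  then show ?thesis by (simp add: adj2_cancel[OF det_special(3)])
qed

text \<open>Right translation by \<open>diag2 l\<close> with \<open>l \<rightarrow> \<infinity>\<close> expands short arcs of the curve
  \<open>y \<mapsto> (c y + y X) k\<close> to long pieces of the lower unipotent group; by compactness these
  accumulate on a full unipotent orbit.\<close>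

lemma wavefront_lower:
  assumes E: "invariant_closed E" and h: "det h1 = 1" "det h2 = 1" "det k = 1"
    and c: "(c \<longlongrightarrow> 1) (nhds 0)"
    and mem: "\<And>y. \<bar>y\<bar> < 1 \<Longrightarrow> (h1, h2 ** (c y *\<^sub>R mat 1 + y *\<^sub>R X) ** k) \<in> E"
    and X: "(adj2 k ** X ** k)$2$1 \<noteq> 0"
    and AB: "det A = 1" "det B = 1"
  shows "(A, B) \<in> E"
proof -
  define Y where "Y = adj2 k ** X ** k"
  define l where "l n = real (Suc n)" for n
  have l: "l n > 0" for n by (simp add: l_def)
  have dB: "det (h2 ** k ** diag2 (l n)) = 1" for n using h l[of n] by (intro det_one_mult) auto
  obtain r M N C D where r: "strict_mono (r :: nat \<Rightarrow> nat)" and MN: "\<And>n. (M n, N n) \<in> L"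
    and C: "(\<lambda>n. adj2 (M n) ** h1) \<longlonglongrightarrow> C" and D: "(\<lambda>n. adj2 (N n) ** (h2 ** k ** diag2 (l (r n)))) \<longlonglongrightarrow> D"
    and CD: "det C = 1" "det D = 1"
    by (rule coset_sequence[of "\<lambda>_. h1" "\<lambda>n. h2 ** k ** diag2 (l n)", OF h(1) dB]) (rule that)
  have "(C, D ** lower2 x) \<in> E" for x
  proof -
    \<comment> \<open>Conjugation by \<open>diag2 (l n)\<close> multiplies the lower left entry by
      \<open>l n\<close> squared and divides the upper right one by it. The parameter
      \<open>y n\<close> makes the former exactly \<open>x\<close>; \<open>V n\<close> is the
      conjugated matrix.\<close>
    define y where "y n = x / (Y$2$1 * (l n * l n))" for n
    have "(\<lambda>n. (x / Y$2$1) * (inverse (l n) * inverse (l n))) \<longlonglongrightarrow> (x / Y$2$1) * (0 * 0)"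
      unfolding l_def by (intro tendsto_intros LIMSEQ_inverse_real_of_nat)
    then have y: "y \<longlonglongrightarrow> 0" by (simp add: y_def[abs_def] field_simps)
    have cy: "(\<lambda>n. c (y n)) \<longlonglongrightarrow> 1" using filterlim_compose[OF c y] .
    define V where "V n = mat2 (c (y n) + y n * Y$1$1) (y n * Y$1$2 * (inverse (l n) * inverse (l n)))
      x (c (y n) + y n * Y$2$2)" for n
    have linv: "(\<lambda>n. inverse (l n)) \<longlonglongrightarrow> 0" unfolding l_def by (rule LIMSEQ_inverse_real_of_nat)
    have "V \<longlonglongrightarrow> mat2 (1 + 0 * Y$1$1) (0 * Y$1$2 * (0 * 0)) x (1 + 0 * Y$2$2)"
      unfolding V_def[abs_def] by (intro tendsto_intros y cy linv)
    then have V: "V \<longlonglongrightarrow> lower2 x" by (simp add: lower2_def)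
    have split: "(c (y n) *\<^sub>R mat 1 + y n *\<^sub>R X) ** k ** diag2 (l n) = k ** diag2 (l n) ** V n" for n
    proof -
      have "V n = adj2 (diag2 (l n)) ** (c (y n) *\<^sub>R mat 1 + y n *\<^sub>R Y) ** diag2 (l n)"
        using l[of n] X unfolding mat_eq_iff
        by (simp add: V_def diag2_mat2 y_def Y_def[symmetric] field_simps)
      also have "c (y n) *\<^sub>R mat 1 + y n *\<^sub>R Y = adj2 k ** (c (y n) *\<^sub>R mat 1 + y n *\<^sub>R X) ** k"
        unfolding Y_def by (simp add: mat_mult_add_distrib adj2_left[OF h(3)])
      finally show ?thesis
        using h(3) l[of n] by (simp add: matrix_mul_assoc adj2_cancel adj2_right)
    qed
    have "\<forall>\<^sub>F n in sequentially. \<bar>y n\<bar> < 1"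
      using y by (auto simp: tendsto_iff dist_real_def)
    then have "\<forall>\<^sub>F n in sequentially. \<bar>y (r n)\<bar> < 1"
      using eventually_subseq[OF r] by blast
    then have "\<forall>\<^sub>F n in sequentially.
        (adj2 (M n) ** h1, adj2 (N n) ** (h2 ** k ** diag2 (l (r n))) ** V (r n)) \<in> E"
    proof eventually_elim
      case (elim n)
      have "(h1 ** diag2 1, h2 ** (c (y (r n)) *\<^sub>R mat 1 + y (r n) *\<^sub>R X) ** k ** diag2 (l (r n))) \<in> E"
        by (intro invariant_closedD(3)[OF E] mem elim l) simp
      also have "h2 ** (c (y (r n)) *\<^sub>R mat 1 + y (r n) *\<^sub>R X) ** k ** diag2 (l (r n)) =
          h2 ** ((c (y (r n)) *\<^sub>R mat 1 + y (r n) *\<^sub>R X) ** k ** diag2 (l (r n)))"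
        by (simp add: matrix_mul_assoc)
      finally have "(h1, h2 ** (k ** diag2 (l (r n)) ** V (r n))) \<in> E" unfolding split by simp
      from invariant_closedD(2)[OF E adj_L[OF MN[of n]] this]
      show ?case by (simp add: matrix_mul_assoc)
    qed
    moreover have "(\<lambda>n. V (r n)) \<longlonglongrightarrow> lower2 x" using LIMSEQ_subseq_LIMSEQ[OF V r] by (simp add: o_def)
    then have "(\<lambda>n. (adj2 (M n) ** h1, adj2 (N n) ** (h2 ** k ** diag2 (l (r n))) ** V (r n)))
        \<longlonglongrightarrow> (C, D ** lower2 x)" by (intro tendsto_intros C D)
    ultimately show ?thesis
      by (rule Lim_in_closed_set[OF invariant_closedD(1)[OF E] _ sequentially_bot])
  qed
  then show ?thesis by (rule lower_line_dense[OF E CD _ AB])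
qed

text \<open>The form of the curve fits both one-parameter groups: rotations, with c y = sqrt (1 -
  y^2), and diagonal matrices, with c y = sqrt (1 + y^2). The condition on \<open>X\<close> says
  that \<open>k\<close> does not conjugate its direction to a diagonal one; the Weyl element
  exchanges the two off-diagonal cases.\<close>

lemma wavefront:
  assumes E: "invariant_closed E" and h: "det h1 = 1" "det h2 = 1" "det k = 1"
    and c: "(c \<longlongrightarrow> 1) (nhds 0)"
    and mem: "\<And>y. \<bar>y\<bar> < 1 \<Longrightarrow> (h1, h2 ** (c y *\<^sub>R mat 1 + y *\<^sub>R X) ** k) \<in> E"
    and X: "(adj2 k ** X ** k)$2$1 \<noteq> 0 \<or> (adj2 k ** X ** k)$1$2 \<noteq> 0"
    and AB: "det A = 1" "det B = 1"
  shows "(A, B) \<in> E"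
proof (cases "(adj2 k ** X ** k)$2$1 = 0")
  case False
  show ?thesis by (rule wavefront_lower[OF E h c _ False AB]) (rule mem)
next
  case True
  define Y where "Y = adj2 k ** X ** k"
  have "Y$1$2 \<noteq> 0" using X True by (simp add: Y_def)
  have "(A, B ** weyl2) \<in> {(A, B). (A, B ** adj2 weyl2) \<in> E}"
  proof (rule wavefront_lower[OF invariant_closed_weyl2[OF E] h(1,2) _ c])
    show "det (k ** weyl2) = 1" "det (B ** weyl2) = 1" using h AB by (auto intro!: det_one_mult)
    show "(h1, h2 ** (c y *\<^sub>R mat 1 + y *\<^sub>R X) ** (k ** weyl2)) \<in> {(A, B). (A, B ** adj2 weyl2) \<in> E}"
      if "\<bar>y\<bar> < 1" for y
      using mem[OF that] by (simp add: matrix_mul_assoc adj2_cancel[OF det_special(3)])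
    have "adj2 (k ** weyl2) ** X ** (k ** weyl2) = adj2 weyl2 ** Y ** weyl2"
      by (simp add: Y_def adj2_mult matrix_mul_assoc)
    then show "(adj2 (k ** weyl2) ** X ** (k ** weyl2))$2$1 \<noteq> 0"
      using \<open>Y$1$2 \<noteq> 0\<close> by (simp add: weyl2_def)
  qed (rule AB)
  then show ?thesis by (simp add: adj2_cancel[OF det_special(3)])
qed

end

section \<open>Orbits of the diagonal group\<close>

definition rot2 :: "real \<Rightarrow> real^2^2" where
  "rot2 s = mat2 (cos s) (- sin s) (sin s) (cos s)"

lemma rot2_add: "rot2 (s + t) = rot2 s ** rot2 t"
  by (simp add: mat_eq_iff rot2_def cos_add sin_add)

lemma det_rot2: "det (rot2 s) = 1"
  by (simp add: rot2_def flip: power2_eq_square)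

lemma diag2_minus: "diag2 (- l) = - diag2 l"
  by (simp add: mat_eq_iff diag2_mat2)

lemma continuous_on_mat2 [continuous_intros]:
  assumes "continuous_on S a" "continuous_on S b" "continuous_on S c" "continuous_on S d"
  shows "continuous_on S (\<lambda>x. mat2 (a x) (b x) (c x) (d x))"
  using assms unfolding continuous_on by (auto intro: tendsto_mat2)

lemma conj_flip:
  assumes "det h = 1" "adj2 h ** M ** h = D"
  shows "M = h ** D ** adj2 h"
  unfolding assms(2)[symmetric]
  by (simp add: matrix_mul_assoc adj2_right[OF assms(1)] adj2_cancel[OF assms(1)])

text \<open>\<open>h\<close> sends i to the fixed point x + i y of \<open>N\<close> in the upper
  half-plane, so conjugation takes \<open>N\<close> to the stabiliser of i, the rotation
  group.\<close>

lemma elliptic_normal_form: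
  assumes N: "det N = 1" and tr: "\<bar>N$1$1 + N$2$2\<bar> < 2"
  shows "\<exists>h \<theta>. det h = 1 \<and> N = h ** rot2 \<theta> ** adj2 h"
proof -
  define a b c d where e: "a = N$1$1" "b = N$1$2" "c = N$2$1" "d = N$2$2"
  have dt: "a * d - b * c = 1" using N by (simp add: det_2 e)
  have "\<bar>a + d\<bar>\<^sup>2 < 2\<^sup>2" using tr by (intro power_strict_mono) (auto simp: e)
  then have tr2: "(a + d) * (a + d) < 4" by (simp add: power2_eq_square)
  have c0: "c \<noteq> 0"
  proof
    assume "c = 0"
    then have "(a - d) * (a - d) = (a + d) * (a + d) - 4" using dt by (simp add: algebra_simps)
    then show False using tr2 zero_le_square[of "a - d"] by linarith
  qed
  define C where "C = (a + d) / 2"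
  \<comment> \<open>The sign makes y = S / c positive, so the fixed point in the upper half-plane is
    chosen.\<close>
  define S where "S = sgn c * sqrt (1 - C\<^sup>2)"
  have C1: "C\<^sup>2 < 1" using tr2 by (simp add: C_def power2_eq_square field_simps)
  have "C\<^sup>2 + S\<^sup>2 = 1" using C1 c0 by (simp add: S_def power_mult_distrib sgn_if)
  then obtain \<theta> where th: "C = cos \<theta>" "S = sin \<theta>" using sincos_total_2pi by metis
  have SS: "S * S = 1 - C * C" using \<open>C\<^sup>2 + S\<^sup>2 = 1\<close> by (simp add: power2_eq_square)
  define y where "y = S / c"
  have y: "y > 0" using c0 C1 by (simp add: y_def S_def sgn_if field_simps)
  define x where "x = (a - d) / (2 * c)"
  define s where "s = sqrt y"
  have s: "s > 0" "s * s = y" using y by (auto simp: s_def)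
  define h where "h = mat2 s (x / s) 0 (1 / s)"
  \<comment> \<open>The same matrix with common denominator \<open>s\<close>, which lets the square
    root cancel in the entries.\<close>
  define h' where "h' = mat2 (y / s) (x / s) 0 (1 / s)"
  have hh: "h = h'" using s by (simp add: h_def h'_def mat_eq_iff field_simps)
  have dh: "det h = 1" using s by (simp add: h_def)
  have "N ** h = h ** rot2 \<theta>"
  proof -
    have Sy: "S = y * c" using c0 by (simp add: y_def)
    have ax: "a = C + x * c" "d = C - x * c" using c0 by (simp_all add: C_def x_def field_simps)
    have b: "b * c = - (x * c) * (x * c) - S * S"
      using dt SS unfolding ax by (simp add: algebra_simps)
    then have "b * c = c * (- x * x * c - y * y * c)" unfolding Sy by (simp add: algebra_simps)
    then have b: "b = - x * x * c - y * y * c" using c0 by simp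
    show ?thesis
      unfolding hh mat_eq_iff mat_mult_nth rot2_def h'_def mat2_nth e(1-4)[symmetric] th[symmetric]
      unfolding ax b Sy using s by (simp add: field_simps)
  qed
  then have "adj2 h ** N ** h = rot2 \<theta>" using conj_eq_iff[OF dh] by blast
  then show ?thesis using conj_flip[OF dh] dh by blast
qed

lemma diagonalise_upper:
  assumes "A$2$1 = 0" "A$2$2 = inverse (A$1$1)" "A$1$1 \<noteq> 0" "A$1$1 \<noteq> 1" "A$1$1 \<noteq> -1"
  shows "\<exists>r. adj2 (upper2 r) ** A ** upper2 r = diag2 (A$1$1)"
proof -
  define l where "l = A$1$1"
  have "l * l \<noteq> 1" using assms by (simp add: l_def square_eq_1_iff)
  then have l: "inverse l - l \<noteq> 0" using assms(3) by (simp add: l_def field_simps)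
  define r where "r = A$1$2 / (inverse l - l)"
  have r: "r * (inverse l - l) = A$1$2" using l by (simp add: r_def)
  have "adj2 (upper2 r) ** A ** upper2 r = diag2 l"
    unfolding mat_eq_iff using assms(1,2) r by (simp add: special_defs l_def algebra_simps)
  then show ?thesis unfolding l_def by blast
qed

text \<open>The last condition fixes the order of the two eigenlines; if it fails,
  \<open>h ** weyl2\<close> exchanges them. It ensures that a matrix h^-1 g which normalises the
  diagonal group is diagonal and not antidiagonal.\<close>

lemma hyperbolic_normal_form:
  assumes N: "det N = 1" and tr: "\<bar>N$1$1 + N$2$2\<bar> > 2" and g: "det g = 1"
  shows "\<exists>h l. det h = 1 \<and> l \<noteq> 0 \<and> l \<noteq> 1 \<and> l \<noteq> -1 \<and> adj2 h ** N ** h = diag2 l \<and>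
    (adj2 h ** g)$1$1 \<noteq> 0"
proof -
  define t where "t = N$1$1 + N$2$2"
  have "2\<^sup>2 < \<bar>t\<bar>\<^sup>2" using tr by (intro power_strict_mono) (auto simp: t_def)
  then have t4: "t * t - 4 > 0" by (simp add: power2_eq_square)
  define l where "l = (t + sqrt (t * t - 4)) / 2"
  have l: "l * l - t * l + 1 = 0" using t4 unfolding l_def by (simp add: field_simps)
  have l1: "l \<noteq> 0" "l \<noteq> 1" "l \<noteq> -1" using l tr by (auto simp: t_def)
  obtain h0 where h0: "det h0 = 1" "(adj2 h0 ** N ** h0)$1$1 = l" "(adj2 h0 ** N ** h0)$2$1 = 0"
    using conj_upper_triangular[OF N] l unfolding t_def by blast
  define A where "A = adj2 h0 ** N ** h0"
  have "det A = 1" unfolding A_def using h0 N by (intro det_one_mult) auto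
  then have "A$1$1 * A$2$2 = 1" using h0 by (simp add: det_2 A_def)
  then have "A$2$2 = inverse (A$1$1)" by (simp add: inverse_unique)
  then obtain r where r: "adj2 (upper2 r) ** A ** upper2 r = diag2 l"
    using diagonalise_upper[of A] l1 h0 by (auto simp: A_def)
  define h where "h = h0 ** upper2 r"
  have h: "det h = 1" "adj2 h ** N ** h = diag2 l"
    using h0 r by (simp_all add: h_def A_def adj2_mult matrix_mul_assoc det_one_mult)
  show ?thesis
  proof (cases "(adj2 h ** g)$1$1 = 0")
    case False
    then show ?thesis using h l1 by blast
  next
    case True
    have "det (adj2 h ** g) = 1" using h g by (intro det_one_mult) auto
    then have "(adj2 h ** g)$2$1 \<noteq> 0" using True by (auto simp: det_2)
    moreover have "adj2 (h ** weyl2) ** g = adj2 weyl2 ** (adj2 h ** g)"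
      by (simp add: adj2_mult matrix_mul_assoc)
    ultimately have "(adj2 (h ** weyl2) ** g)$1$1 \<noteq> 0" by (simp add: weyl2_def)
    moreover have "adj2 (h ** weyl2) ** N ** (h ** weyl2) = adj2 weyl2 ** (adj2 h ** N ** h) ** weyl2"
      by (simp add: adj2_mult matrix_mul_assoc)
    then have "adj2 (h ** weyl2) ** N ** (h ** weyl2) = diag2 (inverse l)"
      unfolding h(2) by (simp add: mat_eq_iff special_defs)
    moreover have "inverse l \<noteq> 0" "inverse l \<noteq> 1" "inverse l \<noteq> -1"
      using l1 by (auto simp: inverse_eq_iff_eq[of l "-1", simplified])
    moreover have "det (h ** weyl2) = 1" using h by (simp add: det_one_mult)
    ultimately show ?thesis by blast
  qed
qed

section \<open>Lifted orbits and lattice points on tori\<close>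

context irreducible_lattice2
begin

text \<open>The preimage of the orbit \<open>xA\<close> under the quotient map, see
  \<open>diag_orbit_preimage\<close>.\<close>

definition diag_sat :: "real^2^2 \<Rightarrow> real^2^2 \<Rightarrow> ((real^2^2) \<times> (real^2^2)) set" where
  "diag_sat g1 g2 = {(M ** g1 ** diag2 a, N ** g2 ** diag2 b) | M N a b. (M, N) \<in> L \<and> a > 0 \<and> b > 0}"

lemma invariant_closed_closure: "invariant_closed (closure (diag_sat g1 g2))"
proof -
  have inv: "f p \<in> closure S" if "p \<in> closure S" "continuous_on UNIV f" "\<And>p. p \<in> S \<Longrightarrow> f p \<in> S"
    for f and S :: "((real^2^2) \<times> (real^2^2)) set" and p
  proof -
    have "f ` S \<subseteq> closure S" using that(3) closure_subset by blast
    then have "f ` closure S \<subseteq> closure S"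
      by (intro image_closure_subset continuous_on_subset[OF that(2)]) auto
    then show ?thesis using that(1) by blast
  qed
  have "(M ** A, N ** B) \<in> closure (diag_sat g1 g2)"
    if MN: "(M, N) \<in> L" and AB: "(A, B) \<in> closure (diag_sat g1 g2)" for M N A B
  proof -
    let ?f = "\<lambda>p :: (real^2^2) \<times> (real^2^2). (M ** fst p, N ** snd p)"
    have "?f (A, B) \<in> closure (diag_sat g1 g2)"
    proof (rule inv[OF AB])
      show "continuous_on UNIV ?f" by (intro continuous_intros)
      fix p assume "p \<in> diag_sat g1 g2"
      then obtain M' N' a b where p: "p = (M' ** g1 ** diag2 a, N' ** g2 ** diag2 b)"
        "(M', N') \<in> L" "a > 0" "b > 0" unfolding diag_sat_def by blast
      have "?f p = ((M ** M') ** g1 ** diag2 a, (N ** N') ** g2 ** diag2 b)"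
        unfolding p by (simp add: matrix_mul_assoc)
      then show "?f p \<in> diag_sat g1 g2" using mult_L[OF MN p(2)] p(3,4) unfolding diag_sat_def by blast
    qed
    then show ?thesis by simp
  qed
  moreover have "(A ** diag2 a, B ** diag2 b) \<in> closure (diag_sat g1 g2)"
    if ab: "a > 0" "b > 0" and AB: "(A, B) \<in> closure (diag_sat g1 g2)" for a b A B
  proof -
    let ?f = "\<lambda>p :: (real^2^2) \<times> (real^2^2). (fst p ** diag2 a, snd p ** diag2 b)"
    have "?f (A, B) \<in> closure (diag_sat g1 g2)"
    proof (rule inv[OF AB])
      show "continuous_on UNIV ?f" by (intro continuous_intros)
      fix p assume "p \<in> diag_sat g1 g2"
      then obtain M N a' b' where p: "p = (M ** g1 ** diag2 a', N ** g2 ** diag2 b')"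
        "(M, N) \<in> L" "a' > 0" "b' > 0" unfolding diag_sat_def by blast
      have "?f p = (M ** g1 ** diag2 (a' * a), N ** g2 ** diag2 (b' * b))"
        unfolding p by (simp flip: matrix_mul_assoc add: diag2_mult)
      moreover have "a' * a > 0" "b' * b > 0" using p ab by auto
      ultimately show "?f p \<in> diag_sat g1 g2" using p(2) unfolding diag_sat_def by blast
    qed
    then show ?thesis by simp
  qed
  ultimately show ?thesis unfolding invariant_closed_def by auto
qed

text \<open>The part of the centraliser of \<gamma> in \<open>L\<close> lying on the one-parameter
  groups through its components, in additive coordinates. \<open>\<rho>\<close> is
  \<open>rot2\<close> for an elliptic second component and \<open>diag2\<close> of
  \<open>exp\<close> for a hyperbolic one.\<close>

definition flow_lattice :: "real^2^2 \<Rightarrow> real^2^2 \<Rightarrow> (real \<Rightarrow> real^2^2) \<Rightarrow> (real \<times> real) set" where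
  "flow_lattice h1 h2 \<rho> =
    {(t, s). (h1 ** diag2 (exp t) ** adj2 h1, h2 ** \<rho> s ** adj2 h2) \<in> L}"

lemma flow_lattice_diff:
  assumes h: "det h1 = 1" "det h2 = 1" and \<rho>: "\<And>s t. \<rho> (s + t) = \<rho> s ** \<rho> t" "\<And>s. det (\<rho> s) = 1"
    and mem: "(t, s) \<in> flow_lattice h1 h2 \<rho>" "(t', s') \<in> flow_lattice h1 h2 \<rho>"
  shows "(t - t', s - s') \<in> flow_lattice h1 h2 \<rho>"
proof -
  have 1: "h1 ** diag2 (exp t) ** adj2 h1 ** adj2 (h1 ** diag2 (exp t') ** adj2 h1) =
      h1 ** diag2 (exp (t - t')) ** adj2 h1"
    by (simp add: adj2_mult adj2_special matrix_mul_assoc adj2_cancel[OF h(1)] exp_diff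
        divide_inverse flip: diag2_mult)
  have "\<rho> s ** adj2 (\<rho> s') = \<rho> (s - s') ** \<rho> s' ** adj2 (\<rho> s')"
    by (simp flip: \<rho>(1))
  then have \<rho>': "\<rho> s ** adj2 (\<rho> s') = \<rho> (s - s')" using adj2_cancel(3)[OF \<rho>(2)] by simp
  have "h2 ** \<rho> s ** adj2 h2 ** adj2 (h2 ** \<rho> s' ** adj2 h2) = h2 ** (\<rho> s ** adj2 (\<rho> s')) ** adj2 h2"
    by (simp add: adj2_mult matrix_mul_assoc adj2_cancel[OF h(2)])
  then have 2: "h2 ** \<rho> s ** adj2 h2 ** adj2 (h2 ** \<rho> s' ** adj2 h2) = h2 ** \<rho> (s - s') ** adj2 h2"
    unfolding \<rho>' .
  from mem have "(h1 ** diag2 (exp t) ** adj2 h1 ** adj2 (h1 ** diag2 (exp t') ** adj2 h1),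
      h2 ** \<rho> s ** adj2 h2 ** adj2 (h2 ** \<rho> s' ** adj2 h2)) \<in> L"
    unfolding flow_lattice_def by (auto intro: mult_L adj_L)
  then show ?thesis unfolding 1 2 flow_lattice_def by simp
qed

lemma flow_lattice_injective:
  assumes h: "det h1 = 1" "det h2 = 1" and \<rho>: "\<And>s t. \<rho> (s + t) = \<rho> s ** \<rho> t" "\<And>s. det (\<rho> s) = 1"
    and mem: "(t, 0) \<in> flow_lattice h1 h2 \<rho>"
  shows "t = 0"
proof -
  have "\<rho> 0 = \<rho> 0 ** \<rho> 0" using \<rho>(1)[of 0 0] by simp
  then have "\<rho> 0 = mat 1" using adj2_cancel(1)[OF \<rho>(2), of 0 "\<rho> 0"] adj2_left[OF \<rho>(2), of 0] by metis
  then have L: "(h1 ** diag2 (exp t) ** adj2 h1, mat 1) \<in> L"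
    using mem h(2) by (simp add: flow_lattice_def adj2_right)
  have eq: "diag2 (exp t) = adj2 h1 ** (h1 ** diag2 (exp t) ** adj2 h1) ** h1"
    by (simp add: matrix_mul_assoc adj2_cancel[OF h(1)] adj2_left[OF h(1)])
  have "diag2 (exp t) = mat 1 \<or> diag2 (exp t) = - mat 1"
    using snd_trivial_imp_fst_trivial[OF L] adj2_left[OF h(1)] eq by auto
  then have "exp t = 1 \<or> exp t = -1" by (auto simp: mat_eq_iff diag2_mat2)
  moreover have "exp t > 0" by simp
  ultimately show "t = 0" by force
qed

text \<open>By injectivity t is a function of s on the flow lattice. Since t is unbounded below over
  |s| \<le> R, infinitely many values of s occur there.\<close>

lemma flow_lattice_snd_dense:
  assumes h: "det h1 = 1" "det h2 = 1" and \<rho>: "\<And>s t. \<rho> (s + t) = \<rho> s ** \<rho> t" "\<And>s. det (\<rho> s) = 1"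
    and unb: "\<And>n::nat. \<exists>t s. (t, s) \<in> flow_lattice h1 h2 \<rho> \<and> t < - real n \<and> \<bar>s\<bar> \<le> R"
  shows "closure (snd ` flow_lattice h1 h2 \<rho>) = UNIV"
proof (rule additive_subgroup_dense)
  let ?F = "flow_lattice h1 h2 \<rho>"
  note diff = flow_lattice_diff[OF h \<rho>]
  show "s - t \<in> snd ` ?F" if st: "s \<in> snd ` ?F" "t \<in> snd ` ?F" for s t
  proof -
    obtain s' t' where "(s', s) \<in> ?F" "(t', t) \<in> ?F" using st by auto
    then have "(s' - t', s - t) \<in> ?F" by (rule diff)
    then show ?thesis by force
  qed
  show "infinite (snd ` ?F \<inter> {-R..R})"
  proof
    assume fin: "finite (snd ` ?F \<inter> {-R..R})"
    have "\<exists>\<tau>. \<forall>s\<in>snd ` ?F. (\<tau> s, s) \<in> ?F" by (rule bchoice) auto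
    then obtain \<tau> where \<tau>: "\<And>s. s \<in> snd ` ?F \<Longrightarrow> (\<tau> s, s) \<in> ?F" by blast
    have uniq: "t = \<tau> s" if "(t, s) \<in> ?F" for t s
    proof -
      have "(\<tau> s, s) \<in> ?F" using \<tau> that by force
      from diff[OF that this] have "(t - \<tau> s, 0) \<in> ?F" by simp
      then have "t - \<tau> s = 0" by (rule flow_lattice_injective[OF h \<rho>])
      then show ?thesis by simp
    qed
    define m where "m = Min (insert 0 (\<tau> ` (snd ` ?F \<inter> {-R..R})))"
    obtain n :: nat where n: "- m < n" using reals_Archimedean2 by blast
    obtain t s where ts: "(t, s) \<in> ?F" "t < - real n" "\<bar>s\<bar> \<le> R" using unb by blast
    have "s \<in> snd ` ?F \<inter> {-R..R}" using ts by force
    then have "m \<le> \<tau> s" unfolding m_def using fin by (intro Min_le) auto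
    then show False using uniq[OF ts(1)] ts(2) n by linarith
  qed
qed

text \<open>Left translation by a flow element (t, s), corrected by the diagonal group on the right,
  turns \<open>upper2 x\<close> into \<open>upper2 (x * exp (2 * t))\<close> and inserts
  \<open>\<rho> s\<close>. As t tends to minus infinity with s bounded, the unipotent factor
  disappears in the limit.\<close>

lemma flow_orbit_mem:
  assumes E: "invariant_closed E"
    and h: "det h1 = 1" "det h2 = 1" and \<rho>: "\<And>s t. \<rho> (s + t) = \<rho> s ** \<rho> t" "\<And>s. det (\<rho> s) = 1"
    and cont: "continuous_on UNIV \<rho>"
    and unb: "\<And>n::nat. \<exists>t s. (t, s) \<in> flow_lattice h1 h2 \<rho> \<and> t < - real n \<and> \<bar>s\<bar> \<le> R"
    and mem: "(h1 ** upper2 r, h2 ** k) \<in> E"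
  shows "(h1, h2 ** \<rho> s ** k) \<in> E"
proof -
  let ?F = "flow_lattice h1 h2 \<rho>"
  have push: "(h1 ** upper2 (x * exp (2 * t)), h2 ** \<rho> s ** k') \<in> E"
    if F: "(t, s) \<in> ?F" and E': "(h1 ** upper2 x, h2 ** k') \<in> E" for t s x k'
  proof -
    have "((h1 ** diag2 (exp t) ** adj2 h1) ** (h1 ** upper2 x) ** diag2 (exp (- t)),
        (h2 ** \<rho> s ** adj2 h2) ** (h2 ** k') ** diag2 1) \<in> E"
      using F by (intro invariant_closedD(2,3)[OF E] E') (auto simp: flow_lattice_def)
    moreover have "diag2 (exp t) ** upper2 x ** diag2 (exp (- t)) = upper2 (x * exp (2 * t))"
      unfolding mat_eq_iff by (simp add: special_defs exp_minus exp_double power2_eq_square)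
    then have "(h1 ** diag2 (exp t) ** adj2 h1) ** (h1 ** upper2 x) ** diag2 (exp (- t)) =
        h1 ** upper2 (x * exp (2 * t))"
      by (simp add: matrix_mul_assoc adj2_cancel[OF h(1)]) (simp flip: matrix_mul_assoc)
    ultimately show ?thesis by (simp add: matrix_mul_assoc adj2_cancel[OF h(2)])
  qed
  note closed = invariant_closedD(1)[OF E]
  have "\<exists>s0. (h1, h2 ** \<rho> s0 ** k) \<in> E"
  proof -
    obtain t s where ts: "\<And>n::nat. (t n, s n) \<in> ?F" "\<And>n. t n < - real n" "\<And>n. \<bar>s n\<bar> \<le> R"
      using unb by metis
    have "bounded (range s)" using ts(3) by (auto simp: bounded_iff)
    then obtain s0 q where q: "strict_mono (q :: nat \<Rightarrow> nat)" "(s \<circ> q) \<longlonglongrightarrow> s0"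
      using bounded_imp_convergent_subsequence[of s] by blast
    have "filterlim (\<lambda>n. - real n) at_bot sequentially"
      by (intro filterlim_uminus_at_bot[THEN iffD2]) (simp add: filterlim_real_sequentially)
    then have "filterlim t at_bot sequentially"
      using ts(2) by (intro filterlim_at_bot_mono[of _ _ t]) (auto intro!: always_eventually less_imp_le)
    then have "filterlim (t \<circ> q) at_bot sequentially"
      unfolding o_def by (rule filterlim_compose) (rule filterlim_subseq[OF q(1)])
    then have "(\<lambda>n. exp (t (q n))) \<longlonglongrightarrow> 0" unfolding o_def by (rule filterlim_compose[OF exp_at_bot])
    then have "(\<lambda>n. r * (exp (t (q n)) * exp (t (q n)))) \<longlonglongrightarrow> r * (0 * 0)" by (intro tendsto_intros)
    then have e: "(\<lambda>n. r * exp (2 * t (q n))) \<longlonglongrightarrow> 0" by (simp add: exp_double power2_eq_square)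
    have \<rho>lim: "(\<lambda>n. \<rho> (s (q n))) \<longlonglongrightarrow> \<rho> s0"
      using cont q(2) by (auto simp: continuous_on_eq_continuous_at o_def intro: isCont_tendsto_compose)
    have lim: "(\<lambda>n. (h1 ** upper2 (r * exp (2 * t (q n))), h2 ** \<rho> (s (q n)) ** k))
        \<longlonglongrightarrow> (h1 ** mat2 1 0 0 1, h2 ** \<rho> s0 ** k)"
      unfolding upper2_def by (intro tendsto_intros e \<rho>lim)
    have mems: "(h1 ** upper2 (r * exp (2 * t (q n))), h2 ** \<rho> (s (q n)) ** k) \<in> E" for n
      by (rule push[OF ts(1) mem])
    have "(h1 ** mat2 1 0 0 1, h2 ** \<rho> s0 ** k) \<in> E" by (rule closed_sequentially[OF closed mems lim])
    moreover have "mat2 1 0 0 1 = mat 1" by (simp add: mat_eq_iff)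
    ultimately show ?thesis by auto
  qed
  then obtain s0 where s0: "(h1, h2 ** \<rho> s0 ** k) \<in> E" by blast
  \<comment> \<open>With the unipotent factor gone, a flow element may be applied whatever its t, so
    the density of the second coordinates reaches every s.\<close>
  have "s - s0 \<in> closure (snd ` ?F)" using flow_lattice_snd_dense[OF h \<rho> unb] by simp
  then obtain u where u: "\<And>n. u n \<in> snd ` ?F" "u \<longlonglongrightarrow> s - s0"
    by (rule closure_sequenceE) (rule that)
  have \<rho>lim: "(\<lambda>n. \<rho> (u n)) \<longlonglongrightarrow> \<rho> (s - s0)"
    using cont u(2) by (auto simp: continuous_on_eq_continuous_at intro: isCont_tendsto_compose)
  have mems: "(h1, h2 ** \<rho> (u n) ** (\<rho> s0 ** k)) \<in> E" for n
  proof -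
    obtain t where "(t, u n) \<in> ?F" using u(1)[of n] by auto
    from push[OF this, of 0 "\<rho> s0 ** k"] show ?thesis using s0 by (simp add: matrix_mul_assoc)
  qed
  have lim: "(\<lambda>n. (h1, h2 ** \<rho> (u n) ** (\<rho> s0 ** k))) \<longlonglongrightarrow> (h1, h2 ** \<rho> (s - s0) ** (\<rho> s0 ** k))"
    by (intro tendsto_intros \<rho>lim)
  have "(h1, h2 ** \<rho> (s - s0) ** (\<rho> s0 ** k)) \<in> E" by (rule closed_sequentially[OF closed mems lim])
  moreover have "h2 ** \<rho> (s - s0) ** (\<rho> s0 ** k) = h2 ** (\<rho> (s - s0) ** \<rho> s0) ** k"
    by (simp add: matrix_mul_assoc)
  ultimately show ?thesis by (simp flip: \<rho>(1))
qed

end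

text \<open>Parametrises the diagonal group in the form required by
  \<open>wavefront\<close>.\<close>

lemma diag2_exp_arsinh:
  "diag2 (exp (arsinh y)) = sqrt (1 + y\<^sup>2) *\<^sub>R mat 1 + y *\<^sub>R mat2 1 0 0 (-1)"
proof -
  have 1: "exp (arsinh y) = y + sqrt (1 + y\<^sup>2)" for y :: real
    using arsinh_real_aux[of y] by (simp add: arsinh_real_def add.commute)
  have 2: "inverse (exp (arsinh y)) = - y + sqrt (1 + y\<^sup>2)"
    using 1[of "- y"] by (simp add: exp_minus)
  show ?thesis unfolding mat_eq_iff diag2_mat2 mat2_nth 2 by (simp add: 1)
qed

lemma commute_diag2:
  assumes "A ** diag2 l = diag2 l ** A" "l \<noteq> 0" "l \<noteq> 1" "l \<noteq> -1" "det A = 1"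
  shows "A = diag2 (A$1$1)" "A$1$1 \<noteq> 0"
proof -
  have "l * l \<noteq> 1" using assms by (simp add: square_eq_1_iff)
  then have l: "l \<noteq> inverse l" using assms(2) by (metis right_inverse)
  have "A$1$2 * inverse l = l * A$1$2" "A$2$1 * l = inverse l * A$2$1"
    using assms(1) by (auto simp: mat_eq_iff diag2_mat2)
  then have off: "A$1$2 = 0" "A$2$1 = 0" using l by (metis mult.commute mult_cancel_left)+
  then have d: "A$1$1 * A$2$2 = 1" using assms(5) by (simp add: det_2)
  then have "A$2$2 = inverse (A$1$1)" by (simp add: inverse_unique)
  then show "A = diag2 (A$1$1)" using off unfolding mat_eq_iff by (simp add: diag2_mat2)
  show "A$1$1 \<noteq> 0" using d by auto
qed

lemma exp_abs_le_norm_diag2: "exp \<bar>t\<bar> \<le> norm (diag2 (exp t))"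
  using norm_mat_entry_le[of "diag2 (exp t)" 1 1] norm_mat_entry_le[of "diag2 (exp t)" 2 2]
  by (cases "t \<ge> 0") (simp_all add: diag2_mat2 exp_minus)

section \<open>Compact tori and density of non-toral orbits\<close>

context irreducible_lattice2
begin

lemma abs_diag_mem:
  assumes h: "det h1 = 1" "det h2 = 1"
    and W: "(W1, W2) \<in> L" "adj2 h1 ** W1 ** h1 = diag2 l1" "adj2 h2 ** W2 ** h2 = diag2 l2"
  shows "(h1 ** diag2 \<bar>l1\<bar> ** adj2 h1, h2 ** diag2 \<bar>l2\<bar> ** adj2 h2) \<in> L"
proof -
  have "W1 = h1 ** diag2 l1 ** adj2 h1" "W2 = h2 ** diag2 l2 ** adj2 h2"
    using conj_flip h W by blast+
  then have "(h1 ** diag2 l1 ** adj2 h1, h2 ** diag2 l2 ** adj2 h2) \<in> L" using W(1) by simp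
  from this minus_fst[OF this] minus_snd[OF this] minus_fst[OF minus_snd[OF this]] show ?thesis
    by (simp add: abs_if diag2_minus)
qed

text \<open>A torus element z commutes with (M, N). If (P, Q) brings z into a bounded set, the
  conjugate of (M, N) by (P, Q) is bounded, hence one of finitely many. Comparing (P, Q) with a
  fixed element giving the same conjugate yields an element of the centraliser at bounded distance
  from z.\<close>

lemma centraliser_cocompact:
  assumes h: "det h1 = 1" "det h2 = 1"
    and MN: "(M, N) \<in> L" "adj2 h1 ** M ** h1 = diag2 l" "adj2 h2 ** N ** h2 = diag2 m"
    and l: "l \<noteq> 0" "l \<noteq> 1" "l \<noteq> -1" and m: "m \<noteq> 0" "m \<noteq> 1" "m \<noteq> -1"
  shows "\<exists>R. \<forall>t s. \<exists>t0 s0. (t0, s0) \<in> flow_lattice h1 h2 (\<lambda>s. diag2 (exp s)) \<and>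
    \<bar>t - t0\<bar> \<le> R \<and> \<bar>s - s0\<bar> \<le> R"
proof -
  obtain R where R: "\<And>A B. det A = 1 \<Longrightarrow> det B = 1 \<Longrightarrow>
      \<exists>P Q. (P, Q) \<in> L \<and> norm (adj2 P ** A) \<le> R \<and> norm (adj2 Q ** B) \<le> R"
    using cocompact_L by blast
  obtain P0 Q0 where "norm (adj2 P0 ** mat 1) \<le> R" using R[of "mat 1" "mat 1"] by auto
  then have R0: "R \<ge> 0" using norm_ge_zero order_trans by blast
  have M: "M = h1 ** diag2 l ** adj2 h1" and N: "N = h2 ** diag2 m ** adj2 h2"
    using conj_flip h MN by blast+
  define \<Phi> where "\<Phi> = {p \<in> L. norm (fst p) \<le> R * norm M * R \<and> norm (snd p) \<le> R * norm N * R}"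
  have "finite \<Phi>" unfolding \<Phi>_def by (rule finite_bounded_L)
  define conjs where "conjs p q \<longleftrightarrow> q \<in> L \<and> fst p = adj2 (fst q) ** M ** fst q \<and> snd p = adj2 (snd q) ** N ** snd q"
    for p q :: "(real^2^2) \<times> (real^2^2)"
  \<comment> \<open>One fixed conjugating lattice element for each conjugate in the finite set
    \<open>\<Phi>\<close>; \<open>S\<close> bounds them all.\<close>
  define \<delta> where "\<delta> p = (SOME q. conjs p q)" for p
  obtain S where S: "\<And>p. p \<in> \<Phi> \<Longrightarrow> norm (\<delta> p) \<le> S"
    using finite_imp_bounded[OF finite_imageI[OF \<open>finite \<Phi>\<close>, of \<delta>]] by (auto simp: bounded_iff)
  \<comment> \<open>\<open>P ** adj2 d\<close> is the element of the centraliser, with eigenvalue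
    \<open>k\<close> of either sign. The bounded matrix \<open>d ** adj2 P ** z\<close> is conjugate
    to the diagonal matrix of exp t / k, whose norm is at least exp \<bar>t - ln
    \<bar>k\<bar>\<bar>.\<close>
  have key: "\<bar>t - ln \<bar>k\<bar>\<bar> \<le> ln ((norm h * norm h) * (S * R))"
    if h: "det h = 1" and P: "det P = 1" and W: "adj2 h ** (P ** adj2 d) ** h = diag2 k" "k \<noteq> 0"
      and bd: "norm (adj2 P ** (h ** diag2 (exp t) ** adj2 h)) \<le> R" "norm d \<le> S" and d: "det d = 1"
    for t k h P d
  proof -
    define z where "z = h ** diag2 (exp t) ** adj2 h"
    have "P ** adj2 d = h ** diag2 k ** adj2 h" by (rule conj_flip[OF h W(1)])
    then have "d ** adj2 P = adj2 (h ** diag2 k ** adj2 h)" by (metis adj2_adj2 adj2_mult)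
    also have "\<dots> = h ** diag2 (inverse k) ** adj2 h"
      by (simp add: adj2_mult adj2_special matrix_mul_assoc)
    finally have "d ** adj2 P ** z = h ** (diag2 (inverse k) ** diag2 (exp t)) ** adj2 h"
      unfolding z_def by (simp add: matrix_mul_assoc adj2_cancel[OF h])
    then have eq: "diag2 (inverse k * exp t) = adj2 h ** (d ** (adj2 P ** z)) ** h"
      by (simp add: diag2_mult matrix_mul_assoc adj2_cancel[OF h] adj2_left[OF h])
    have "norm (diag2 (inverse k * exp t)) \<le> norm h * norm (d ** (adj2 P ** z)) * norm h"
      unfolding eq by (rule norm_conj_le)
    also have "\<dots> \<le> norm h * (S * R) * norm h"
    proof -
      have "norm (d ** (adj2 P ** z)) \<le> norm d * norm (adj2 P ** z)" by (rule norm_mat_mult_le)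
      also have "\<dots> \<le> S * R"
        using bd order_trans[OF norm_ge_zero bd(2)] by (intro mult_mono) (auto simp: z_def)
      finally show ?thesis by (simp add: mult_left_mono mult_right_mono)
    qed
    also have "\<dots> = (norm h * norm h) * (S * R)" by simp
    finally have le: "norm (diag2 (inverse k * exp t)) \<le> (norm h * norm h) * (S * R)" .
    have "norm (diag2 (exp (t - ln \<bar>k\<bar>))) = norm (diag2 (inverse k * exp t))"
    proof -
      have "exp (t - ln \<bar>k\<bar>) = \<bar>inverse k * exp t\<bar>"
        using W(2) by (simp add: exp_diff abs_mult field_simps)
      then show ?thesis by (cases "inverse k * exp t \<ge> 0") (simp_all add: diag2_minus)
    qed
    then have "exp \<bar>t - ln \<bar>k\<bar>\<bar> \<le> (norm h * norm h) * (S * R)"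
      using exp_abs_le_norm_diag2[of "t - ln \<bar>k\<bar>"] le by linarith
    then show ?thesis by (metis exp_gt_zero exp_ln ln_exp ln_mono order_less_le_trans)
  qed
  define R1 where "R1 = max (ln ((norm h1 * norm h1) * (S * R))) (ln ((norm h2 * norm h2) * (S * R)))"
  have "\<exists>t0 s0. (t0, s0) \<in> flow_lattice h1 h2 (\<lambda>s. diag2 (exp s)) \<and> \<bar>t - t0\<bar> \<le> R1 \<and> \<bar>s - s0\<bar> \<le> R1"
    for t s
  proof -
    define z1 where "z1 = h1 ** diag2 (exp t) ** adj2 h1"
    define z2 where "z2 = h2 ** diag2 (exp s) ** adj2 h2"
    have dz: "det z1 = 1" "det z2 = 1" unfolding z1_def z2_def using h by (auto intro!: det_one_mult)
    obtain P Q where PQ: "(P, Q) \<in> L" "norm (adj2 P ** z1) \<le> R" "norm (adj2 Q ** z2) \<le> R"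
      using R[OF dz] by blast
    have dPQ: "det P = 1" "det Q = 1" using PQ(1) det_fst det_snd by auto
    have cz: "z1 ** M ** adj2 z1 = M" "z2 ** N ** adj2 z2 = N"
      unfolding z1_def z2_def M N
      by (simp_all add: adj2_mult adj2_special matrix_mul_assoc adj2_cancel[OF h(1)] adj2_cancel[OF h(2)])
        (simp_all add: diag2_mult mult.commute mult.left_commute flip: matrix_mul_assoc)
    define p where "p = (adj2 P ** M ** P, adj2 Q ** N ** Q)"
    have bnd: "norm (adj2 X ** V ** X) \<le> R * norm V * R"
      if "norm (adj2 X ** z) \<le> R" "z ** V ** adj2 z = V" for X V z
    proof -
      have "adj2 X ** V ** X = (adj2 X ** z) ** V ** adj2 (adj2 X ** z)"
        by (subst that(2)[symmetric]) (simp add: adj2_mult matrix_mul_assoc)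
      also have "norm \<dots> \<le> norm (adj2 X ** z) * norm V * norm (adj2 (adj2 X ** z))"
        by (meson norm_mat_mult_le mult_right_mono norm_ge_zero order_trans)
      also have "\<dots> \<le> R * norm V * R" unfolding norm_adj2 using that(1) R0
        by (intro mult_mono mult_nonneg_nonneg) auto
      finally show ?thesis .
    qed
    have "p \<in> L" unfolding p_def using conj_L[OF adj_L[OF PQ(1)] MN(1)] by simp
    then have p\<Phi>: "p \<in> \<Phi>" unfolding \<Phi>_def p_def using bnd[OF PQ(2) cz(1)] bnd[OF PQ(3) cz(2)] by simp
    have "conjs p (P, Q)" unfolding conjs_def p_def using PQ(1) by simp
    then have "conjs p (\<delta> p)" unfolding \<delta>_def by (rule someI)
    moreover obtain d1 d2 where d12: "\<delta> p = (d1, d2)" by (cases "\<delta> p")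
    ultimately have "conjs p (d1, d2)" by simp
    then have d: "(d1, d2) \<in> L"
      "adj2 P ** M ** P = adj2 d1 ** M ** d1" "adj2 Q ** N ** Q = adj2 d2 ** N ** d2"
      by (simp_all add: conjs_def p_def)
    have dd: "det d1 = 1" "det d2 = 1" using d det_fst det_snd by auto
    have nd: "norm d1 \<le> S" "norm d2 \<le> S"
      using S[OF p\<Phi>] norm_fst_le[of d1 d2] norm_snd_le[of d2 d1] by (auto simp: d12)
    have com: "M' ** (X ** adj2 Y) = (X ** adj2 Y) ** M'"
      if "adj2 X ** M' ** X = adj2 Y ** M' ** Y" "det X = 1" "det Y = 1" for X Y M'
    proof -
      have "X ** (adj2 X ** M' ** X) ** adj2 Y = X ** (adj2 Y ** M' ** Y) ** adj2 Y" using that by simp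
      then show ?thesis
        by (simp add: matrix_mul_assoc adj2_cancel[OF that(3)] adj2_right[OF that(2)])
    qed
    have diag: "\<exists>k. k \<noteq> 0 \<and> adj2 h ** (X ** adj2 Y) ** h = diag2 k"
      if "adj2 X ** M' ** X = adj2 Y ** M' ** Y" "det X = 1" "det Y = 1" "det h = 1"
        "M' = h ** diag2 l' ** adj2 h" "l' \<noteq> 0" "l' \<noteq> 1" "l' \<noteq> -1" for X Y M' h l'
    proof -
      define A where "A = adj2 h ** (X ** adj2 Y) ** h"
      have "A ** diag2 l' = adj2 h ** ((X ** adj2 Y) ** M') ** h"
        unfolding A_def that(5) by (simp add: matrix_mul_assoc adj2_cancel[OF that(4)])
      also have "\<dots> = diag2 l' ** A"
        unfolding com[OF that(1-3), symmetric] unfolding A_def that(5)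
        by (simp add: matrix_mul_assoc adj2_cancel[OF that(4)] adj2_left[OF that(4)])
      finally have "A ** diag2 l' = diag2 l' ** A" .
      moreover have "det A = 1" unfolding A_def using that by (intro det_one_mult) auto
      ultimately show ?thesis using commute_diag2[of A l'] that(6-8) unfolding A_def by metis
    qed
    obtain k1 where k1: "k1 \<noteq> 0" "adj2 h1 ** (P ** adj2 d1) ** h1 = diag2 k1"
      using diag[OF d(2) dPQ(1) dd(1) h(1) M l] by blast
    obtain k2 where k2: "k2 \<noteq> 0" "adj2 h2 ** (Q ** adj2 d2) ** h2 = diag2 k2"
      using diag[OF d(3) dPQ(2) dd(2) h(2) N m] by blast
    have "(P ** adj2 d1, Q ** adj2 d2) \<in> L" by (intro mult_L adj_L PQ d)
    then have "(h1 ** diag2 \<bar>k1\<bar> ** adj2 h1, h2 ** diag2 \<bar>k2\<bar> ** adj2 h2) \<in> L"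
      using abs_diag_mem[OF h _ k1(2) k2(2)] by blast
    then have "(ln \<bar>k1\<bar>, ln \<bar>k2\<bar>) \<in> flow_lattice h1 h2 (\<lambda>s. diag2 (exp s))"
      using k1(1) k2(1) by (simp add: flow_lattice_def)
    moreover have "\<bar>t - ln \<bar>k1\<bar>\<bar> \<le> R1"
      using key[OF h(1) dPQ(1) k1(2,1) _ nd(1) dd(1)] PQ(2) unfolding z1_def R1_def by force
    moreover have "\<bar>s - ln \<bar>k2\<bar>\<bar> \<le> R1"
      using key[OF h(2) dPQ(2) k2(2,1) _ nd(2) dd(2)] PQ(3) unfolding z2_def R1_def by force
    ultimately show ?thesis by blast
  qed
  then show ?thesis by blast
qed

text \<open>Modulo the flow lattice the diagonal parameters can be taken in [-R, R]. In a convergent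
  sequence they subconverge, so the lattice parts converge too and their limit is in
  \<open>L\<close>.\<close>

lemma closed_diag_sat:
  assumes h: "det h1 = 1" "det h2 = 1"
    and R: "\<And>t s. \<exists>t0 s0. (t0, s0) \<in> flow_lattice h1 h2 (\<lambda>s. diag2 (exp s)) \<and>
      \<bar>t - t0\<bar> \<le> R \<and> \<bar>s - s0\<bar> \<le> R"
    and p: "p \<noteq> 0"
  shows "closed (diag_sat h1 (h2 ** diag2 p))"
proof -
  have rep: "\<exists>M N u v. (M, N) \<in> L \<and> \<bar>u\<bar> \<le> R \<and> \<bar>v\<bar> \<le> R \<and>
      x = (M ** (h1 ** diag2 (exp u)), N ** (h2 ** diag2 (p * exp v)))"
    if x: "x \<in> diag_sat h1 (h2 ** diag2 p)" for x
  proof -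
    obtain M N a b where x: "x = (M ** h1 ** diag2 a, N ** (h2 ** diag2 p) ** diag2 b)"
      "(M, N) \<in> L" "a > 0" "b > 0"
      using x unfolding diag_sat_def by blast
    obtain t s where ts: "(t, s) \<in> flow_lattice h1 h2 (\<lambda>s. diag2 (exp s))"
      "\<bar>ln a - t\<bar> \<le> R" "\<bar>ln b - s\<bar> \<le> R" using R by blast
    have a: "a = exp t * exp (ln a - t)" and b: "p * b = exp s * (p * exp (ln b - s))"
      using x(3,4) by (simp_all add: exp_diff)
    have "M ** h1 ** diag2 a = M ** (h1 ** diag2 (exp t) ** adj2 h1) ** (h1 ** diag2 (exp (ln a - t)))"
      by (subst a) (simp add: matrix_mul_assoc adj2_cancel[OF h(1)] flip: diag2_mult)
    moreover have "N ** (h2 ** diag2 p) ** diag2 b = N ** h2 ** diag2 (p * b)"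
      by (simp add: matrix_mul_assoc flip: diag2_mult)
    moreover have "N ** h2 ** diag2 (p * b) =
        N ** (h2 ** diag2 (exp s) ** adj2 h2) ** (h2 ** diag2 (p * exp (ln b - s)))"
      unfolding b by (simp add: matrix_mul_assoc adj2_cancel[OF h(2)] flip: diag2_mult)
    moreover have "(M ** (h1 ** diag2 (exp t) ** adj2 h1), N ** (h2 ** diag2 (exp s) ** adj2 h2)) \<in> L"
      using mult_L[OF x(2)] ts(1) by (simp add: flow_lattice_def)
    ultimately show ?thesis using ts(2,3) x(1) by metis
  qed
  show ?thesis
    unfolding closed_sequential_limits
  proof (intro allI impI, elim conjE)
    fix f l assume f: "\<forall>n. f n \<in> diag_sat h1 (h2 ** diag2 p)" "f \<longlonglongrightarrow> l"
    then have "\<forall>n. \<exists>M N u v. (M, N) \<in> L \<and> \<bar>u\<bar> \<le> R \<and> \<bar>v\<bar> \<le> R \<and>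
        f n = (M ** (h1 ** diag2 (exp u)), N ** (h2 ** diag2 (p * exp v)))"
      using rep by blast
    then obtain M N u v where MN: "\<And>n. (M n, N n) \<in> L" and uv: "\<And>n. \<bar>u n\<bar> \<le> R" "\<And>n. \<bar>v n\<bar> \<le> R"
      and fn: "\<And>n. f n = (M n ** (h1 ** diag2 (exp (u n))), N n ** (h2 ** diag2 (p * exp (v n))))"
      by metis
    have "bounded (range (\<lambda>n. (u n, v n)))"
    proof (rule boundedI)
      fix q assume "q \<in> range (\<lambda>n. (u n, v n))"
      then obtain n where q: "q = (u n, v n)" by blast
      show "norm q \<le> R + R" unfolding q
        by (rule order_trans[OF norm_Pair_le add_mono]) (use uv in auto)
    qed
    then obtain w r where r: "strict_mono (r :: nat \<Rightarrow> nat)" "((\<lambda>n. (u n, v n)) \<circ> r) \<longlonglongrightarrow> w"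
      using bounded_imp_convergent_subsequence[of "\<lambda>n. (u n, v n)"] by blast
    have ur: "(\<lambda>n. u (r n)) \<longlonglongrightarrow> fst w" and vr: "(\<lambda>n. v (r n)) \<longlonglongrightarrow> snd w"
      using tendsto_fst[OF r(2)] tendsto_snd[OF r(2)] by (simp_all add: o_def)
    have fr: "(\<lambda>n. f (r n)) \<longlonglongrightarrow> l" using LIMSEQ_subseq_LIMSEQ[OF f(2) r(1)] by (simp add: o_def)
    define X where "X n = h1 ** diag2 (exp (u (r n)))" for n
    define Y where "Y n = h2 ** diag2 (p * exp (v (r n)))" for n
    have dX: "det (X n) = 1" "det (Y n) = 1" for n
      unfolding X_def Y_def using h p by (auto intro!: det_one_mult)
    have X: "X \<longlonglongrightarrow> h1 ** diag2 (exp (fst w))"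
      unfolding X_def[abs_def] diag2_mat2 by (intro tendsto_intros ur) auto
    have Y: "Y \<longlonglongrightarrow> h2 ** diag2 (p * exp (snd w))"
      unfolding Y_def[abs_def] diag2_mat2 by (intro tendsto_intros vr) (use p in auto)
    have "fst (f (r n)) ** adj2 (X n) = M (r n)" "snd (f (r n)) ** adj2 (Y n) = N (r n)" for n
      unfolding fn using adj2_cancel(3)[OF dX(1)] adj2_cancel(3)[OF dX(2)] by (simp_all flip: X_def Y_def)
    then have Mlim: "(\<lambda>n. M (r n)) \<longlonglongrightarrow> fst l ** adj2 (h1 ** diag2 (exp (fst w)))"
      and Nlim: "(\<lambda>n. N (r n)) \<longlonglongrightarrow> snd l ** adj2 (h2 ** diag2 (p * exp (snd w)))"
      using tendsto_mat_mult[OF tendsto_fst[OF fr] tendsto_adj2[OF X]]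
        tendsto_mat_mult[OF tendsto_snd[OF fr] tendsto_adj2[OF Y]] by simp_all
    have mem: "(fst l ** adj2 (h1 ** diag2 (exp (fst w))), snd l ** adj2 (h2 ** diag2 (p * exp (snd w)))) \<in> L"
      by (rule limit_mem[OF MN Mlim Nlim])
    have d: "det (h1 ** diag2 (exp (fst w))) = 1" "det (h2 ** diag2 (p * exp (snd w))) = 1"
      using h p by (auto intro!: det_one_mult)
    have "fst l = fst l ** adj2 (h1 ** diag2 (exp (fst w))) ** h1 ** diag2 (exp (fst w))"
      using adj2_cancel(4)[OF d(1), of "fst l"] by (simp add: matrix_mul_assoc)
    moreover have "snd l = snd l ** adj2 (h2 ** diag2 (p * exp (snd w))) ** (h2 ** diag2 p) ** diag2 (exp (snd w))"
      using adj2_cancel(4)[OF d(2), of "snd l"] by (simp add: matrix_mul_assoc flip: diag2_mult)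
    ultimately show "l \<in> diag_sat h1 (h2 ** diag2 p)"
      using mem unfolding diag_sat_def mem_Collect_eq by (metis exp_gt_zero prod.collapse)
  qed
qed

text \<open>Multiples of one flow element suffice, since angles can be reduced modulo 2 pi. The
  curve always expands: a real \<open>k\<close> cannot diagonalise a rotation, and the entry tested
  is a sum of two squares.\<close>

lemma rot2_flow_dense:
  assumes E: "invariant_closed E" and h: "det h1 = 1" "det h2 = 1" "det k = 1"
    and mem: "(h1 ** upper2 r, h2 ** k) \<in> E"
    and F: "(t, \<theta>) \<in> flow_lattice h1 h2 rot2" and t: "t \<noteq> 0"
    and AB: "det A = 1" "det B = 1"
  shows "(A, B) \<in> E"
proof -
  let ?F = "flow_lattice h1 h2 rot2"
  have diff: "x - y \<in> ?F" if "x \<in> ?F" "y \<in> ?F" for x y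
    using flow_lattice_diff[OF h(1,2) rot2_add det_rot2, of "fst x" "snd x" "fst y" "snd y"] that
    by (simp add: minus_prod_def)
  have period: "(u, s - of_int i * (2 * pi)) \<in> ?F \<longleftrightarrow> (u, s) \<in> ?F" for u s and i :: int
  proof -
    have "cos (s - of_int i * (2 * pi)) = cos s" "sin (s - of_int i * (2 * pi)) = sin s"
      using cos_int_2pin[of i] sin_int_2pin[of i] by (simp_all add: cos_diff sin_diff mult.commute)
    then show ?thesis by (simp add: flow_lattice_def rot2_def)
  qed
  have unb: "\<exists>u s. (u, s) \<in> ?F \<and> u < - real n \<and> \<bar>s\<bar> \<le> 2 * pi" for n :: nat
  proof -
    obtain m :: nat where m: "real n / \<bar>t\<bar> < real m" using reals_Archimedean2 by blast
    \<comment> \<open>The sign makes \<open>j * t\<close> negative, so the flow contracts.\<close>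
    define j where "j = (if t > 0 then - int m else int m)"
    have "of_int j * t = - (real m * \<bar>t\<bar>)" by (simp add: j_def abs_if)
    moreover have "real n < real m * \<bar>t\<bar>" using m t by (simp add: field_simps)
    ultimately have jt: "of_int j * t < - real n" by simp
    have "of_int j *\<^sub>R (t, \<theta>) \<in> ?F" by (rule int_multiple_mem[OF diff F])
    then have "(of_int j * t, of_int j * \<theta>) \<in> ?F" by simp
    define i where "i = \<lfloor>of_int j * \<theta> / (2 * pi)\<rfloor>"
    have "of_int i \<le> of_int j * \<theta> / (2 * pi)" "of_int j * \<theta> / (2 * pi) < of_int i + 1"
      unfolding i_def by linarith+
    then have "\<bar>of_int j * \<theta> - of_int i * (2 * pi)\<bar> \<le> 2 * pi"
      by (simp add: field_simps abs_if)
    then show ?thesis using jt period \<open>(of_int j * t, of_int j * \<theta>) \<in> ?F\<close> by blast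
  qed
  have cont: "continuous_on UNIV rot2" unfolding rot2_def by (intro continuous_intros)
  have all: "(h1, h2 ** rot2 s ** k) \<in> E" for s
    by (rule flow_orbit_mem[OF E h(1,2) rot2_add det_rot2 cont unb mem])
  show ?thesis
  proof (rule wavefront[OF E h, of "\<lambda>y. sqrt (1 - y\<^sup>2)" weyl2, OF _ _ _ AB])
    have "((\<lambda>y. sqrt (1 - y\<^sup>2)) \<longlongrightarrow> sqrt (1 - 0\<^sup>2)) (nhds (0::real))"
      by (intro tendsto_intros filterlim_ident)
    then show "((\<lambda>y. sqrt (1 - y\<^sup>2)) \<longlongrightarrow> 1) (nhds (0::real))" by simp
    show "(h1, h2 ** (sqrt (1 - y\<^sup>2) *\<^sub>R mat 1 + y *\<^sub>R weyl2) ** k) \<in> E" if "\<bar>y\<bar> < 1" for y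
    proof -
      have "rot2 (arcsin y) = sqrt (1 - y\<^sup>2) *\<^sub>R mat 1 + y *\<^sub>R weyl2"
        using that by (simp add: mat_eq_iff rot2_def weyl2_def cos_arcsin)
      then show ?thesis using all[of "arcsin y"] by simp
    qed
    have "(adj2 k ** weyl2 ** k)$2$1 = (k$1$1)\<^sup>2 + (k$2$1)\<^sup>2"
      by (simp add: weyl2_def power2_eq_square)
    moreover have "k$1$1 \<noteq> 0 \<or> k$2$1 \<noteq> 0" using h(3) by (auto simp: det_2)
    ultimately show "(adj2 k ** weyl2 ** k)$2$1 \<noteq> 0 \<or> (adj2 k ** weyl2 ** k)$1$2 \<noteq> 0"
      by (simp add: sum_power2_eq_zero_iff)
  qed
qed

text \<open>The condition on \<open>k\<close> says that \<open>k\<close> does not normalise the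
  diagonal group: k^-1 diag(1, -1) k has off-diagonal entries -2 k21 k11 and 2 k12 k22.\<close>

lemma diag2_flow_dense:
  assumes E: "invariant_closed E" and h: "det h1 = 1" "det h2 = 1" "det k = 1"
    and mem: "(h1 ** upper2 r, h2 ** k) \<in> E"
    and unb: "\<And>n::nat. \<exists>t s. (t, s) \<in> flow_lattice h1 h2 (\<lambda>s. diag2 (exp s)) \<and> t < - real n \<and> \<bar>s\<bar> \<le> R"
    and k: "k$1$1 * k$2$1 \<noteq> 0 \<or> k$1$2 * k$2$2 \<noteq> 0"
    and AB: "det A = 1" "det B = 1"
  shows "(A, B) \<in> E"
proof -
  have cont: "continuous_on UNIV (\<lambda>s. diag2 (exp s))"
    unfolding diag2_mat2 by (intro continuous_intros) auto
  have all: "(h1, h2 ** diag2 (exp s) ** k) \<in> E" for s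
    by (rule flow_orbit_mem[OF E h(1,2) _ _ cont unb mem]) (simp_all add: exp_add diag2_mult)
  show ?thesis
  proof (rule wavefront[OF E h, of "\<lambda>y. sqrt (1 + y\<^sup>2)" "mat2 1 0 0 (-1)", OF _ _ _ AB])
    have "((\<lambda>y. sqrt (1 + y\<^sup>2)) \<longlongrightarrow> sqrt (1 + 0\<^sup>2)) (nhds (0::real))"
      by (intro tendsto_intros filterlim_ident)
    then show "((\<lambda>y. sqrt (1 + y\<^sup>2)) \<longlongrightarrow> 1) (nhds (0::real))" by simp
    show "(h1, h2 ** (sqrt (1 + y\<^sup>2) *\<^sub>R mat 1 + y *\<^sub>R mat2 1 0 0 (-1)) ** k) \<in> E" for y
      using all[of "arsinh y"] unfolding diag2_exp_arsinh .
    show "(adj2 k ** mat2 1 0 0 (-1) ** k)$2$1 \<noteq> 0 \<or> (adj2 k ** mat2 1 0 0 (-1) ** k)$1$2 \<noteq> 0"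
      using k by auto
  qed
qed

section \<open>The dichotomy for lifted orbits\<close>

lemma swap_invariant_closed:
  assumes "invariant_closed E"
  shows "irreducible_lattice2.invariant_closed (prod.swap ` L) (prod.swap ` E)"
proof -
  interpret S: irreducible_lattice2 "prod.swap ` L" by (rule swap_irreducible)
  have mem: "(A, B) \<in> prod.swap ` E \<longleftrightarrow> (B, A) \<in> E" for A B by force
  have "prod.swap ` E = prod.swap -` E" by force
  moreover have "closed (prod.swap -` E)"
    by (rule closed_vimage[OF invariant_closedD(1)[OF assms] continuous_on_swap])
  ultimately have "closed (prod.swap ` E)" by simp
  then show ?thesis
    unfolding S.invariant_closed_def mem mem_swap using invariant_closedD(2,3)[OF assms] by blast
qed

lemma orbit_closed_or_dense_upper:
  assumes g: "det g1 = 1" "det g2 = 1" and MN: "(M, N) \<in> L" "M \<noteq> mat 1" "M \<noteq> - mat 1"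
    and fix1: "(adj2 g1 ** M ** g1)$2$1 = 0"
  shows "closed (diag_sat g1 g2) \<or> (\<forall>A B. det A = 1 \<longrightarrow> det B = 1 \<longrightarrow> (A, B) \<in> closure (diag_sat g1 g2))"
proof -
  define E where "E = closure (diag_sat g1 g2)"
  have E: "invariant_closed E" unfolding E_def by (rule invariant_closed_closure)
  have "(mat 1 ** g1 ** diag2 1, mat 1 ** g2 ** diag2 1) \<in> diag_sat g1 g2"
    unfolding diag_sat_def using one_L zero_less_one by blast
  then have gE: "(g1, g2) \<in> E" unfolding E_def using closure_subset by fastforce
  have dMN: "det M = 1" "det N = 1" using MN det_fst det_snd by auto
  define X where "X = adj2 g1 ** M ** g1"
  define l where "l = X$1$1"
  have "det X = 1" unfolding X_def using g dMN by (intro det_one_mult) auto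
  then have X: "X$2$1 = 0" "l * X$2$2 = 1" using fix1 by (simp_all add: det_2 X_def l_def)
  have trX: "X$1$1 + X$2$2 = M$1$1 + M$2$2" unfolding X_def by (rule trace_conj[OF g(1)])
  have l: "l \<noteq> 0" "l \<noteq> 1" "l \<noteq> -1"
    using X parabolic_fst_trivial[OF MN(1)] MN(2,3) trX by (auto simp: l_def)
  have "X$2$2 = inverse l" using X(2) by (simp add: inverse_unique)
  then obtain r where r: "adj2 (upper2 r) ** X ** upper2 r = diag2 l"
    using diagonalise_upper[of X] X(1) l unfolding l_def by blast
  \<comment> \<open>\<open>h1\<close> diagonalises \<open>M\<close>, and \<open>upper2 (- r)\<close>
    is the unipotent factor to be contracted; it is trivial exactly when \<open>r\<close> is
    0.\<close>
  define h1 where "h1 = g1 ** upper2 r"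
  have dh1: "det h1 = 1" unfolding h1_def using g by (simp add: det_one_mult)
  have g1: "g1 = h1 ** upper2 (- r)"
    unfolding h1_def by (simp add: upper2_add flip: matrix_mul_assoc)
  have Mh: "adj2 h1 ** M ** h1 = diag2 l"
    using r unfolding h1_def X_def by (simp add: adj2_mult matrix_mul_assoc)
  have N1: "N \<noteq> mat 1" "N \<noteq> - mat 1"
    using snd_trivial_imp_fst_trivial[OF MN(1)] MN(2,3) by auto
  have trN: "\<bar>N$1$1 + N$2$2\<bar> \<noteq> 2"
    using cocompact_lattice2.parabolic_fst_trivial[OF swap_lattice] MN(1) N1 mem_swap by blast
  show ?thesis
  proof (cases "\<bar>N$1$1 + N$2$2\<bar> < 2")
    case True
    obtain h2 \<theta> where h2: "det h2 = 1" "N = h2 ** rot2 \<theta> ** adj2 h2"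
      using elliptic_normal_form[OF dMN(2) True] by blast
    have "M = h1 ** diag2 l ** adj2 h1" by (rule conj_flip[OF dh1 Mh])
    then have "(h1 ** diag2 \<bar>l\<bar> ** adj2 h1, N) \<in> L"
      using MN(1) minus_fst[OF MN(1)] by (simp add: abs_if diag2_minus)
    then have F: "(ln \<bar>l\<bar>, \<theta>) \<in> flow_lattice h1 h2 rot2"
      using l(1) h2(2) by (simp add: flow_lattice_def)
    have "ln \<bar>l\<bar> \<noteq> 0" using l by (auto simp: ln_eq_zero_iff abs_if)
    moreover have "(h1 ** upper2 (- r), h2 ** (adj2 h2 ** g2)) \<in> E"
      using gE g1 adj2_cancel(2)[OF h2(1)] by simp
    moreover have "det (adj2 h2 ** g2) = 1" using h2 g by (intro det_one_mult) auto
    ultimately have "(A, B) \<in> E" if "det A = 1" "det B = 1" for A B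
      using rot2_flow_dense[OF E dh1 h2(1) _ _ F _ that] by blast
    then show ?thesis unfolding E_def by blast
  next
    case False
    then have "\<bar>N$1$1 + N$2$2\<bar> > 2" using trN by simp
    then obtain h2 m where h2: "det h2 = 1" "adj2 h2 ** N ** h2 = diag2 m" "(adj2 h2 ** g2)$1$1 \<noteq> 0"
      and m: "m \<noteq> 0" "m \<noteq> 1" "m \<noteq> -1"
      using hyperbolic_normal_form[OF dMN(2), of g2] g(2) by blast
    define k where "k = adj2 h2 ** g2"
    have dk: "det k = 1" unfolding k_def using h2 g by (intro det_one_mult) auto
    have g2: "g2 = h2 ** k" unfolding k_def using adj2_cancel(2)[OF h2(1)] by simp
    let ?F = "flow_lattice h1 h2 (\<lambda>s. diag2 (exp s))"
    obtain R where R: "\<And>t s. \<exists>t0 s0. (t0, s0) \<in> ?F \<and> \<bar>t - t0\<bar> \<le> R \<and> \<bar>s - s0\<bar> \<le> R"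
      using centraliser_cocompact[OF dh1 h2(1) MN(1) Mh h2(2) l m] by blast
    \<comment> \<open>The target lies R + 1 below -n, which absorbs the error \<open>R\<close> and
      leaves t strictly below -n.\<close>
    have unb1: "\<exists>t s. (t, s) \<in> ?F \<and> t < - real n \<and> \<bar>s\<bar> \<le> R" for n :: nat
    proof -
      obtain t s where ts: "(t, s) \<in> ?F" "\<bar>(- real n - R - 1) - t\<bar> \<le> R" "\<bar>0 - s\<bar> \<le> R"
        using R[of "- real n - R - 1" 0] by blast
      have "t < - real n" "\<bar>s\<bar> \<le> R" using ts(2,3) by linarith+
      then show ?thesis using ts(1) by blast
    qed
    have unb2: "\<exists>t s. (t, s) \<in> ?F \<and> s < - real n \<and> \<bar>t\<bar> \<le> R" for n :: nat
    proof -
      obtain t s where ts: "(t, s) \<in> ?F" "\<bar>0 - t\<bar> \<le> R" "\<bar>(- real n - R - 1) - s\<bar> \<le> R"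
        using R[of 0 "- real n - R - 1"] by blast
      have "s < - real n" "\<bar>t\<bar> \<le> R" using ts(2,3) by linarith+
      then show ?thesis using ts(1) by blast
    qed
    show ?thesis
    proof (cases "k$1$1 * k$2$1 \<noteq> 0 \<or> k$1$2 * k$2$2 \<noteq> 0")
      case True
      have "(h1 ** upper2 (- r), h2 ** k) \<in> E" using gE g1 g2 by simp
      then have "(A, B) \<in> E" if "det A = 1" "det B = 1" for A B
        using diag2_flow_dense[OF E dh1 h2(1) dk _ unb1 True that] by blast
      then show ?thesis unfolding E_def by blast
    next
      case False
      \<comment> \<open>Here \<open>k\<close> normalises the diagonal group, and the choice of
        \<open>h2\<close> makes it diagonal, so that \<open>g2\<close> diagonalises
        \<open>N\<close>.\<close>
      define p where "p = k$1$1"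
      have "p \<noteq> 0" using h2(3) by (simp add: p_def k_def)
      then have k21: "k$2$1 = 0" using False by (simp add: p_def)
      then have pk: "p * k$2$2 = 1" using dk by (simp add: det_2 p_def)
      then have "k$1$2 = 0" using False by auto
      moreover have "k$2$2 = inverse p" using pk by (simp add: inverse_unique)
      ultimately have k: "k = diag2 p" using k21 by (simp add: mat_eq_iff diag2_mat2 p_def)
      show ?thesis
      proof (cases "r = 0")
        case True
        have "closed (diag_sat h1 (h2 ** diag2 p))"
          by (rule closed_diag_sat[OF dh1 h2(1) R \<open>p \<noteq> 0\<close>])
        then show ?thesis using g1 g2 k True by simp
      next
        case False
        \<comment> \<open>With the factors exchanged nothing has to be contracted
          (\<open>upper2 0\<close>), and \<open>upper2 (- r)\<close> takes the place of
          \<open>k\<close>; as \<open>r\<close> is non-zero it does not normalise the diagonal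
          group.\<close>
        interpret S: irreducible_lattice2 "prod.swap ` L" by (rule swap_irreducible)
        have SF: "(s, t) \<in> S.flow_lattice h2 h1 (\<lambda>s. diag2 (exp s)) \<longleftrightarrow> (t, s) \<in> ?F" for s t
          unfolding S.flow_lattice_def flow_lattice_def mem_Collect_eq prod.case mem_swap by (rule refl)
        have "(g1 ** diag2 1, g2 ** diag2 (inverse \<bar>p\<bar>)) \<in> E"
          using \<open>p \<noteq> 0\<close> by (intro invariant_closedD(3)[OF E] gE) auto
        moreover have "g2 ** diag2 (inverse \<bar>p\<bar>) = h2 \<or> g2 ** diag2 (inverse \<bar>p\<bar>) = - h2"
          using \<open>p \<noteq> 0\<close> unfolding g2 k
          by (cases "p > 0") (simp_all add: diag2_mult diag2_minus flip: matrix_mul_assoc)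
        ultimately have "(g1, h2) \<in> E"
          using invariant_closed_minus(2)[OF E, of g1 "- h2"] by auto
        then have "(h1 ** upper2 (- r), h2) \<in> E" using g1 by simp
        then have mem: "(h2 ** upper2 0, h1 ** upper2 (- r)) \<in> prod.swap ` E" by force
        have unb: "\<exists>t s. (t, s) \<in> S.flow_lattice h2 h1 (\<lambda>s. diag2 (exp s)) \<and> t < - real n \<and> \<bar>s\<bar> \<le> R"
          for n :: nat
          unfolding SF using unb2 by blast
        have nz: "upper2 (- r)$1$1 * upper2 (- r)$2$1 \<noteq> 0 \<or> upper2 (- r)$1$2 * upper2 (- r)$2$2 \<noteq> 0"
          using False by (simp add: upper2_def)
        have "(B, A) \<in> prod.swap ` E" if "det A = 1" "det B = 1" for A B
          by (rule S.diag2_flow_dense[OF swap_invariant_closed[OF E] h2(1) dh1 det_special(1) mem unb nz that(2,1)])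
        then show ?thesis unfolding E_def by force
      qed
    qed
  qed
qed

text \<open>The second alternative says that \<open>M\<close> fixes g1(0). Right translation by
  \<open>weyl2\<close> is a homeomorphism that preserves diagonal orbits and turns g1(0) into the
  image of \<infinity>.\<close>

lemma orbit_closed_or_dense_fst:
  assumes g: "det g1 = 1" "det g2 = 1" and MN: "(M, N) \<in> L" "M \<noteq> mat 1" "M \<noteq> - mat 1"
    and fix1: "(adj2 g1 ** M ** g1)$2$1 = 0 \<or> (adj2 g1 ** M ** g1)$1$2 = 0"
  shows "closed (diag_sat g1 g2) \<or> (\<forall>A B. det A = 1 \<longrightarrow> det B = 1 \<longrightarrow> (A, B) \<in> closure (diag_sat g1 g2))"
proof (cases "(adj2 g1 ** M ** g1)$2$1 = 0")
  case True
  then show ?thesis by (intro orbit_closed_or_dense_upper[OF g MN])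
next
  case False
  define X where "X = adj2 g1 ** M ** g1"
  define D where "D = diag_sat (g1 ** weyl2) g2"
  have dw: "det (g1 ** weyl2) = 1" using g by (simp add: det_one_mult)
  have "adj2 (g1 ** weyl2) ** M ** (g1 ** weyl2) = adj2 weyl2 ** X ** weyl2"
    by (simp add: X_def adj2_mult matrix_mul_assoc)
  then have "(adj2 (g1 ** weyl2) ** M ** (g1 ** weyl2))$2$1 = 0"
    using fix1 False by (simp add: X_def[symmetric] weyl2_def)
  from orbit_closed_or_dense_upper[OF dw g(2) MN this]
  have cases: "closed D \<or> (\<forall>A B. det A = 1 \<longrightarrow> det B = 1 \<longrightarrow> (A, B) \<in> closure D)"
    unfolding D_def .
  have comm: "weyl2 ** diag2 a = diag2 (inverse a) ** weyl2" for a
    by (simp add: mat_eq_iff special_defs)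
  have iff: "(A ** weyl2, B) \<in> D \<longleftrightarrow> (A, B) \<in> diag_sat g1 g2" for A B
  proof
    assume "(A ** weyl2, B) \<in> D"
    then obtain M N a b where *: "A ** weyl2 = M ** (g1 ** weyl2) ** diag2 a" "B = N ** g2 ** diag2 b"
      "(M, N) \<in> L" "a > 0" "b > 0" unfolding D_def diag_sat_def by blast
    have "A = A ** weyl2 ** adj2 weyl2" by (simp add: adj2_cancel[OF det_special(3)])
    also have "\<dots> = M ** g1 ** (weyl2 ** diag2 a) ** adj2 weyl2" unfolding * by (simp add: matrix_mul_assoc)
    also have "\<dots> = M ** g1 ** diag2 (inverse a)"
      unfolding comm by (simp add: matrix_mul_assoc adj2_cancel[OF det_special(3)])
    finally show "(A, B) \<in> diag_sat g1 g2"
      using * positive_imp_inverse_positive unfolding diag_sat_def by blast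
  next
    assume "(A, B) \<in> diag_sat g1 g2"
    then obtain M N a b where *: "A = M ** g1 ** diag2 a" "B = N ** g2 ** diag2 b"
      "(M, N) \<in> L" "a > 0" "b > 0" unfolding diag_sat_def by blast
    have "A ** weyl2 = M ** g1 ** (weyl2 ** diag2 (inverse a))" unfolding * comm by (simp add: matrix_mul_assoc)
    then have "A ** weyl2 = M ** (g1 ** weyl2) ** diag2 (inverse a)" by (simp add: matrix_mul_assoc)
    then show "(A ** weyl2, B) \<in> D"
      using * positive_imp_inverse_positive unfolding D_def diag_sat_def by blast
  qed
  from cases show ?thesis
  proof
    assume "closed D"
    moreover have "continuous_on UNIV (\<lambda>p :: (real^2^2) \<times> (real^2^2). (fst p ** weyl2, snd p))"
      by (intro continuous_intros)
    ultimately have "closed ((\<lambda>p. (fst p ** weyl2, snd p)) -` D)" by (rule closed_vimage)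
    moreover have "(\<lambda>p. (fst p ** weyl2, snd p)) -` D = diag_sat g1 g2" using iff by force
    ultimately show ?thesis by simp
  next
    assume dense: "\<forall>A B. det A = 1 \<longrightarrow> det B = 1 \<longrightarrow> (A, B) \<in> closure D"
    have "(A, B) \<in> closure (diag_sat g1 g2)" if AB: "det A = 1" "det B = 1" for A B
    proof -
      let ?f = "\<lambda>p :: (real^2^2) \<times> (real^2^2). (fst p ** adj2 weyl2, snd p)"
      have "continuous_on (closure D) ?f" by (intro continuous_intros)
      moreover have "?f ` D \<subseteq> closure (diag_sat g1 g2)"
      proof
        fix q assume "q \<in> ?f ` D"
        then obtain p where p: "p \<in> D" "q = ?f p" by blast
        have "(fst p ** adj2 weyl2 ** weyl2, snd p) \<in> D"
          using p(1) by (simp add: adj2_cancel[OF det_special(3)])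
        then have "q \<in> diag_sat g1 g2" unfolding iff p(2) .
        then show "q \<in> closure (diag_sat g1 g2)" using closure_subset by blast
      qed
      ultimately have "?f ` closure D \<subseteq> closure (diag_sat g1 g2)"
        by (intro image_closure_subset) auto
      moreover have "(A ** weyl2, B) \<in> closure D" using dense AB by (simp add: det_one_mult)
      ultimately have "?f (A ** weyl2, B) \<in> closure (diag_sat g1 g2)" by blast
      then show ?thesis by (simp add: adj2_cancel[OF det_special(3)])
    qed
    then show ?thesis by blast
  qed
qed

theorem orbit_closed_or_dense:
  assumes g: "det g1 = 1" "det g2 = 1" and MN: "(M, N) \<in> L"
    and nontrivial: "\<not> ((M = mat 1 \<or> M = - mat 1) \<and> (N = mat 1 \<or> N = - mat 1))"
    and fixed: "(adj2 g1 ** M ** g1)$2$1 = 0 \<or> (adj2 g1 ** M ** g1)$1$2 = 0 \<or>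
      (adj2 g2 ** N ** g2)$2$1 = 0 \<or> (adj2 g2 ** N ** g2)$1$2 = 0"
  shows "closed (diag_sat g1 g2) \<or> (\<forall>A B. det A = 1 \<longrightarrow> det B = 1 \<longrightarrow> (A, B) \<in> closure (diag_sat g1 g2))"
proof -
  \<comment> \<open>Injectivity of both projections: a non-trivial element is non-trivial in each
    component.\<close>
  have M: "M \<noteq> mat 1" "M \<noteq> - mat 1" and N: "N \<noteq> mat 1" "N \<noteq> - mat 1"
    using fst_trivial_imp_snd_trivial[OF MN] snd_trivial_imp_fst_trivial[OF MN] nontrivial by auto
  show ?thesis
  proof (cases "(adj2 g1 ** M ** g1)$2$1 = 0 \<or> (adj2 g1 ** M ** g1)$1$2 = 0")
    case True
    then show ?thesis by (rule orbit_closed_or_dense_fst[OF g MN M])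
  next
    case False
    interpret S: irreducible_lattice2 "prod.swap ` L" by (rule swap_irreducible)
    have sat: "prod.swap -` S.diag_sat g2 g1 = diag_sat g1 g2"
    proof (rule Set.set_eqI)
      fix x :: "(real^2^2) \<times> (real^2^2)"
      obtain A B where x: "x = (A, B)" by (cases x)
      show "x \<in> prod.swap -` S.diag_sat g2 g1 \<longleftrightarrow> x \<in> diag_sat g1 g2"
        unfolding x S.diag_sat_def diag_sat_def mem_swap by auto
    qed
    have "closed (S.diag_sat g2 g1) \<or> (\<forall>A B. det A = 1 \<longrightarrow> det B = 1 \<longrightarrow> (A, B) \<in> closure (S.diag_sat g2 g1))"
      using S.orbit_closed_or_dense_fst[OF g(2,1) _ N] MN False fixed unfolding mem_swap by blast
    then show ?thesis
    proof
      assume "closed (S.diag_sat g2 g1)"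
      from closed_vimage[OF this continuous_on_swap] show ?thesis unfolding sat by simp
    next
      assume dense: "\<forall>A B. det A = 1 \<longrightarrow> det B = 1 \<longrightarrow> (A, B) \<in> closure (S.diag_sat g2 g1)"
      have "prod.swap ` S.diag_sat g2 g1 \<subseteq> closure (diag_sat g1 g2)"
        unfolding sat[symmetric] using closure_subset by fastforce
      then have "prod.swap ` closure (S.diag_sat g2 g1) \<subseteq> closure (diag_sat g1 g2)"
        by (intro image_closure_subset continuous_on_swap) auto
      then show ?thesis using dense by fastforce
    qed
  qed
qed

end

section \<open>Passage to \<open>PSL(2,\<real>) \<times> PSL(2,\<real>)\<close>\<close>

lemma openin_if_preimage:
  assumes "quotient_map X Y f" "U \<subseteq> topspace Y" "openin X {x \<in> topspace X. f x \<in> U}"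
  shows "openin Y U"
  using assms unfolding quotient_map_def by blast

lemma closedin_if_preimage:
  assumes "quotient_map X Y f" "U \<subseteq> topspace Y" "closedin X {x \<in> topspace X. f x \<in> U}"
  shows "closedin Y U"
  using assms unfolding quotient_map_closedin by blast

lemma carrier_SL2: "carrier SL2 = {M. det M = 1}"
  by (simp add: SL2_def)

lemma psl_mult: "psl M \<otimes>\<^bsub>PSL2\<^esub> psl N = psl (M ** N)"
  by (auto simp: PSL2_def FactGroup_def set_mult_def psl_eq SL2_def)

lemma psl_one: "\<one>\<^bsub>PSL2\<^esub> = psl (mat 1)"
  by (auto simp: PSL2_def FactGroup_def psl_eq SL2_centre_def)

lemma psl_eq_iff: "psl M = psl N \<longleftrightarrow> M = N \<or> M = - N"
  unfolding psl_eq by (auto simp: doubleton_eq_iff)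

lemma psl_minus: "psl (- M) = psl M"
  by (simp add: psl_eq_iff)

lemma psl_cases:
  assumes "x \<in> carrier PSL2"
  obtains M where "x = psl M" "det M = 1"
  using assms unfolding carrier_PSL2 carrier_SL2 by blast

lemma psl_mem: "det M = 1 \<Longrightarrow> psl M \<in> carrier PSL2"
  unfolding carrier_PSL2 carrier_SL2 by blast

lemma inv_psl: "det M = 1 \<Longrightarrow> inv\<^bsub>PSL2\<^esub> (psl M) = psl (adj2 M)"
  by (rule group.inv_equality[OF group_PSL2]) (simp_all add: psl_mult psl_one adj2_left psl_mem)

definition psl_pair :: "(real^2^2) \<times> (real^2^2) \<Rightarrow> psl2_pair" where
  "psl_pair p = (psl (fst p), psl (snd p))"

definition SL2_pairs :: "((real^2^2) \<times> (real^2^2)) set" where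
  "SL2_pairs = {M. det M = 1} \<times> {M. det M = 1}"

lemma psl_pair_mult:
  "psl_pair (M, N) \<otimes>\<^bsub>PSL2_sq\<^esub> psl_pair (A, B) = psl_pair (M ** A, N ** B)"
  by (simp add: psl_pair_def PSL2_sq_def psl_mult)

lemma psl_pair_one: "\<one>\<^bsub>PSL2_sq\<^esub> = psl_pair (mat 1, mat 1)"
  by (simp add: psl_pair_def PSL2_sq_def psl_one one_DirProd)

lemma carrier_PSL2_sq: "carrier PSL2_sq = psl_pair ` SL2_pairs"
  by (force simp: PSL2_sq_def carrier_PSL2 carrier_SL2 psl_pair_def SL2_pairs_def)

lemma psl_pair_mem: "p \<in> SL2_pairs \<Longrightarrow> psl_pair p \<in> carrier PSL2_sq"
  unfolding carrier_PSL2_sq by blast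

lemma inv_psl_pair:
  assumes "det M = 1" "det N = 1"
  shows "inv\<^bsub>PSL2_sq\<^esub> (psl_pair (M, N)) = psl_pair (adj2 M, adj2 N)"
  using assms
  by (intro group.inv_equality[OF group_PSL2_sq])
    (simp_all add: psl_pair_mult psl_pair_one adj2_left psl_pair_mem SL2_pairs_def)

lemma quotient_map_psl: "quotient_map (top_of_set {M. det M = 1}) PSL2_top psl"
  using quotient_map_quotient_topology[of "top_of_set (carrier SL2)" psl]
  unfolding PSL2_top_def carrier_SL2 .

text \<open>The saturation of \<open>U\<close> is the union of \<open>U\<close> and -U, which is
  open.\<close>

lemma open_map_psl:
  assumes "openin (top_of_set {M. det M = 1}) U"
  shows "openin PSL2_top (psl ` U)"
proof -
  let ?S = "{M :: real^2^2. det M = 1}"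
  have US: "U \<subseteq> ?S" using assms openin_imp_subset by blast
  have "psl M \<in> psl ` U \<longleftrightarrow> M \<in> U \<or> - M \<in> U" for M
  proof
    show "psl M \<in> psl ` U \<Longrightarrow> M \<in> U \<or> - M \<in> U" by (auto simp: psl_eq_iff)
    show "M \<in> U \<or> - M \<in> U \<Longrightarrow> psl M \<in> psl ` U" using psl_minus[of M] by (metis imageI)
  qed
  then have "{M \<in> ?S. psl M \<in> psl ` U} = U \<union> (?S \<inter> uminus -` U)" using US by auto
  moreover have "continuous_on ?S uminus"
    using continuous_on_minus[OF continuous_on_id[of ?S]] by simp
  then have "openin (top_of_set ?S) (?S \<inter> uminus -` U)"
    using continuous_openin_preimage[of ?S uminus ?S U] assms by auto
  ultimately have "openin (top_of_set ?S) {M \<in> ?S. psl M \<in> psl ` U}" using assms by auto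
  moreover have "psl ` U \<subseteq> topspace PSL2_top"
    using US by (auto simp: topspace_PSL2_top carrier_PSL2 carrier_SL2)
  ultimately show ?thesis by (intro openin_if_preimage[OF quotient_map_psl]) simp_all
qed

text \<open>A product of quotient maps need not be a quotient map; openness of \<open>psl\<close>
  makes it one here.\<close>

lemma quotient_map_psl_pair: "quotient_map (top_of_set SL2_pairs) PSL2_sq_top psl_pair"
proof (rule continuous_open_imp_quotient_map)
  let ?T = "top_of_set {M :: real^2^2. det M = 1}"
  have eq: "top_of_set SL2_pairs = prod_topology ?T ?T" by (simp add: SL2_pairs_def)
  have cont: "continuous_map ?T PSL2_top psl" by (rule quotient_imp_continuous_map[OF quotient_map_psl])
  show "continuous_map (top_of_set SL2_pairs) PSL2_sq_top psl_pair"
    unfolding eq PSL2_sq_top_def psl_pair_def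
    by (intro continuous_map_pairedI continuous_map_compose[OF continuous_map_fst cont, unfolded o_def]
        continuous_map_compose[OF continuous_map_snd cont, unfolded o_def])
  show "open_map (top_of_set SL2_pairs) PSL2_sq_top psl_pair"
    unfolding open_map_def
  proof (intro allI impI)
    fix W assume W: "openin (top_of_set SL2_pairs) W"
    show "openin PSL2_sq_top (psl_pair ` W)"
      unfolding PSL2_sq_top_def openin_prod_topology_alt
    proof (intro allI impI)
      fix x y assume "(x, y) \<in> psl_pair ` W"
      then obtain p where p: "p \<in> W" "psl_pair p = (x, y)" by (metis imageE)
      define A B where "A = fst p" "B = snd p"
      have AB: "(A, B) \<in> W" "x = psl A" "y = psl B" using p by (simp_all add: A_B_def psl_pair_def)
      obtain U V where UV: "openin ?T U" "openin ?T V" "A \<in> U" "B \<in> V" "U \<times> V \<subseteq> W"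
        using W[unfolded eq openin_prod_topology_alt, rule_format, OF AB(1)] by (elim exE conjE)
      have "psl ` U \<times> psl ` V \<subseteq> psl_pair ` W"
      proof
        fix z assume "z \<in> psl ` U \<times> psl ` V"
        then obtain u v where uv: "u \<in> U" "v \<in> V" and z: "z = (psl u, psl v)" by blast
        have "(u, v) \<in> W" using uv UV(5) by blast
        moreover have "z = psl_pair (u, v)" by (simp add: z psl_pair_def)
        ultimately show "z \<in> psl_pair ` W" by (rule rev_image_eqI)
      qed
      then show "\<exists>U V. openin PSL2_top U \<and> openin PSL2_top V \<and> x \<in> U \<and> y \<in> V \<and> U \<times> V \<subseteq> psl_pair ` W"
        using open_map_psl[OF UV(1)] open_map_psl[OF UV(2)] UV(3,4) AB(2,3) by (metis imageI)
    qed
  qed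
  show "psl_pair ` topspace (top_of_set SL2_pairs) = topspace PSL2_sq_top"
    by (simp add: topspace_PSL2_sq_top carrier_PSL2_sq)
qed

definition lift_pairs :: "psl2_pair set \<Rightarrow> ((real^2^2) \<times> (real^2^2)) set" where
  "lift_pairs \<Gamma> = {p \<in> SL2_pairs. psl_pair p \<in> \<Gamma>}"

lemma psl_pair_eq_iff:
  "psl_pair (A, B) = psl_pair (C, D) \<longleftrightarrow> (A = C \<or> A = - C) \<and> (B = D \<or> B = - D)"
  by (simp add: psl_pair_def psl_eq_iff)

lemma lift_pairs_minus:
  assumes "(M, N) \<in> lift_pairs \<Gamma>"
  shows "(- M, N) \<in> lift_pairs \<Gamma>" "(M, - N) \<in> lift_pairs \<Gamma>"
  using assms by (auto simp: lift_pairs_def SL2_pairs_def psl_pair_def psl_minus)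

text \<open>The lift contains all sign choices of its elements, so the matrix equations on the right
  hold on the nose.\<close>

lemma coset_psl_pair_eq_iff:
  assumes \<Gamma>: "subgroup \<Gamma> PSL2_sq" and p: "(A, B) \<in> SL2_pairs" "(C, D) \<in> SL2_pairs"
  shows "\<Gamma> #>\<^bsub>PSL2_sq\<^esub> psl_pair (A, B) = \<Gamma> #>\<^bsub>PSL2_sq\<^esub> psl_pair (C, D) \<longleftrightarrow>
    (\<exists>M N. (M, N) \<in> lift_pairs \<Gamma> \<and> A = M ** C \<and> B = N ** D)" (is "?L \<longleftrightarrow> ?R")
proof -
  interpret group PSL2_sq by (rule group_PSL2_sq)
  interpret sub: subgroup \<Gamma> PSL2_sq by (rule \<Gamma>)
  show ?thesis
  proof
    assume ?L
    moreover have "psl_pair (A, B) \<in> \<Gamma> #>\<^bsub>PSL2_sq\<^esub> psl_pair (A, B)"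
      by (rule rcos_self[OF psl_pair_mem[OF p(1)] \<Gamma>])
    ultimately have "psl_pair (A, B) \<in> \<Gamma> #>\<^bsub>PSL2_sq\<^esub> psl_pair (C, D)" by simp
    then obtain \<gamma> where \<gamma>: "\<gamma> \<in> \<Gamma>" "psl_pair (A, B) = \<gamma> \<otimes>\<^bsub>PSL2_sq\<^esub> psl_pair (C, D)"
      by (auto simp: r_coset_def)
    obtain M N where MN: "\<gamma> = psl_pair (M, N)" "(M, N) \<in> SL2_pairs"
      using sub.mem_carrier[OF \<gamma>(1)] unfolding carrier_PSL2_sq by auto
    have L: "(M, N) \<in> lift_pairs \<Gamma>" using \<gamma>(1) MN by (simp add: lift_pairs_def)
    have "(A = M ** C \<or> A = - (M ** C)) \<and> (B = N ** D \<or> B = - (N ** D))"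
      using \<gamma>(2) unfolding MN(1) psl_pair_mult psl_pair_eq_iff .
    then show ?R
      using L lift_pairs_minus[OF L] lift_pairs_minus(2)[OF lift_pairs_minus(1)[OF L]]
      by (elim conjE disjE) (metis mat_mult_minus(1))+
  next
    assume ?R
    then obtain M N where MN: "(M, N) \<in> lift_pairs \<Gamma>" "A = M ** C" "B = N ** D" by blast
    have "psl_pair (A, B) = psl_pair (M, N) \<otimes>\<^bsub>PSL2_sq\<^esub> psl_pair (C, D)"
      unfolding MN(2,3) psl_pair_mult ..
    then have "psl_pair (A, B) \<in> \<Gamma> #>\<^bsub>PSL2_sq\<^esub> psl_pair (C, D)"
      using MN(1) by (auto simp: r_coset_def lift_pairs_def)
    then show ?L using repr_independence[OF _ psl_pair_mem[OF p(2)] \<Gamma>] by simp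
  qed
qed

lemma quotient_map_coset:
  "quotient_map (top_of_set SL2_pairs) (coset_topology PSL2_sq PSL2_sq_top \<Gamma>)
    (\<lambda>p. \<Gamma> #>\<^bsub>PSL2_sq\<^esub> psl_pair p)"
  using quotient_map_compose[OF quotient_map_psl_pair
      quotient_map_quotient_topology[of PSL2_sq_top "\<lambda>g. \<Gamma> #>\<^bsub>PSL2_sq\<^esub> g"]]
  unfolding coset_topology_def o_def .

lemma discrete_lift:
  assumes "subtopology PSL2_sq_top \<Gamma> = discrete_topology \<Gamma>" "\<one>\<^bsub>PSL2_sq\<^esub> \<in> \<Gamma>"
  shows "\<exists>e>0. \<forall>M N. (M, N) \<in> lift_pairs \<Gamma> \<longrightarrow> dist M (mat 1) < e \<longrightarrow> dist N (mat 1) < e \<longrightarrow>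
    M = mat 1 \<and> N = mat 1"
proof -
  have "openin (subtopology PSL2_sq_top \<Gamma>) {\<one>\<^bsub>PSL2_sq\<^esub>}" using assms by simp
  then obtain U where U: "openin PSL2_sq_top U" "U \<inter> \<Gamma> = {\<one>\<^bsub>PSL2_sq\<^esub>}"
    unfolding openin_subtopology by auto
  have "openin (top_of_set SL2_pairs) {p \<in> SL2_pairs. psl_pair p \<in> U}"
    using openin_continuous_map_preimage[OF quotient_imp_continuous_map[OF quotient_map_psl_pair] U(1)]
    by simp
  moreover have "(mat 1, mat 1) \<in> {p \<in> SL2_pairs. psl_pair p \<in> U}"
    using U(2) by (auto simp: SL2_pairs_def psl_pair_one)
  ultimately obtain e where e: "e > 0"
    "\<And>p. p \<in> SL2_pairs \<Longrightarrow> dist p (mat 1, mat 1) < e \<Longrightarrow> psl_pair p \<in> U"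
    unfolding openin_euclidean_subtopology_iff by blast
  have not_minus: "M \<noteq> - mat 1" if "dist M (mat 1) < 1" for M :: "real^2^2"
    using norm_mat_entry_le[of "M - mat 1" 1 1] that by (auto simp: dist_norm)
  \<comment> \<open>Half of \<open>e\<close> for each component keeps the pair within
    \<open>e\<close>; the bound 1 excludes -1, which has the same image as 1.\<close>
  have "M = mat 1 \<and> N = mat 1"
    if MN: "(M, N) \<in> lift_pairs \<Gamma>" "dist M (mat 1) < min (e / 2) 1" "dist N (mat 1) < min (e / 2) 1" for M N
  proof -
    have "dist (M, N) (mat 1, mat 1) \<le> dist M (mat 1) + dist N (mat 1)"
      unfolding dist_Pair_Pair by (simp add: sqrt_sum_squares_le_sum)
    then have "psl_pair (M, N) \<in> U" using MN by (intro e(2)) (auto simp: lift_pairs_def)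
    then have "psl_pair (M, N) = psl_pair (mat 1, mat 1)"
      using U(2) MN(1) unfolding lift_pairs_def psl_pair_one by blast
    then show ?thesis using not_minus[of M] not_minus[of N] MN(2,3) by (auto simp: psl_pair_eq_iff)
  qed
  then show ?thesis using e(1) by (intro exI[of _ "min (e / 2) 1"]) auto
qed

text \<open>The saturation of a norm ball is a union of lattice translates, so its image in the
  quotient is open. These images exhaust the compact quotient, and the largest radius of a finite
  subcover is \<open>R\<close>.\<close>

lemma cocompact_lift:
  assumes \<Gamma>: "subgroup \<Gamma> PSL2_sq" and comp: "compact_space (coset_topology PSL2_sq PSL2_sq_top \<Gamma>)"
  shows "\<exists>R. \<forall>A B. det A = 1 \<longrightarrow> det B = 1 \<longrightarrow>
    (\<exists>M N. (M, N) \<in> lift_pairs \<Gamma> \<and> norm (adj2 M ** A) \<le> R \<and> norm (adj2 N ** B) \<le> R)"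
proof -
  let ?X = "coset_topology PSL2_sq PSL2_sq_top \<Gamma>"
  define q where "q p = \<Gamma> #>\<^bsub>PSL2_sq\<^esub> psl_pair p" for p
  have qm: "quotient_map (top_of_set SL2_pairs) ?X q"
    using quotient_map_coset unfolding q_def[abs_def] .
  define b where "b n = {p \<in> SL2_pairs. norm (fst p) < n \<and> norm (snd p) < n}" for n :: real
  have pre: "{p \<in> SL2_pairs. q p \<in> q ` b n} =
      (\<Union>(M, N)\<in>lift_pairs \<Gamma>. {p \<in> SL2_pairs. norm (adj2 M ** fst p) < n \<and> norm (adj2 N ** snd p) < n})"
    (is "?l = ?r") for n
  proof (rule Set.set_eqI)
    fix p :: "(real^2^2) \<times> (real^2^2)"
    obtain A B where p: "p = (A, B)" by (cases p)
    show "p \<in> ?l \<longleftrightarrow> p \<in> ?r"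
    proof
      assume "p \<in> ?l"
      then obtain C D where CD: "(A, B) \<in> SL2_pairs" "(C, D) \<in> b n" "q (A, B) = q (C, D)"
        unfolding p by auto
      then obtain M N where MN: "(M, N) \<in> lift_pairs \<Gamma>" "A = M ** C" "B = N ** D"
        using coset_psl_pair_eq_iff[OF \<Gamma>] unfolding q_def b_def by blast
      have "det M = 1" "det N = 1" using MN(1) by (auto simp: lift_pairs_def SL2_pairs_def)
      then have "adj2 M ** A = C" "adj2 N ** B = D" using MN adj2_cancel(1) by auto
      then show "p \<in> ?r" using CD MN(1) unfolding p b_def by force
    next
      assume "p \<in> ?r"
      then obtain M N where MN: "(M, N) \<in> lift_pairs \<Gamma>" "(A, B) \<in> SL2_pairs"
        "norm (adj2 M ** A) < n" "norm (adj2 N ** B) < n" unfolding p by auto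
      have d: "det M = 1" "det N = 1" using MN(1) by (auto simp: lift_pairs_def SL2_pairs_def)
      then have S: "(adj2 M ** A, adj2 N ** B) \<in> SL2_pairs"
        using MN(2) by (auto simp: SL2_pairs_def det_one_mult)
      have "q (A, B) = q (adj2 M ** A, adj2 N ** B)"
        unfolding q_def coset_psl_pair_eq_iff[OF \<Gamma> MN(2) S] using MN(1) d adj2_cancel(2) by metis
      moreover have "(adj2 M ** A, adj2 N ** B) \<in> b n" using S MN by (simp add: b_def)
      ultimately show "p \<in> ?l" using MN(2) unfolding p by blast
    qed
  qed
  have op: "openin ?X (q ` b n)" for n
  proof -
    have "openin (top_of_set SL2_pairs)
        {p \<in> SL2_pairs. norm (adj2 M ** fst p) < n \<and> norm (adj2 N ** snd p) < n}" for M N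
    proof -
      have "open {p :: (real^2^2) \<times> (real^2^2). norm (adj2 M ** fst p) < n \<and> norm (adj2 N ** snd p) < n}"
        by (intro open_Collect_conj open_Collect_less continuous_intros)
      from openin_open_Int[OF this, of SL2_pairs] show ?thesis by (simp add: Int_def)
    qed
    then have "openin (top_of_set SL2_pairs) {p \<in> SL2_pairs. q p \<in> q ` b n}"
      unfolding pre by (intro openin_Union) auto
    moreover have "q ` b n \<subseteq> topspace ?X"
      using quotient_imp_surjective_map[OF qm] by (auto simp: b_def)
    ultimately show ?thesis by (intro openin_if_preimage[OF qm]) simp_all
  qed
  have surj: "q ` SL2_pairs = topspace ?X" using quotient_imp_surjective_map[OF qm] by simp
  define \<U> where "\<U> = range (\<lambda>n::nat. q ` b (real n))"
  have "topspace ?X \<subseteq> \<Union> \<U>"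
    unfolding surj[symmetric]
  proof (rule image_subsetI)
    fix p :: "(real^2^2) \<times> (real^2^2)" assume p: "p \<in> SL2_pairs"
    obtain n :: nat where "max (norm (fst p)) (norm (snd p)) < n" using reals_Archimedean2 by blast
    then have "p \<in> b n" using p by (simp add: b_def)
    then have "q p \<in> q ` b (real n)" by (rule imageI)
    then show "q p \<in> \<Union> \<U>" unfolding \<U>_def by (rule UN_I[OF UNIV_I])
  qed
  moreover have "\<forall>U\<in>\<U>. openin ?X U" unfolding \<U>_def by (rule ballI, elim imageE) (simp add: op)
  ultimately obtain F where F: "finite F" "F \<subseteq> \<U>" "topspace ?X \<subseteq> \<Union> F"
    using comp[unfolded compact_space_alt, rule_format, of \<U>] by blast
  obtain I :: "nat set" where I: "finite I" "F = (\<lambda>n::nat. q ` b (real n)) ` I"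
    using finite_subset_image[OF F(1) F(2)[unfolded \<U>_def]] by blast
  define R where "R = real (Max (insert 0 I))"
  have "\<exists>M N. (M, N) \<in> lift_pairs \<Gamma> \<and> norm (adj2 M ** A) \<le> R \<and> norm (adj2 N ** B) \<le> R"
    if AB: "det A = 1" "det B = 1" for A B
  proof -
    have S: "(A, B) \<in> SL2_pairs" using AB by (simp add: SL2_pairs_def)
    then have "q (A, B) \<in> topspace ?X" unfolding surj[symmetric] by (rule imageI)
    then have "q (A, B) \<in> (\<Union>n\<in>I. q ` b (real n))" using F(3) unfolding I(2) by (rule rev_subsetD)
    then obtain n where n: "n \<in> I" "q (A, B) \<in> q ` b (real n)" by (rule UN_E)
    have "real n \<le> R" unfolding R_def using I(1) n(1) by simp
    have "(A, B) \<in> {p \<in> SL2_pairs. q p \<in> q ` b (real n)}" using S n(2) by simp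
    then obtain M N where "(M, N) \<in> lift_pairs \<Gamma>" "norm (adj2 M ** A) < n" "norm (adj2 N ** B) < n"
      unfolding pre by auto
    then show ?thesis using \<open>real n \<le> R\<close> by (meson less_imp_le order_trans)
  qed
  then show ?thesis by blast
qed

lemma cocompact_lattice2_lift:
  assumes "uniform_lattice PSL2_sq PSL2_sq_top \<Gamma>"
  shows "cocompact_lattice2 (lift_pairs \<Gamma>)"
proof -
  have \<Gamma>: "subgroup \<Gamma> PSL2_sq" and disc: "subtopology PSL2_sq_top \<Gamma> = discrete_topology \<Gamma>"
    and comp: "compact_space (coset_topology PSL2_sq PSL2_sq_top \<Gamma>)"
    using assms by (simp_all add: uniform_lattice_def lattice_subgroup_def discrete_subgroup_def)
  have one: "psl_pair (mat 1, mat 1) \<in> \<Gamma>" using subgroup.one_closed[OF \<Gamma>] by (simp add: psl_pair_one)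
  then have oneL: "(mat 1, mat 1) \<in> lift_pairs \<Gamma>" by (simp add: lift_pairs_def SL2_pairs_def)
  show ?thesis
  proof
    fix M N assume MN: "(M, N) \<in> lift_pairs \<Gamma>"
    then show d: "det M = 1" "det N = 1" by (auto simp: lift_pairs_def SL2_pairs_def)
    have "inv\<^bsub>PSL2_sq\<^esub> psl_pair (M, N) \<in> \<Gamma>"
      using subgroup.m_inv_closed[OF \<Gamma>] MN by (simp add: lift_pairs_def)
    then show "(adj2 M, adj2 N) \<in> lift_pairs \<Gamma>"
      using d by (simp add: inv_psl_pair lift_pairs_def SL2_pairs_def)
    show "(M ** M', N ** N') \<in> lift_pairs \<Gamma>" if "(M', N') \<in> lift_pairs \<Gamma>" for M' N'
      using subgroup.m_closed[OF \<Gamma>, of "psl_pair (M, N)" "psl_pair (M', N')"] MN that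
      by (simp add: lift_pairs_def SL2_pairs_def psl_pair_mult det_one_mult)
  next
    show "(- mat 1, mat 1) \<in> lift_pairs \<Gamma>" "(mat 1, - mat 1) \<in> lift_pairs \<Gamma>"
      using lift_pairs_minus[OF oneL] by auto
    show "\<exists>e>0. \<forall>M N. (M, N) \<in> lift_pairs \<Gamma> \<longrightarrow> dist M (mat 1) < e \<longrightarrow> dist N (mat 1) < e \<longrightarrow>
        M = mat 1 \<and> N = mat 1"
      by (rule discrete_lift[OF disc subgroup.one_closed[OF \<Gamma>]])
  qed (rule cocompact_lift[OF \<Gamma> comp])
qed

text \<open>G(\<infinity>) is the line spanned by the first column of \<open>G\<close>; if
  \<open>M\<close> fixes it, this column is an eigenvector.\<close>

lemma mobius_fixes_first_column:
  assumes "mobius M (mobius G Infty) = mobius G Infty"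
  shows "(adj2 G ** M ** G)$2$1 = 0"
proof (cases "G$2$1 = 0")
  case True
  then show ?thesis using assms by (auto split: if_splits)
next
  case False
  define x where "x = G$1$1 / G$2$1"
  have "mobius M (Fin x) = Fin x" using assms False by (simp add: x_def)
  then have "M$2$1 * x + M$2$2 \<noteq> 0" "(M$1$1 * x + M$1$2) / (M$2$1 * x + M$2$2) = x"
    by (auto split: if_splits)
  then have "M$1$1 * x + M$1$2 = x * (M$2$1 * x + M$2$2)" by (metis nonzero_divide_eq_eq)
  then have M12: "M$1$2 = x * (M$2$1 * x + M$2$2) - M$1$1 * x" by linarith
  have G11: "G$1$1 = x * G$2$1" using False by (simp add: x_def)
  have "(adj2 G ** M ** G)$2$1 =
      G$1$1 * (M$2$1 * G$1$1 + M$2$2 * G$2$1) - G$2$1 * (M$1$1 * G$1$1 + M$1$2 * G$2$1)"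
    by (simp add: algebra_simps)
  also have "\<dots> = 0" unfolding G11 M12 by (simp add: algebra_simps)
  finally show ?thesis .
qed

lemma mobius_fixes_second_column:
  assumes "mobius M (mobius G (Fin 0)) = mobius G (Fin 0)"
  shows "(adj2 G ** M ** G)$1$2 = 0"
proof -
  have "mobius G (Fin 0) = mobius (G ** weyl2) Infty" by (simp add: weyl2_def)
  then have 1: "(adj2 (G ** weyl2) ** M ** (G ** weyl2))$2$1 = 0"
    using assms by (intro mobius_fixes_first_column) simp
  have 2: "adj2 (G ** weyl2) ** M ** (G ** weyl2) = adj2 weyl2 ** (adj2 G ** M ** G) ** weyl2"
    by (simp add: adj2_mult matrix_mul_assoc)
  have 3: "(adj2 weyl2 ** X ** weyl2)$2$1 = - (X$1$2)" for X by (simp add: weyl2_def)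
  show ?thesis using 1 unfolding 2 3 neg_equal_0_iff_equal .
qed

context irreducible_lattice2
begin

lemma diag_orbit_preimage:
  assumes L: "L = lift_pairs \<Gamma>" and \<Gamma>: "subgroup \<Gamma> PSL2_sq" and g: "det g1 = 1" "det g2 = 1"
  shows "{p \<in> SL2_pairs. \<Gamma> #>\<^bsub>PSL2_sq\<^esub> psl_pair p \<in>
    diag_orbit (\<Gamma> #>\<^bsub>PSL2_sq\<^esub> psl_pair (g1, g2))} = diag_sat g1 g2"
proof -
  interpret group PSL2_sq by (rule group_PSL2_sq)
  have translate: "(\<Gamma> #>\<^bsub>PSL2_sq\<^esub> psl_pair (g1, g2)) #>\<^bsub>PSL2_sq\<^esub> psl_pair (diag2 a, diag2 b) =
      \<Gamma> #>\<^bsub>PSL2_sq\<^esub> psl_pair (g1 ** diag2 a, g2 ** diag2 b)" if "a > 0" "b > 0" for a b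
    using that g subgroup.subset[OF \<Gamma>]
    by (subst coset_mult_assoc) (auto simp: psl_pair_mult intro!: psl_pair_mem simp: SL2_pairs_def)
  have D: "diag_subgroup = {psl_pair (diag2 a, diag2 b) | a b. a > 0 \<and> b > 0}"
    by (simp add: diag_subgroup_def psl_pair_def)
  have orbit: "y \<in> diag_orbit (\<Gamma> #>\<^bsub>PSL2_sq\<^esub> psl_pair (g1, g2)) \<longleftrightarrow>
      (\<exists>a b. a > 0 \<and> b > 0 \<and> y = \<Gamma> #>\<^bsub>PSL2_sq\<^esub> psl_pair (g1 ** diag2 a, g2 ** diag2 b))" for y
  proof
    assume "y \<in> diag_orbit (\<Gamma> #>\<^bsub>PSL2_sq\<^esub> psl_pair (g1, g2))"
    then obtain d where d: "d \<in> diag_subgroup"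
      "y = (\<Gamma> #>\<^bsub>PSL2_sq\<^esub> psl_pair (g1, g2)) #>\<^bsub>PSL2_sq\<^esub> d"
      unfolding diag_orbit_def by (rule imageE)
    then obtain a b where ab: "d = psl_pair (diag2 a, diag2 b)" "a > 0" "b > 0" unfolding D by blast
    show "\<exists>a b. a > 0 \<and> b > 0 \<and> y = \<Gamma> #>\<^bsub>PSL2_sq\<^esub> psl_pair (g1 ** diag2 a, g2 ** diag2 b)"
      using ab(2,3) d(2)[unfolded ab(1) translate[OF ab(2,3)]] by (intro exI conjI)
  next
    assume "\<exists>a b. a > 0 \<and> b > 0 \<and> y = \<Gamma> #>\<^bsub>PSL2_sq\<^esub> psl_pair (g1 ** diag2 a, g2 ** diag2 b)"
    then obtain a b where ab: "a > 0" "b > 0"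
      and y: "y = \<Gamma> #>\<^bsub>PSL2_sq\<^esub> psl_pair (g1 ** diag2 a, g2 ** diag2 b)" by (elim exE conjE)
    have "psl_pair (diag2 a, diag2 b) \<in> diag_subgroup" unfolding D using ab by blast
    then show "y \<in> diag_orbit (\<Gamma> #>\<^bsub>PSL2_sq\<^esub> psl_pair (g1, g2))"
      unfolding diag_orbit_def y translate[OF ab, symmetric] by (rule imageI)
  qed
  have S: "(g1 ** diag2 a, g2 ** diag2 b) \<in> SL2_pairs" if "a > 0" "b > 0" for a b
    using that g by (simp add: SL2_pairs_def det_one_mult)
  show ?thesis
  proof (rule Set.set_eqI)
    fix p :: "(real^2^2) \<times> (real^2^2)"
    obtain A B where p: "p = (A, B)" by (cases p)
    have "p \<in> diag_sat g1 g2 \<Longrightarrow> p \<in> SL2_pairs"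
      using g det_fst det_snd unfolding diag_sat_def by (auto simp: SL2_pairs_def intro!: det_one_mult)
    moreover have "\<Gamma> #>\<^bsub>PSL2_sq\<^esub> psl_pair p \<in> diag_orbit (\<Gamma> #>\<^bsub>PSL2_sq\<^esub> psl_pair (g1, g2)) \<longleftrightarrow>
        p \<in> diag_sat g1 g2" if "p \<in> SL2_pairs"
    proof -
      have "\<Gamma> #>\<^bsub>PSL2_sq\<^esub> psl_pair p \<in> diag_orbit (\<Gamma> #>\<^bsub>PSL2_sq\<^esub> psl_pair (g1, g2)) \<longleftrightarrow>
          (\<exists>a b. a > 0 \<and> b > 0 \<and> (\<exists>M N. (M, N) \<in> L \<and> A = M ** (g1 ** diag2 a) \<and> B = N ** (g2 ** diag2 b)))"
        unfolding orbit L p using coset_psl_pair_eq_iff[OF \<Gamma> that[unfolded p] S] by (intro ex_cong1) blast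
      also have "\<dots> \<longleftrightarrow> p \<in> diag_sat g1 g2"
        unfolding diag_sat_def p by (auto simp: matrix_mul_assoc)
      finally show ?thesis .
    qed
    ultimately show "p \<in> {p \<in> SL2_pairs. \<Gamma> #>\<^bsub>PSL2_sq\<^esub> psl_pair p \<in>
        diag_orbit (\<Gamma> #>\<^bsub>PSL2_sq\<^esub> psl_pair (g1, g2))} \<longleftrightarrow> p \<in> diag_sat g1 g2" by blast
  qed
qed

lemma coset_orbit_closed_or_dense:
  assumes L: "L = lift_pairs \<Gamma>" and \<Gamma>: "subgroup \<Gamma> PSL2_sq" and g: "det g1 = 1" "det g2 = 1"
    and dich: "closed (diag_sat g1 g2) \<or>
      (\<forall>A B. det A = 1 \<longrightarrow> det B = 1 \<longrightarrow> (A, B) \<in> closure (diag_sat g1 g2))"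
  defines "X \<equiv> coset_topology PSL2_sq PSL2_sq_top \<Gamma>"
    and "Y \<equiv> diag_orbit (\<Gamma> #>\<^bsub>PSL2_sq\<^esub> psl_pair (g1, g2))"
  shows "closedin X Y \<or> X closure_of Y = topspace X"
proof -
  define q where "q p = \<Gamma> #>\<^bsub>PSL2_sq\<^esub> psl_pair p" for p
  have qm: "quotient_map (top_of_set SL2_pairs) X q"
    using quotient_map_coset unfolding q_def[abs_def] X_def .
  have surj: "q ` SL2_pairs = topspace X" using quotient_imp_surjective_map[OF qm] by simp
  have pre: "{p \<in> SL2_pairs. q p \<in> Y} = diag_sat g1 g2"
    unfolding q_def Y_def by (rule diag_orbit_preimage[OF L \<Gamma> g])
  interpret group PSL2_sq by (rule group_PSL2_sq)
  have YX: "Y \<subseteq> topspace X"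
  proof
    fix y assume "y \<in> Y"
    then obtain a where a: "a \<in> diag_subgroup" "y = (\<Gamma> #>\<^bsub>PSL2_sq\<^esub> psl_pair (g1, g2)) #>\<^bsub>PSL2_sq\<^esub> a"
      unfolding Y_def diag_orbit_def by blast
    have gc: "psl_pair (g1, g2) \<in> carrier PSL2_sq" using g by (intro psl_pair_mem) (simp add: SL2_pairs_def)
    have ac: "a \<in> carrier PSL2_sq" using a(1) diag_subgroup_subset by blast
    have "y = \<Gamma> #>\<^bsub>PSL2_sq\<^esub> (psl_pair (g1, g2) \<otimes>\<^bsub>PSL2_sq\<^esub> a)"
      unfolding a(2) by (rule coset_mult_assoc[OF subgroup.subset[OF \<Gamma>] gc ac])
    moreover have "psl_pair (g1, g2) \<otimes>\<^bsub>PSL2_sq\<^esub> a \<in> carrier PSL2_sq" by (rule m_closed[OF gc ac])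
    ultimately show "y \<in> topspace X"
      unfolding X_def topspace_coset_topology RCOSETS_def by blast
  qed
  from dich show ?thesis
  proof
    assume "closed (diag_sat g1 g2)"
    then have "closedin (top_of_set SL2_pairs) {p \<in> SL2_pairs. q p \<in> Y}"
      unfolding pre by (intro closed_subset) (use pre in auto)
    then have "closedin X Y" by (intro closedin_if_preimage[OF qm YX]) simp
    then show ?thesis ..
  next
    assume dense: "\<forall>A B. det A = 1 \<longrightarrow> det B = 1 \<longrightarrow> (A, B) \<in> closure (diag_sat g1 g2)"
    have "topspace X \<subseteq> X closure_of Y"
    proof
      fix x assume x: "x \<in> topspace X"
      show "x \<in> X closure_of Y"
        unfolding in_closure_of
      proof (intro conjI allI impI x)
        fix T assume T: "x \<in> T \<and> openin X T"
        obtain p where p: "p \<in> SL2_pairs" "x = q p" using x surj by blast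
        have "openin (top_of_set SL2_pairs) {p \<in> SL2_pairs. q p \<in> T}"
          using openin_continuous_map_preimage[OF quotient_imp_continuous_map[OF qm]] T by auto
        then obtain e where e: "e > 0" "\<And>p'. p' \<in> SL2_pairs \<Longrightarrow> dist p' p < e \<Longrightarrow> q p' \<in> T"
          using p T unfolding openin_euclidean_subtopology_iff by blast
        have "p \<in> closure (diag_sat g1 g2)" using dense p(1) by (cases p) (simp add: SL2_pairs_def)
        then obtain p' where p': "p' \<in> diag_sat g1 g2" "dist p' p < e"
          using e(1) unfolding closure_approachable by blast
        then have "p' \<in> SL2_pairs" "q p' \<in> Y" using pre by blast+
        then show "\<exists>y. y \<in> Y \<and> y \<in> T" using e(2) p'(2) by blast
      qed
    qed
    then have "X closure_of Y = topspace X" using closure_of_subset_topspace by (metis subset_antisym)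
    then show ?thesis ..
  qed
qed

end

section \<open>Haar measure and reducibility\<close>

text \<open>A compact exhaustion; membership does not depend on the representative, since -M has the
  norm of M.\<close>

definition psl_ball :: "real \<Rightarrow> (real^2^2) set set" where
  "psl_ball r = psl ` {M. det M = 1 \<and> norm M \<le> r}"

lemma psl_ball_subset: "psl_ball r \<subseteq> carrier PSL2"
  unfolding psl_ball_def carrier_PSL2 carrier_SL2 by blast

lemma compactin_psl_ball: "compactin PSL2_top (psl_ball r)"
  unfolding psl_ball_def
proof (rule image_compactin[OF _ quotient_imp_continuous_map[OF quotient_map_psl]])
  have "{M :: real^2^2. det M = 1 \<and> norm M \<le> r} = {M. det M = 1} \<inter> cball 0 r" by auto
  moreover have "compact ({M :: real^2^2. det M = 1} \<inter> cball 0 r)"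
    by (rule closed_Int_compact[OF closed_det_one compact_cball])
  ultimately show "compactin (top_of_set {M. det M = 1}) {M :: real^2^2. det M = 1 \<and> norm M \<le> r}"
    by (auto simp: compactin_subtopology)
qed

lemma closedin_psl_ball: "closedin PSL2_top (psl_ball r)"
proof (rule closedin_if_preimage[OF quotient_map_psl])
  show "psl_ball r \<subseteq> topspace PSL2_top" by (simp add: topspace_PSL2_top psl_ball_subset)
  have "psl M \<in> psl_ball r \<longleftrightarrow> norm M \<le> r" if "det M = 1" for M
    unfolding psl_ball_def using that by (auto simp: psl_eq_iff)
  then have "{M \<in> topspace (top_of_set {M. det M = 1}). psl M \<in> psl_ball r} = {M. det M = 1} \<inter> cball 0 r"
    by auto
  then show "closedin (top_of_set {M. det M = 1}) {M \<in> topspace (top_of_set {M. det M = 1}). psl M \<in> psl_ball r}"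
    by (simp add: closedin_closed_Int)
qed

lemma openin_left_translate:
  assumes H: "det H = 1" and U: "openin PSL2_top U"
  shows "openin PSL2_top {x \<in> carrier PSL2. psl H \<otimes>\<^bsub>PSL2\<^esub> x \<in> U}"
proof (rule openin_if_preimage[OF quotient_map_psl])
  let ?T = "top_of_set {M :: real^2^2. det M = 1}"
  show "{x \<in> carrier PSL2. psl H \<otimes>\<^bsub>PSL2\<^esub> x \<in> U} \<subseteq> topspace PSL2_top" by (auto simp: topspace_PSL2_top)
  have "continuous_map ?T ?T (\<lambda>M. H ** M)"
    using H by (auto simp: det_one_mult intro!: continuous_intros)
  then have "continuous_map ?T PSL2_top (psl \<circ> (\<lambda>M. H ** M))"
    by (rule continuous_map_compose[OF _ quotient_imp_continuous_map[OF quotient_map_psl]])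
  from openin_continuous_map_preimage[OF this U]
  have "openin ?T {M \<in> topspace ?T. psl (H ** M) \<in> U}" by (simp only: o_def)
  moreover have "{M \<in> topspace ?T. psl (H ** M) \<in> U} =
      {M \<in> topspace ?T. psl M \<in> {x \<in> carrier PSL2. psl H \<otimes>\<^bsub>PSL2\<^esub> x \<in> U}}"
    by (auto simp: psl_mult psl_mem)
  ultimately show "openin ?T {M \<in> topspace ?T. psl M \<in> {x \<in> carrier PSL2. psl H \<otimes>\<^bsub>PSL2\<^esub> x \<in> U}}"
    by simp
qed

text \<open>A Haar measure \<open>\<mu>\<close> of the product yields the Haar measure \<open>A \<mapsto> \<mu> (A \<times> B)\<close> of the factor,
  where \<open>B\<close> is a compact set that is large enough for this measure not to vanish.\<close>

lemma haar_measure_factor: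
  assumes "haar_measure PSL2_sq PSL2_sq_top \<mu>"
  shows "\<exists>\<nu>. haar_measure PSL2 PSL2_top \<nu>"
proof -
  let ?C = "carrier PSL2" and ?O = "{U. openin PSL2_top U}"
  have space: "space \<mu> = ?C \<times> ?C"
    using assms by (simp add: haar_measure_def topspace_PSL2_sq_top PSL2_sq_def)
  have sets: "sets \<mu> = sigma_sets (?C \<times> ?C) {U. openin PSL2_sq_top U}"
    using assms by (simp add: haar_measure_def topspace_PSL2_sq_top PSL2_sq_def)
  have fin: "\<And>K. compactin PSL2_sq_top K \<Longrightarrow> emeasure \<mu> K < \<infinity>"
    and nonzero: "emeasure \<mu> (space \<mu>) \<noteq> 0"
    and inv: "\<And>g B. g \<in> carrier PSL2_sq \<Longrightarrow> B \<in> sets \<mu> \<Longrightarrow> emeasure \<mu> (g <#\<^bsub>PSL2_sq\<^esub> B) = emeasure \<mu> B"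
    using assms by (auto simp: haar_measure_def)
  define M1 where "M1 = sigma ?C ?O"
  have O: "?O \<subseteq> Pow ?C" using openin_subset topspace_PSL2_top by auto
  have M1: "space M1 = ?C" "sets M1 = sigma_sets ?C ?O"
    using O by (simp_all add: M1_def)
  have op: "A \<times> B \<in> sets \<mu>" if "openin PSL2_top A" "openin PSL2_top B" for A B
    unfolding sets using that by (intro sigma_sets.Basic) (simp add: PSL2_sq_top_def openin_prod_Times_iff)
  have openC: "openin PSL2_top ?C" by (metis openin_topspace topspace_PSL2_top)
  have fst_meas: "fst \<in> measurable \<mu> M1"
    unfolding M1_def
  proof (rule measurable_measure_of[OF O])
    show "fst \<in> space \<mu> \<rightarrow> ?C" by (auto simp: space)
    fix U assume U: "U \<in> ?O"
    then have "fst -` U \<inter> space \<mu> = U \<times> ?C" using O by (auto simp: space)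
    then show "fst -` U \<inter> space \<mu> \<in> sets \<mu>" using op[OF _ openC] U by simp
  qed
  have snd_meas: "snd \<in> measurable \<mu> M1"
    unfolding M1_def
  proof (rule measurable_measure_of[OF O])
    show "snd \<in> space \<mu> \<rightarrow> ?C" by (auto simp: space)
    fix U assume U: "U \<in> ?O"
    then have "snd -` U \<inter> space \<mu> = ?C \<times> U" using O by (auto simp: space)
    then show "snd -` U \<inter> space \<mu> \<in> sets \<mu>" using op[OF openC] U by simp
  qed
  have closed_sets: "B \<in> sets M1" if "closedin PSL2_top B" for B
  proof -
    have "?C - B \<in> sets M1"
      using that unfolding M1 by (intro sigma_sets.Basic) (simp add: closedin_def topspace_PSL2_top)
    then have "space M1 - (?C - B) \<in> sets M1" by (rule sets.compl_sets)
    moreover have "space M1 - (?C - B) = B"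
      using closedin_subset[OF that] by (auto simp: M1 topspace_PSL2_top)
    ultimately show ?thesis by simp
  qed
  have times: "A \<times> B \<in> sets \<mu>" if A: "A \<in> sets M1" and B: "B \<in> sets M1" for A B
  proof -
    have "(fst -` A \<inter> space \<mu>) \<inter> (snd -` B \<inter> space \<mu>) \<in> sets \<mu>"
      using fst_meas snd_meas A B by (intro sets.Int measurable_sets)
    moreover have "(fst -` A \<inter> space \<mu>) \<inter> (snd -` B \<inter> space \<mu>) = A \<times> B"
      using sets.sets_into_space[OF A] sets.sets_into_space[OF B] by (auto simp: space M1)
    ultimately show ?thesis by simp
  qed
  have C: "?C \<in> sets M1" using sets.top[of M1] by (simp add: M1)
  have ball: "psl_ball r \<in> sets M1" for r by (rule closed_sets[OF closedin_psl_ball])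
  have "\<exists>n::nat. emeasure \<mu> (?C \<times> psl_ball (real n)) \<noteq> 0"
  proof (rule ccontr)
    assume "\<not> ?thesis"
    then have "emeasure \<mu> (\<Union>n::nat. ?C \<times> psl_ball (real n)) = 0"
      by (intro emeasure_UN_eq_0) (auto intro: times C ball)
    moreover have "(\<Union>n::nat. ?C \<times> psl_ball (real n)) = space \<mu>"
    proof -
      have "x \<in> (\<Union>n::nat. psl_ball (real n))" if x: "x \<in> ?C" for x
      proof -
        obtain M where M: "x = psl M" "det M = 1" using psl_cases[OF x] by blast
        obtain n :: nat where "norm M < n" using reals_Archimedean2 by blast
        then have "x \<in> psl_ball n" unfolding psl_ball_def using M by auto
        then show ?thesis by blast
      qed
      then show ?thesis using psl_ball_subset unfolding space by blast
    qed
    ultimately show False using nonzero by simp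
  qed
  then obtain r where r: "emeasure \<mu> (?C \<times> psl_ball r) \<noteq> 0" by blast
  define B where "B = psl_ball r"
  define \<nu> where "\<nu> = distr (restrict_space \<mu> (?C \<times> B)) M1 fst"
  have CB: "?C \<times> B \<in> sets \<mu>" unfolding B_def by (intro times C ball)
  have BC: "B \<subseteq> ?C" unfolding B_def by (rule psl_ball_subset)
  have \<nu>: "emeasure \<nu> A = emeasure \<mu> (A \<times> B)" if A: "A \<in> sets M1" for A
  proof -
    have "emeasure \<nu> A = emeasure (restrict_space \<mu> (?C \<times> B)) (fst -` A \<inter> space (restrict_space \<mu> (?C \<times> B)))"
      unfolding \<nu>_def by (rule emeasure_distr[OF measurable_restrict_space1[OF fst_meas] A])
    also have "fst -` A \<inter> space (restrict_space \<mu> (?C \<times> B)) = A \<times> B"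
      using sets.sets_into_space[OF A] BC by (auto simp: space_restrict_space space M1)
    also have "emeasure (restrict_space \<mu> (?C \<times> B)) (A \<times> B) = emeasure \<mu> (A \<times> B)"
      using CB sets.sets_into_space[OF CB] sets.sets_into_space[OF A]
      by (intro emeasure_restrict_space) (auto simp: M1 Int_absorb2)
    finally show ?thesis .
  qed
  have "haar_measure PSL2 PSL2_top \<nu>"
    unfolding haar_measure_def topspace_PSL2_top
  proof (intro conjI allI impI ballI)
    show "space \<nu> = ?C" "sets \<nu> = sigma_sets ?C ?O" by (simp_all add: \<nu>_def M1)
    show "emeasure \<nu> K < \<infinity>" if "compactin PSL2_top K" for K
    proof (cases "K \<in> sets M1")
      case True
      have "compactin PSL2_sq_top (K \<times> B)"
        unfolding PSL2_sq_top_def compactin_Times B_def using that compactin_psl_ball by blast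
      then show ?thesis using \<nu>[OF True] fin by simp
    next
      \<comment> \<open>Sets outside the sigma-algebra have measure 0 by convention.\<close>
      case False
      then show ?thesis by (simp add: \<nu>_def emeasure_notin_sets)
    qed
    show "emeasure \<nu> (space \<nu>) \<noteq> 0"
      using \<nu>[OF C] r by (simp add: \<nu>_def M1 B_def)
    fix g A assume g: "g \<in> ?C" and "A \<in> sets \<nu>"
    then have A: "A \<in> sets M1" by (simp add: \<nu>_def)
    have AC: "A \<subseteq> ?C" using sets.sets_into_space[OF A] by (simp add: M1)
    obtain G where G: "g = psl G" "det G = 1" using psl_cases[OF g] by blast
    define h where "h = psl (adj2 G)"
    have h: "h \<in> ?C" using G by (simp add: h_def psl_mem)
    interpret group PSL2 by (rule group_PSL2)
    have gh: "h \<otimes>\<^bsub>PSL2\<^esub> g = \<one>\<^bsub>PSL2\<^esub>" "g \<otimes>\<^bsub>PSL2\<^esub> h = \<one>\<^bsub>PSL2\<^esub>"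
      using G by (simp_all add: h_def psl_mult psl_one adj2_left adj2_right)
    \<comment> \<open>Writing the translate as a preimage under translation by the inverse
      \<open>h\<close> gives its measurability.\<close>
    have gA: "g <#\<^bsub>PSL2\<^esub> A = (\<lambda>x. h \<otimes>\<^bsub>PSL2\<^esub> x) -` A \<inter> space M1"
    proof (rule Set.set_eqI)
      fix x
      show "x \<in> g <#\<^bsub>PSL2\<^esub> A \<longleftrightarrow> x \<in> (\<lambda>x. h \<otimes>\<^bsub>PSL2\<^esub> x) -` A \<inter> space M1"
      proof
        assume "x \<in> g <#\<^bsub>PSL2\<^esub> A"
        then obtain a where a: "a \<in> A" "x = g \<otimes>\<^bsub>PSL2\<^esub> a" by (auto simp: l_coset_def)
        have "a \<in> ?C" using a AC by blast
        then have "h \<otimes>\<^bsub>PSL2\<^esub> x = a" using g h gh(1) by (simp add: a(2) m_assoc[symmetric])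
        then show "x \<in> (\<lambda>x. h \<otimes>\<^bsub>PSL2\<^esub> x) -` A \<inter> space M1"
          using a(1) g \<open>a \<in> ?C\<close> by (simp add: M1 a(2))
      next
        assume x: "x \<in> (\<lambda>x. h \<otimes>\<^bsub>PSL2\<^esub> x) -` A \<inter> space M1"
        then have "x = g \<otimes>\<^bsub>PSL2\<^esub> (h \<otimes>\<^bsub>PSL2\<^esub> x)" using g h gh(2) by (simp add: M1 m_assoc[symmetric])
        then show "x \<in> g <#\<^bsub>PSL2\<^esub> A" using x by (auto simp: l_coset_def)
      qed
    qed
    have "(\<lambda>x. h \<otimes>\<^bsub>PSL2\<^esub> x) \<in> measurable M1 M1"
      unfolding M1_def
    proof (rule measurable_measure_of[OF O], fold M1_def)
      show "(\<lambda>x. h \<otimes>\<^bsub>PSL2\<^esub> x) \<in> space M1 \<rightarrow> ?C" using h by (auto simp: M1)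
      fix U assume "U \<in> ?O"
      then have "openin PSL2_top {x \<in> ?C. h \<otimes>\<^bsub>PSL2\<^esub> x \<in> U}"
        unfolding h_def using G by (intro openin_left_translate) auto
      moreover have "{x \<in> ?C. h \<otimes>\<^bsub>PSL2\<^esub> x \<in> U} = (\<lambda>x. h \<otimes>\<^bsub>PSL2\<^esub> x) -` U \<inter> space M1"
        by (auto simp: M1)
      ultimately show "(\<lambda>x. h \<otimes>\<^bsub>PSL2\<^esub> x) -` U \<inter> space M1 \<in> sets M1"
        unfolding M1(2) by (intro sigma_sets.Basic) simp
    qed
    then have gA_sets: "g <#\<^bsub>PSL2\<^esub> A \<in> sets M1" unfolding gA by (rule measurable_sets[OF _ A])
    have "(g, \<one>\<^bsub>PSL2\<^esub>) <#\<^bsub>PSL2_sq\<^esub> (A \<times> B) = (g <#\<^bsub>PSL2\<^esub> A) \<times> B"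
    proof -
      have "\<one>\<^bsub>PSL2\<^esub> \<otimes>\<^bsub>PSL2\<^esub> b = b" if "b \<in> B" for b using BC that by (intro l_one) blast
      then show ?thesis by (force simp: l_coset_def PSL2_sq_def)
    qed
    moreover have "(g, \<one>\<^bsub>PSL2\<^esub>) \<in> carrier PSL2_sq" using g by (simp add: PSL2_sq_def)
    moreover have "A \<times> B \<in> sets \<mu>" unfolding B_def by (intro times A ball)
    ultimately have "emeasure \<mu> ((g <#\<^bsub>PSL2\<^esub> A) \<times> B) = emeasure \<mu> (A \<times> B)" using inv by metis
    then show "emeasure \<nu> (g <#\<^bsub>PSL2\<^esub> A) = emeasure \<nu> A" using \<nu> A gA_sets by simp
  qed
  then show ?thesis ..
qed

text \<open>A strict Borel fundamental domain is obtained by covering the quotient by the images of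
  finitely many small open sets \<open>V i\<close>, on which the quotient map is injective, and removing from
  \<open>V i\<close> the translates of the preceding sets.\<close>

lemma lattice_subgroup_psl:
  assumes det: "\<And>M. M \<in> K \<Longrightarrow> det M = 1"
    and mult: "\<And>M N. M \<in> K \<Longrightarrow> N \<in> K \<Longrightarrow> M ** N \<in> K"
    and adj: "\<And>M. M \<in> K \<Longrightarrow> adj2 M \<in> K"
    and minus: "\<And>M. M \<in> K \<Longrightarrow> - M \<in> K" and one: "mat 1 \<in> K"
    and disc: "e > 0" "\<And>M. M \<in> K \<Longrightarrow> dist M (mat 1) < e \<Longrightarrow> M = mat 1"
    and cocomp: "\<And>B. det B = 1 \<Longrightarrow> \<exists>M\<in>K. norm (adj2 M ** B) \<le> R"
    and haar: "haar_measure PSL2 PSL2_top \<nu>"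
  shows "lattice_subgroup PSL2 PSL2_top (psl ` K)"
proof -
  interpret group PSL2 by (rule group_PSL2)
  have sub: "subgroup (psl ` K) PSL2"
  proof (rule subgroupI)
    show "psl ` K \<subseteq> carrier PSL2" using det psl_mem by blast
    show "psl ` K \<noteq> {}" using one by blast
    show "inv\<^bsub>PSL2\<^esub> a \<in> psl ` K" if "a \<in> psl ` K" for a
      using that det adj inv_psl by force
    show "a \<otimes>\<^bsub>PSL2\<^esub> b \<in> psl ` K" if "a \<in> psl ` K" "b \<in> psl ` K" for a b
      using that mult psl_mult by force
  qed
  obtain M0 where M0: "norm (adj2 M0 ** mat 1) \<le> R" using cocomp[of "mat 1"] by auto
  have R0: "R \<ge> 0" using order_trans[OF norm_ge_zero M0] .
  \<comment> \<open>For \<open>u\<close>, \<open>u'\<close> in one \<open>d\<close>-ball with centre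
    of norm at most \<open>R\<close>, the quotient of \<open>u'\<close> by \<open>u\<close> is
    within 2 d (R + 1) of 1; R + 2 in the denominator makes this strictly less than
    \<open>e\<close>.\<close>
  define d where "d = min 1 (e / (2 * (R + 2)))"
  have d: "d > 0" "d \<le> 1" "2 * d * (R + 1) < e"
  proof -
    show "d > 0" "d \<le> 1" using R0 disc(1) by (auto simp: d_def)
    have "d \<le> e / (2 * (R + 2))" by (simp add: d_def)
    then have "d * (2 * (R + 2)) \<le> e" using R0 by (subst (asm) pos_le_divide_eq) auto
    then show "2 * d * (R + 1) < e" using \<open>d > 0\<close> by (simp add: algebra_simps)
  qed
  have inj: "u = u'"
    if "norm c \<le> R" "dist u c < d" "dist u' c < d" "det u = 1" "u' ** adj2 u \<in> K" for c u u'
  proof -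
    have "norm u \<le> R + 1" using norm_triangle_ineq2[of u c] that(1,2) d(2) by (simp add: dist_norm)
    moreover have "dist u' u < 2 * d" using dist_triangle2[of u' u c] that(2,3) by simp
    moreover have "u' ** adj2 u - mat 1 = (u' - u) ** adj2 u"
      by (simp add: mat_mult_diff_distrib adj2_right[OF that(4)])
    then have "dist (u' ** adj2 u) (mat 1) \<le> dist u' u * norm u"
      using norm_mat_mult_le[of "u' - u" "adj2 u"] by (simp add: dist_norm)
    ultimately have "dist (u' ** adj2 u) (mat 1) \<le> 2 * d * (R + 1)"
      by (smt (verit) mult_mono norm_ge_zero zero_le_dist)
    then have "u' ** adj2 u = mat 1" using d(3) disc(2)[OF that(5)] by linarith
    then have "u' ** adj2 u ** u = u" by simp
    then show ?thesis using adj2_cancel(4)[OF that(4)] by simp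
  qed
  have S_open: "openin (top_of_set {M. det M = 1}) {x. det x = 1 \<and> dist (A ** x) c < r}" for A c :: "real^2^2" and r
  proof -
    have "open {x :: real^2^2. dist (A ** x) c < r}"
      by (intro open_Collect_less continuous_intros)
    from openin_open_Int[OF this, of "{M. det M = 1}"] show ?thesis by (simp add: Int_def)
  qed
  have discrete: "subtopology PSL2_top (psl ` K) = discrete_topology (psl ` K)"
  proof -
    have "openin (subtopology PSL2_top (psl ` K)) {x}" if "x \<in> psl ` K" for x
    proof -
      obtain k where k: "k \<in> K" "x = psl k" using \<open>x \<in> psl ` K\<close> by blast
      define V where "V = {m. det m = 1 \<and> dist (adj2 k ** m) (mat 1) < e}"
      have "m = k" if "m \<in> K" "m \<in> V" for m
      proof -
        have "adj2 k ** m = mat 1" using disc(2)[OF mult[OF adj[OF k(1)] that(1)]] that(2) by (simp add: V_def)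
        then have "k ** (adj2 k ** m) = k" by simp
        then show ?thesis using adj2_cancel(2)[OF det[OF k(1)]] by simp
      qed
      moreover have "m \<in> K" if "psl m \<in> psl ` K" for m
        using that minus by (auto simp: psl_eq_iff)
      ultimately have "psl ` V \<inter> psl ` K \<subseteq> {x}" using k by blast
      moreover have "k \<in> V" using k det disc(1) by (simp add: V_def adj2_left)
      ultimately have "psl ` V \<inter> psl ` K = {x}" using k by blast
      moreover have "openin PSL2_top (psl ` V)" unfolding V_def by (intro open_map_psl S_open)
      ultimately show ?thesis unfolding openin_subtopology by blast
    qed
    moreover have "topspace (subtopology PSL2_top (psl ` K)) = psl ` K"
      using subgroup.subset[OF sub] by (auto simp: topspace_PSL2_top)
    ultimately show ?thesis using discrete_topology_unique by metis
  qed
  have "seq_compact ({M :: real^2^2. det M = 1} \<inter> cball 0 R)"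
    by (intro compact_imp_seq_compact closed_Int_compact[OF closed_det_one compact_cball])
  from seq_compact_imp_totally_bounded[OF this, rule_format, OF d(1)] obtain Z where Z: "finite Z" "Z \<subseteq> {M :: real^2^2. det M = 1} \<inter> cball 0 R"
    "{M :: real^2^2. det M = 1} \<inter> cball 0 R \<subseteq> (\<Union>z\<in>Z. ball z d)"
    by (elim exE conjE)
  obtain n :: nat and c where c: "Z = c ` {i. i < n}"
    using finite_imp_nat_seg_image_inj_on[OF Z(1)] by blast
  have nc: "norm (c i) \<le> R" if "i < n" for i using Z(2) that unfolding c by auto
  define V where "V i = {u. det u = 1 \<and> dist u (c i) < d}" for i
  \<comment> \<open>The saturation of \<open>V i\<close> under left translation by
    \<open>K\<close>.\<close>
  define W where "W i = (\<Union>M\<in>K. {x. det x = 1 \<and> dist (adj2 M ** x) (c i) < d})" for i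
  define F where "F = (\<Union>i\<in>{..<n}. psl ` V i - (\<Union>j\<in>{..<i}. psl ` W j))"
  have openV: "openin PSL2_top (psl ` V i)" for i
    using S_open[of "mat 1"] by (intro open_map_psl) (simp add: V_def)
  have openW: "openin PSL2_top (psl ` W i)" for i
    unfolding W_def by (intro open_map_psl openin_Union) (auto intro: S_open)
  have sets: "sets \<nu> = sigma_sets (topspace PSL2_top) {U. openin PSL2_top U}"
    and finite_compact: "\<And>K. compactin PSL2_top K \<Longrightarrow> emeasure \<nu> K < \<infinity>"
    and space: "space \<nu> = topspace PSL2_top"
    using haar by (auto simp: haar_measure_def)
  have open_sets: "U \<in> sets \<nu>" if "openin PSL2_top U" for U
    unfolding sets using that by (intro sigma_sets.Basic) simp
  have F: "F \<in> sets \<nu>"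
    unfolding F_def by (intro sets.finite_UN sets.Diff open_sets openV openW) auto
  have ball: "psl_ball (R + 1) \<in> sets \<nu>"
  proof -
    have "topspace PSL2_top - psl_ball (R + 1) \<in> sets \<nu>"
      using closedin_psl_ball[of "R + 1"] by (intro open_sets) (simp add: closedin_def)
    then have "space \<nu> - (topspace PSL2_top - psl_ball (R + 1)) \<in> sets \<nu>" by (rule sets.compl_sets)
    moreover have "space \<nu> - (topspace PSL2_top - psl_ball (R + 1)) = psl_ball (R + 1)"
      using psl_ball_subset by (auto simp: space topspace_PSL2_top)
    ultimately show ?thesis by simp
  qed
  have "F \<subseteq> psl_ball (R + 1)"
  proof
    fix y assume "y \<in> F"
    then obtain i u where i: "i < n" "u \<in> V i" "y = psl u" unfolding F_def by blast
    have "norm u \<le> R + 1"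
      using norm_triangle_ineq2[of u "c i"] nc[OF i(1)] i(2) d(2) by (simp add: V_def dist_norm)
    then show "y \<in> psl_ball (R + 1)" using i by (auto simp: psl_ball_def V_def)
  qed
  then have finF: "emeasure \<nu> F < \<infinity>"
    using emeasure_mono[OF _ ball, of F] finite_compact[OF compactin_psl_ball[of "R + 1"]]
    by (meson order_le_less_trans)
  have "\<exists>!f. f \<in> F \<inter> x" if x: "x \<in> rcosets\<^bsub>PSL2\<^esub> (psl ` K)" for x
  proof -
    obtain g where g: "g \<in> carrier PSL2" "x = psl ` K #>\<^bsub>PSL2\<^esub> g" using x by (auto simp: RCOSETS_def)
    obtain B where B: "g = psl B" "det B = 1" using psl_cases[OF g(1)] by blast
    have xi: "psl u \<in> x \<longleftrightarrow> (\<exists>M\<in>K. u = M ** B)" for u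
    proof
      assume "psl u \<in> x"
      then obtain M where M: "M \<in> K" "psl u = psl (M ** B)"
        unfolding g(2) B(1) by (auto simp: r_coset_def psl_mult)
      then have "u = M ** B \<or> u = (- M) ** B" by (simp add: psl_eq_iff)
      then show "\<exists>M\<in>K. u = M ** B" using M(1) minus by blast
    next
      assume "\<exists>M\<in>K. u = M ** B"
      then show "psl u \<in> x" unfolding g(2) B(1) by (auto simp: r_coset_def psl_mult)
    qed
    define P where "P i \<longleftrightarrow> i < n \<and> (\<exists>u\<in>V i. psl u \<in> x)" for i
    obtain M where M: "M \<in> K" "norm (adj2 M ** B) \<le> R" using cocomp[OF B(2)] by blast
    define u0 where "u0 = adj2 M ** B"
    have du0: "det u0 = 1" unfolding u0_def using det[OF M(1)] B(2) by (intro det_one_mult) auto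
    then have "u0 \<in> {M. det M = 1} \<inter> cball 0 R" using M(2) by (simp add: u0_def)
    then have "u0 \<in> (\<Union>z\<in>Z. ball z d)" by (rule subsetD[OF Z(3)])
    then obtain i where "i < n" "dist u0 (c i) < d" unfolding c by (auto simp: dist_commute)
    moreover have "psl u0 \<in> x" unfolding xi u0_def using adj[OF M(1)] by blast
    ultimately have "P i" unfolding P_def V_def using du0 by blast
    \<comment> \<open>The first index whose piece meets the coset: earlier pieces miss it, and later
      pieces lose it when \<open>W k\<close> is removed. Injectivity on \<open>V k\<close> then
      gives uniqueness.\<close>
    define k where "k = (LEAST i. P i)"
    have Pk: "P k" unfolding k_def using \<open>P i\<close> by (rule LeastI)
    have least: "\<not> P j" if "j < k" for j using that unfolding k_def by (rule not_less_Least)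
    obtain u where u: "u \<in> V k" "psl u \<in> x" "k < n" using Pk unfolding P_def by blast
    obtain M1 where M1: "M1 \<in> K" "u = M1 ** B" using u(2) unfolding xi by blast
    have inW: "P j" if y: "y \<in> x" "y \<in> psl ` W j" and j: "j < n" for y j
    proof -
      obtain w M2 where w: "y = psl w" "M2 \<in> K" "det w = 1" "dist (adj2 M2 ** w) (c j) < d"
        using y(2) unfolding W_def by blast
      obtain M3 where M3: "M3 \<in> K" "w = M3 ** B" using y(1) unfolding w(1) xi by blast
      have "adj2 M2 ** w \<in> V j"
        unfolding V_def using w det[OF w(2)] by (auto intro!: det_one_mult)
      moreover have "psl (adj2 M2 ** w) \<in> x"
        unfolding xi M3(2) using mult[OF adj[OF w(2)] M3(1)] by (auto simp: matrix_mul_assoc)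
      ultimately show ?thesis unfolding P_def using j by blast
    qed
    have "psl u \<in> F"
    proof -
      have "psl u \<notin> psl ` W j" if "j < k" for j
        using inW[OF u(2)] least[OF that] that u(3) by fastforce
      then show ?thesis unfolding F_def using u by blast
    qed
    moreover have "y = psl u" if y: "y \<in> F" "y \<in> x" for y
    proof -
      obtain i where i: "i < n" "y \<in> psl ` V i" "\<And>j. j < i \<Longrightarrow> y \<notin> psl ` W j"
        using y(1) unfolding F_def by blast
      obtain v where v: "v \<in> V i" "y = psl v" using i(2) by blast
      obtain M4 where M4: "M4 \<in> K" "v = M4 ** B" using y(2) unfolding v(2) xi by blast
      have "P i" unfolding P_def using i(1) v y(2) by blast
      then have "\<not> i < k" using least by blast
      moreover have "\<not> k < i"
      proof
        assume "k < i"
        have "M4 ** adj2 M1 \<in> K" by (intro mult adj M4 M1)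
        moreover have "adj2 (M4 ** adj2 M1) ** v = u"
          unfolding adj2_mult M4(2) M1(2) using adj2_cancel(4)[OF det[OF M4(1)]]
          by (simp add: matrix_mul_assoc)
        ultimately have "v \<in> W k"
          unfolding W_def using u(1) v(1) by (auto simp: V_def intro!: bexI[of _ "M4 ** adj2 M1"])
        then show False using i(3)[OF \<open>k < i\<close>] v(2) by blast
      qed
      ultimately have "i = k" by simp
      have "v ** adj2 u = M4 ** adj2 M1"
        unfolding M4(2) M1(2) adj2_mult using adj2_cancel(3)[OF B(2)] by (simp add: matrix_mul_assoc)
      then have "v ** adj2 u \<in> K" using mult adj M4 M1 by simp
      then have "u = v"
        using v(1) u(1) \<open>i = k\<close> by (intro inj[OF nc[OF u(3)]]) (auto simp: V_def)
      then show ?thesis using v(2) by simp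
    qed
    ultimately show ?thesis using u(2) by blast
  qed
  then have "finite_covolume PSL2 PSL2_top (psl ` K)"
    unfolding finite_covolume_def by (intro exI[of _ \<nu>] exI[of _ F] conjI haar F finF ballI)
  then show ?thesis
    unfolding lattice_subgroup_def discrete_subgroup_def using sub discrete by blast
qed

text \<open>The product of the two kernels is the required product of lattices. Cocompact kernels
  allow both components of an element of \<open>\<Gamma>\<close> to be made bounded within its
  coset, so the finite set \<open>\<Phi>\<close> represents all cosets.\<close>

lemma (in cocompact_lattice2) reducible_if_kernels_cocompact:
  assumes L: "L = lift_pairs \<Gamma>" and \<Gamma>: "subgroup \<Gamma> PSL2_sq"
    and haar: "haar_measure PSL2 PSL2_top \<nu>"
    and R1: "\<And>A. det A = 1 \<Longrightarrow> \<exists>M. (M, mat 1) \<in> L \<and> norm (adj2 M ** A) \<le> R1"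
    and R2: "\<And>B. det B = 1 \<Longrightarrow> \<exists>N. (mat 1, N) \<in> L \<and> norm (adj2 N ** B) \<le> R2"
  shows "reducible_lattice \<Gamma>"
proof -
  interpret G: group PSL2_sq by (rule group_PSL2_sq)
  define K1 where "K1 = {M. (M, mat 1) \<in> L}"
  define K2 where "K2 = {N. (mat 1, N) \<in> L}"
  obtain e where e: "e > 0" "\<And>M N. (M, N) \<in> L \<Longrightarrow> dist M (mat 1) < e \<Longrightarrow> dist N (mat 1) < e \<Longrightarrow>
      M = mat 1 \<and> N = mat 1"
    using discrete_L by blast
  have l1: "lattice_subgroup PSL2 PSL2_top (psl ` K1)"
  proof (rule lattice_subgroup_psl[OF _ _ _ _ _ e(1) _ _ haar])
    show "M ** N \<in> K1" if "M \<in> K1" "N \<in> K1" for M N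
      using that mult_L[of M "mat 1" N "mat 1"] by (simp add: K1_def)
    show "adj2 M \<in> K1" if "M \<in> K1" for M using that adj_L[of M "mat 1"] by (simp add: K1_def)
    show "\<exists>M\<in>K1. norm (adj2 M ** B) \<le> R1" if "det B = 1" for B using R1[OF that] by (auto simp: K1_def)
    show "M = mat 1" if "M \<in> K1" "dist M (mat 1) < e" for M
      using e(2)[of M "mat 1"] that e(1) by (simp add: K1_def)
  qed (use one_L minus_fst det_fst in \<open>auto simp: K1_def\<close>)
  have l2: "lattice_subgroup PSL2 PSL2_top (psl ` K2)"
  proof (rule lattice_subgroup_psl[OF _ _ _ _ _ e(1) _ _ haar])
    show "M ** N \<in> K2" if "M \<in> K2" "N \<in> K2" for M N
      using that mult_L[of "mat 1" M "mat 1" N] by (simp add: K2_def)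
    show "adj2 M \<in> K2" if "M \<in> K2" for M using that adj_L[of "mat 1" M] by (simp add: K2_def)
    show "\<exists>M\<in>K2. norm (adj2 M ** B) \<le> R2" if "det B = 1" for B using R2[OF that] by (auto simp: K2_def)
    show "M = mat 1" if "M \<in> K2" "dist M (mat 1) < e" for M
      using e(2)[of "mat 1" M] that e(1) by (simp add: K2_def)
  qed (use one_L minus_snd det_snd in \<open>auto simp: K2_def\<close>)
  let ?H = "psl ` K1 \<times> psl ` K2"
  have sub1: "subgroup (psl ` K1) PSL2" and sub2: "subgroup (psl ` K2) PSL2"
    using l1 l2 by (simp_all add: lattice_subgroup_def discrete_subgroup_def)
  have sub: "subgroup ?H PSL2_sq"
    unfolding PSL2_sq_def by (rule DirProd_subgroups[OF group_PSL2 sub1 group_PSL2 sub2])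
  have K12: "(M, N) \<in> L" if "M \<in> K1" "N \<in> K2" for M N
    using mult_L[of M "mat 1" "mat 1" N] that by (simp add: K1_def K2_def)
  have H\<Gamma>: "?H \<subseteq> \<Gamma>"
  proof
    fix x assume "x \<in> ?H"
    then obtain M N where MN: "M \<in> K1" "N \<in> K2" "x = psl_pair (M, N)" by (auto simp: psl_pair_def)
    have "(M, N) \<in> lift_pairs \<Gamma>" using K12[OF MN(1,2)] L by simp
    then show "x \<in> \<Gamma>" by (simp add: MN(3) lift_pairs_def)
  qed
  define \<Phi> where "\<Phi> = {p \<in> L. norm (fst p) \<le> R1 \<and> norm (snd p) \<le> R2}"
  have fin: "finite \<Phi>" unfolding \<Phi>_def by (rule finite_bounded_L)
  have "rcosets\<^bsub>PSL2_sq\<lparr>carrier := \<Gamma>\<rparr>\<^esub> ?H \<subseteq> (\<lambda>p. ?H #>\<^bsub>PSL2_sq\<^esub> psl_pair p) ` \<Phi>"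
  proof
    fix x assume "x \<in> rcosets\<^bsub>PSL2_sq\<lparr>carrier := \<Gamma>\<rparr>\<^esub> ?H"
    then obtain a where a: "a \<in> \<Gamma>" "x = ?H #>\<^bsub>PSL2_sq\<^esub> a" by (auto simp: RCOSETS_def r_coset_def)
    obtain M N where MN: "a = psl_pair (M, N)" "(M, N) \<in> SL2_pairs"
      using subgroup.mem_carrier[OF \<Gamma> a(1)] unfolding carrier_PSL2_sq by auto
    have MNL: "(M, N) \<in> L" using a(1) MN by (simp add: L lift_pairs_def)
    obtain P where P: "(P, mat 1) \<in> L" "norm (adj2 P ** M) \<le> R1" using R1[OF det_fst[OF MNL]] by blast
    obtain Q where Q: "(mat 1, Q) \<in> L" "norm (adj2 Q ** N) \<le> R2" using R2[OF det_snd[OF MNL]] by blast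
    have "(adj2 P ** (mat 1 ** M), mat 1 ** (adj2 Q ** N)) \<in> L"
      using mult_L[OF adj_L[OF P(1)] mult_L[OF adj_L[OF Q(1)] MNL]] by simp
    then have \<Phi>: "(adj2 P ** M, adj2 Q ** N) \<in> \<Phi>" using P(2) Q(2) by (simp add: \<Phi>_def)
    have "psl_pair (adj2 P, adj2 Q) \<in> ?H"
      using adj_L[OF P(1)] adj_L[OF Q(1)] by (auto simp: psl_pair_def K1_def K2_def)
    moreover have "psl_pair (adj2 P ** M, adj2 Q ** N) = psl_pair (adj2 P, adj2 Q) \<otimes>\<^bsub>PSL2_sq\<^esub> a"
      unfolding MN(1) psl_pair_mult ..
    ultimately have "psl_pair (adj2 P ** M, adj2 Q ** N) \<in> ?H #>\<^bsub>PSL2_sq\<^esub> a"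
      unfolding r_coset_def by (intro UN_I) simp_all
    then have "x = ?H #>\<^bsub>PSL2_sq\<^esub> psl_pair (adj2 P ** M, adj2 Q ** N)"
      unfolding a(2) by (rule G.repr_independence[OF _ subgroup.mem_carrier[OF \<Gamma> a(1)] sub])
    then show "x \<in> (\<lambda>p. ?H #>\<^bsub>PSL2_sq\<^esub> psl_pair p) ` \<Phi>" by (rule image_eqI[OF _ \<Phi>])
  qed
  then have "finite (rcosets\<^bsub>PSL2_sq\<lparr>carrier := \<Gamma>\<rparr>\<^esub> ?H)" by (rule finite_surj[OF fin])
  then have fi: "finite_index_subgroup PSL2_sq ?H \<Gamma>"
    unfolding finite_index_subgroup_def by (intro conjI sub \<Gamma> H\<Gamma>)
  show ?thesis
    unfolding reducible_lattice_def
    by (rule exI[of _ "psl ` K1"], rule exI[of _ "psl ` K2"]) (rule conjI[OF l1 conjI[OF l2 fi]])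
qed

text \<open>If one projection is discrete, so is the other, and then both kernels are cocompact,
  which makes \<open>\<Gamma>\<close> reducible. Hence both projections are nondiscrete, and
  \<open>dense_fst\<close> applies to \<open>L\<close> and to its swap.\<close>

lemma irreducible_lattice2_lift:
  assumes unif: "uniform_lattice PSL2_sq PSL2_sq_top \<Gamma>" and irred: "\<not> reducible_lattice \<Gamma>"
  shows "irreducible_lattice2 (lift_pairs \<Gamma>)"
proof -
  interpret cocompact_lattice2 "lift_pairs \<Gamma>" by (rule cocompact_lattice2_lift[OF unif])
  interpret S: cocompact_lattice2 "prod.swap ` lift_pairs \<Gamma>" by (rule swap_lattice)
  let ?L = "lift_pairs \<Gamma>"
  have \<Gamma>: "subgroup \<Gamma> PSL2_sq"
    using unif by (simp add: uniform_lattice_def lattice_subgroup_def discrete_subgroup_def)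
  obtain \<mu> where "haar_measure PSL2_sq PSL2_sq_top \<mu>"
    using unif by (auto simp: uniform_lattice_def lattice_subgroup_def finite_covolume_def)
  then obtain \<nu> where haar: "haar_measure PSL2 PSL2_top \<nu>" using haar_measure_factor by blast
  have swap: "fst ` prod.swap ` ?L = snd ` ?L" "snd ` prod.swap ` ?L = fst ` ?L" by force+
  have no: False
    if d1: "e1 > 0" "\<And>M. M \<in> fst ` ?L \<Longrightarrow> dist M (mat 1) < e1 \<Longrightarrow> M = mat 1"
      and d2: "e2 > 0" "\<And>N. N \<in> snd ` ?L \<Longrightarrow> dist N (mat 1) < e2 \<Longrightarrow> N = mat 1" for e1 e2 :: real
  proof -
    obtain R2 where R2: "\<And>B. det B = 1 \<Longrightarrow> \<exists>N. (mat 1, N) \<in> ?L \<and> norm (adj2 N ** B) \<le> R2"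
      using kernel_cocompact[OF d1] by blast
    obtain R1 where R1: "\<And>A. det A = 1 \<Longrightarrow> \<exists>M. (M, mat 1) \<in> ?L \<and> norm (adj2 M ** A) \<le> R1"
      using S.kernel_cocompact[OF d2(1)] d2(2) unfolding swap mem_swap by blast
    show False using reducible_if_kernels_cocompact[OF refl \<Gamma> haar R1 R2] irred by blast
  qed
  have "\<exists>M\<in>fst ` ?L. M \<noteq> mat 1 \<and> dist M (mat 1) < e" if "e > 0" for e
  proof (rule ccontr)
    assume "\<not> ?thesis"
    then have d1: "M = mat 1" if "M \<in> fst ` ?L" "dist M (mat 1) < e" for M using that by blast
    then show False using discrete_snd_if_discrete_fst[OF \<open>e > 0\<close> d1] no[OF \<open>e > 0\<close> d1] by blast
  qed
  moreover have "\<exists>N\<in>snd ` ?L. N \<noteq> mat 1 \<and> dist N (mat 1) < e" if "e > 0" for e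
  proof (rule ccontr)
    assume "\<not> ?thesis"
    then have d2: "N = mat 1" if "N \<in> snd ` ?L" "dist N (mat 1) < e" for N using that by blast
    then obtain e' where "e' > 0" "\<And>M. M \<in> fst ` ?L \<Longrightarrow> dist M (mat 1) < e' \<Longrightarrow> M = mat 1"
      using S.discrete_snd_if_discrete_fst[OF \<open>e > 0\<close>] unfolding swap by blast
    then show False using no[OF _ _ \<open>e > 0\<close> d2] by blast
  qed
  ultimately show ?thesis
    unfolding irreducible_lattice2_def irreducible_lattice2_axioms_def
    using cocompact_lattice2_axioms dense_fst S.dense_fst unfolding swap by blast
qed

theorem corollary1p6:
  fixes \<Gamma> :: "psl2_pair set" and g\<^sub>1 g\<^sub>2 :: "(real^2^2) set" and x :: "psl2_pair set"
  assumes "uniform_lattice PSL2_sq PSL2_sq_top \<Gamma>"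
    and "\<not> reducible_lattice \<Gamma>"
    and "(g\<^sub>1, g\<^sub>2) \<in> carrier PSL2_sq"
    and "x = \<Gamma> #>\<^bsub>PSL2_sq\<^esub> (g\<^sub>1, g\<^sub>2)"
    and "\<exists>(\<gamma>\<^sub>1, \<gamma>\<^sub>2) \<in> \<Gamma>. (\<gamma>\<^sub>1, \<gamma>\<^sub>2) \<noteq> \<one>\<^bsub>PSL2_sq\<^esub> \<and>
           ((\<exists>\<xi> \<in> {psl_act g\<^sub>1 (Fin 0), psl_act g\<^sub>1 Infty}. psl_act \<gamma>\<^sub>1 \<xi> = \<xi>) \<or>
            (\<exists>\<xi> \<in> {psl_act g\<^sub>2 (Fin 0), psl_act g\<^sub>2 Infty}. psl_act \<gamma>\<^sub>2 \<xi> = \<xi>))"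
  shows "closedin (coset_topology PSL2_sq PSL2_sq_top \<Gamma>) (diag_orbit x) \<or>
         coset_topology PSL2_sq PSL2_sq_top \<Gamma> closure_of diag_orbit x =
           topspace (coset_topology PSL2_sq PSL2_sq_top \<Gamma>)"
proof -
  interpret irreducible_lattice2 "lift_pairs \<Gamma>"
    by (rule irreducible_lattice2_lift[OF assms(1,2)])
  have \<Gamma>: "subgroup \<Gamma> PSL2_sq"
    using assms(1) by (simp add: uniform_lattice_def lattice_subgroup_def discrete_subgroup_def)
  obtain G1 G2 where G: "det G1 = 1" "det G2 = 1" "g\<^sub>1 = psl G1" "g\<^sub>2 = psl G2"
    using assms(3) unfolding carrier_PSL2_sq by (auto simp: SL2_pairs_def psl_pair_def)
  obtain c1 c2 where c: "(c1, c2) \<in> \<Gamma>" "(c1, c2) \<noteq> \<one>\<^bsub>PSL2_sq\<^esub>"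
    "(\<exists>\<xi> \<in> {psl_act g\<^sub>1 (Fin 0), psl_act g\<^sub>1 Infty}. psl_act c1 \<xi> = \<xi>) \<or>
     (\<exists>\<xi> \<in> {psl_act g\<^sub>2 (Fin 0), psl_act g\<^sub>2 Infty}. psl_act c2 \<xi> = \<xi>)"
    using assms(5) by auto
  obtain M N where MN: "(M, N) \<in> SL2_pairs" "c1 = psl M" "c2 = psl N"
    using subgroup.mem_carrier[OF \<Gamma> c(1)] unfolding carrier_PSL2_sq by (auto simp: psl_pair_def)
  have MNL: "(M, N) \<in> lift_pairs \<Gamma>" using c(1) MN by (simp add: lift_pairs_def psl_pair_def)
  have nontrivial: "\<not> ((M = mat 1 \<or> M = - mat 1) \<and> (N = mat 1 \<or> N = - mat 1))"
    using c(2) MN(2,3) by (simp add: psl_pair_one psl_pair_def psl_eq_iff)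
  have "mobius M (mobius G1 (Fin 0)) = mobius G1 (Fin 0) \<or> mobius M (mobius G1 Infty) = mobius G1 Infty \<or>
      mobius N (mobius G2 (Fin 0)) = mobius G2 (Fin 0) \<or> mobius N (mobius G2 Infty) = mobius G2 Infty"
    using c(3) unfolding G(3,4) MN(2,3) psl_act_psl by blast
  then have "(adj2 G1 ** M ** G1)$2$1 = 0 \<or> (adj2 G1 ** M ** G1)$1$2 = 0 \<or>
      (adj2 G2 ** N ** G2)$2$1 = 0 \<or> (adj2 G2 ** N ** G2)$1$2 = 0"
    using mobius_fixes_first_column mobius_fixes_second_column by blast
  from orbit_closed_or_dense[OF G(1,2) MNL nontrivial this]
  have "closedin (coset_topology PSL2_sq PSL2_sq_top \<Gamma>) (diag_orbit (\<Gamma> #>\<^bsub>PSL2_sq\<^esub> psl_pair (G1, G2))) \<or>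
      coset_topology PSL2_sq PSL2_sq_top \<Gamma> closure_of diag_orbit (\<Gamma> #>\<^bsub>PSL2_sq\<^esub> psl_pair (G1, G2)) =
        topspace (coset_topology PSL2_sq PSL2_sq_top \<Gamma>)"
    by (rule coset_orbit_closed_or_dense[OF refl \<Gamma> G(1,2)])
  moreover have "x = \<Gamma> #>\<^bsub>PSL2_sq\<^esub> psl_pair (G1, G2)" using assms(4) G(3,4) by (simp add: psl_pair_def)
  ultimately show ?thesis by simp
qed


end
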